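(* Let $\mathbf h=(\mathbf p,\nabla,\Delta)$ be a connected Hopf monoid which is finite-dimensional, commutative, cocommutative, and strongly linearized in some basis $\mathrm P$ for $\mathbf p$, and let $m_\bullet,p_\bullet,e_\bullet,h_\bullet$ be the associated set subspecies of $\mathbf p$. Then each of $m_\bullet$, $p_\bullet$, $e_\bullet$, $h_\bullet$ is a basis for $\mathbf p$. On these bases, for disjoint finite sets $S$ and $T$ and indices $\alpha\in\mathrm P[S]$, $\beta\in\mathrm P[T]$, $\lambda\in\mathrm P[S\sqcup T]$, the product and coproduct of $\mathbf h$ have the following formulas: (a) When $x\in\{p,e,h\}$ and $y\in\{m\}$, $$\nabla_{S,T}(x_\alpha\otimes x_\beta)=x_{\alpha\cdot\beta}\quad\text{and}\quad\nabla_{S,T}(y_\alpha\otimes y_\beta)=\sum_{\substack{\gamma\in\mathrm P[S\sqcup T]\\ \gamma|_S=\alpha\text{ and }\gamma|_T=\beta}}y_\gamma.$$ (b) When $x\in\{e,h\}$ and $y\in\{m,p\}$, $$\Delta_{S,T}(x_\lambda)=x_{\lambda|_S}\otimes x_{\lambda|_T}\quad\text{and}\quad\Delta_{S,T}(y_\lambda)=\begin{cases}y_{\lambda|_S}\otimes y_{\lambda|_T}&\text{if }\lambda\in\mathrm{Image}(\nabla_{S,T})\\0&\text{otherwise.}\end{cases}$$ In particular, the natural changes of basis $p_\bullet\leftrightarrow h_\bullet$, $p_\bullet\leftrightarrow m_\bullet$, and $e_\bullet\leftrightarrow h_\bullet$ (the linear maps $p_\lambda\leftrightarrow h_\lambda$,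 $p_\lambda\leftrightarrow m_\lambda$, $e_\lambda\leftrightarrow h_\lambda$) are respectively isomorphisms of connected monoids, connected comonoids, and connected Hopf monoids. Moreover, $\mathbf h$ is strongly linearized in each of the bases $e_\bullet$ and $h_\bullet$, and strongly self-dual in the basis $p_\bullet$.
   Context: $\mathbb K$ is a field of characteristic zero. **Species.** A set species (resp. vector species) is a functor from the category of finite sets with bijections to sets (resp. $\mathbb K$-vector spaces); morphisms are natural transformations. A set subspecies of a species $\mathrm P$ assigns to each finite set $S$ a subset of $\mathrm P[S]$, stable under all maps $\mathrm P[\sigma]$. A connected species is a vector species $\mathbf p$ with mutually inverse linear isomorphisms $\mathbb K\to\mathbf p[\varnothing]$ (unit) and $\mathbf p[\varnothing]\to\mathbb K$ (counit); $1_{\mathbf p}$ is the image of $1_{\mathbb K}$ under the unit. Morphisms of connected species are natural transformations $f$ with $f_\varnothing(1_{\mathbf p})=1_{\mathbf p'}$. Finite-dimensional means every $\mathbf p[S]$ is finite-dimensional. **Hopf monoids.** A product $\nabla$ (resp. coproduct $\Delta$) on $\mathbf p$ is a family of linear maps $\nabla_{S,T}:\mathbf p[S]\otimes\mathbf p[T]\to\mathbf p[S\sqcup T]$ (resp. $\Delta_{S,T}:\mathbf p[S\sqcup T]\to\mathbf p[S]\otimes\mathbf p[T]$) for all ordered pairs of disjoint finite sets, natural with respect to bijections $S\sqcup T\to S'\sqcup T'$ carrying $S$ to $S'$ and $T$ to $T'$. The product is associative if $\nabla_{R\sqcup S,T}(\nabla_{R,S}\otimes\mathrm{id})=\nabla_{R,S\sqcup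 T}(\mathrm{id}\otimes\nabla_{S,T})$, and commutative if $\nabla_{S,T}(x\otimes y)=\nabla_{T,S}(y\otimes x)$; coassociativity and cocommutativity of $\Delta$ are the dual conditions. $(\mathbf p,\nabla)$ is a connected monoid if $\nabla$ is associative and $\nabla_{\varnothing,S}(1_{\mathbf p}\otimes\lambda)=\nabla_{S,\varnothing}(\lambda\otimes1_{\mathbf p})=\lambda$. $(\mathbf p,\Delta)$ is a connected comonoid if $\Delta$ is coassociative and $\Delta_{\varnothing,S}(\lambda)=1_{\mathbf p}\otimes\lambda$, $\Delta_{S,\varnothing}(\lambda)=\lambda\otimes1_{\mathbf p}$. $(\mathbf p,\nabla,\Delta)$ is a connected Hopf monoid if it is a connected monoid and a connected comonoid and, for any two decompositions $I=R\sqcup R'=S\sqcup S'$, with $A=R\cap S$, $B=R\cap S'$, $A'=R'\cap S$, $B'=R'\cap S'$, one has $\Delta_{S,S'}\circ\nabla_{R,R'}=(\nabla_{A,A'}\otimes\nabla_{B,B'})\circ\tau\circ(\Delta_{A,B}\otimes\Delta_{A',B'})$, where $\tau$ swaps the two middle tensor factors. Morphisms of connected monoids, comonoids, Hopf monoids are morphisms of connected species commuting with products, coproducts, or both. A connected Hopf monoid is commutative/cocommutative if $\nabla$/$\Delta$ is. **Linearization and strong self-duality.** A basis of a connected species $\mathbf p$ is a set subspecies $\mathrm P\subset\mathbf p$ with each $\mathrm P[S]$ a $\mathbb K$-basis of $\mathbf p[S]$ and $\mathrm P[\varnothing]=\{1_{\mathbf p}\}$. A connected Hopf monoid is linearized in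 $\mathrm P$ if for all disjoint $S,T$ the map $\nabla_{S,T}$ restricts to a map $\mathrm P[S]\times\mathrm P[T]\to\mathrm P[S\sqcup T]$ and $\Delta_{S,T}$ restricts to a map $\mathrm P[S\sqcup T]\to\mathrm P[S]\times\mathrm P[T]$ (identifying $(a,b)$ with $a\otimes b$). $\mathcal P(\mathrm P,\nabla)$ is the set subspecies of $\mathrm P$ with $\mathcal P(\mathrm P,\nabla)[\varnothing]=\varnothing$ and, for $I\ne\varnothing$, consisting of the elements of $\mathrm P[I]$ not in the image of $\nabla_{S,T}$ for any decomposition $I=S\sqcup T$ with $S,T$ nonempty. The Hopf monoid is strongly linearized in $\mathrm P$ if it is linearized in $\mathrm P$ and, with $\mathrm Q=\mathcal P(\mathrm P,\nabla)$, $\Delta_{S,T}$ restricts to a map $\mathrm Q[S\sqcup T]\to\mathrm Q[S]\times\mathrm Q[T]$ for all disjoint nonempty $S,T$. It is strongly self-dual in a basis $\mathrm P$ if for all disjoint $S,T$: $\nabla_{S,T}$ restricts to a map $\mathrm P[S]\times\mathrm P[T]\to\mathrm P[S\sqcup T]$, and $\mathrm P[S\sqcup T]$ is a finite subset of the union of the image of $\nabla_{S,T}$ and the kernel of $\Delta_{S,T}$. **Notation for $\mathbf h$ linearized in $\mathrm P$.** For disjoint $S,T$, $\alpha\in\mathrm P[S]$, $\beta\in\mathrm P[T]$, $\lambda\in\mathrm P[S\sqcup T]$, write $\alpha\cdot\beta=\nabla_{S,T}(\alpha\otimes\beta)\in\mathrm P[S\sqcup T]$ and $\Delta_{S,T}(\lambda)=\lambda|_S\otimes\lambda|_T$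 with $\lambda|_S\in\mathrm P[S]$, $\lambda|_T\in\mathrm P[T]$. **The partial order and the four families.** The relation $\prec$ on each $\mathrm P[I]$ is the minimal transitive relation such that $\lambda\prec\lambda'$ whenever $\lambda\neq\lambda'$ and $\lambda=\nabla_{S,T}\circ\Delta_{S,T}(\lambda')$ for some decomposition $I=S\sqcup T$. It is known that $\prec$ is a strict partial order on $\mathrm P[I]$; $\preceq$ denotes "$\prec$ or equal". Let $\mu(\cdot,\cdot)$ be the Möbius function of the finite poset $(\mathrm P[I],\preceq)$. For $\lambda\in\mathrm P[I]$ the set $\{\lambda'\in\mathrm P[I]:\lambda'\preceq\lambda\}$ has a unique minimal element $\emptyset_\lambda$, and one sets $\mu(\lambda)=\mu(\emptyset_\lambda,\lambda)$. Define $$p_\lambda=\sum_{\lambda'\preceq\lambda}\mu(\lambda',\lambda)\,\lambda',\quad m_\lambda=\sum_{\lambda'\succeq\lambda}\mu(\lambda,\lambda')\,p_{\lambda'},\quad e_\lambda=\sum_{\lambda'\preceq\lambda}\mu(\lambda')\,p_{\lambda'},\quad h_\lambda=\sum_{\lambda'\preceq\lambda}|\mu(\lambda')|\,p_{\lambda'},$$ sums over $\lambda'\in\mathrm P[I]$. For $x\in\{m,p,e,h\}$, $x_\bullet$ is the set subspecies of $\mathbf p$ with $x_\bullet[I]=\{x_\lambda:\lambda\in\mathrm P[I]\}$. *)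

theory Defs
  imports Complex_Main "HOL-Library.Function_Algebras"
begin

section \<open>Vector spaces with carriers and their tensor products\<close>

text \<open>A vector space is given as a subspace \<open>carr\<close> of an ambient type, which carries the addition
  and, via \<open>smul\<close>, a vector space structure.\<close>

record ('k, 'a) vspace =
  smul :: "'k \<Rightarrow> 'a \<Rightarrow> 'a"
  carr :: "'a set"

definition is_vspace :: "('k::field, 'a::ab_group_add) vspace \<Rightarrow> bool" where
  "is_vspace X \<longleftrightarrow> vector_space (smul X) \<and> module.subspace (smul X) (carr X)"

definition base_field :: "('k::field, 'k) vspace" where
  "base_field = \<lparr>smul = (*), carr = UNIV\<rparr>"

definition lin :: "('k::field, 'a::ab_group_add) vspace \<Rightarrow> ('k, 'b::ab_group_add) vspace \<Rightarrow> ('a \<Rightarrow> 'b) \<Rightarrow> bool"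
  where "lin X Y f \<longleftrightarrow>
    (\<forall>x\<in>carr X. f x \<in> carr Y) \<and>
    (\<forall>x\<in>carr X. \<forall>y\<in>carr X. f (x + y) = f x + f y) \<and>
    (\<forall>c. \<forall>x\<in>carr X. f (smul X c x) = smul Y c (f x))"

definition bilin :: "('k::field, 'a::ab_group_add) vspace \<Rightarrow> ('k, 'b::ab_group_add) vspace \<Rightarrow>
    ('k, 'c::ab_group_add) vspace \<Rightarrow> ('a \<Rightarrow> 'b \<Rightarrow> 'c) \<Rightarrow> bool"
  where "bilin X Y Z b \<longleftrightarrow>
    (\<forall>x\<in>carr X. lin Y Z (b x)) \<and> (\<forall>y\<in>carr Y. lin X Z (\<lambda>x. b x y))"

abbreviation bilin_form :: "('k::field, 'a::ab_group_add) vspace \<Rightarrow> ('k, 'b::ab_group_add) vspace \<Rightarrow>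
    ('a \<Rightarrow> 'b \<Rightarrow> 'k) \<Rightarrow> bool"
  where "bilin_form X Y \<equiv> bilin X Y base_field"

text \<open>Over a field, \<open>X \<otimes> Y\<close> embeds into the dual of the space of bilinear forms on \<open>X \<times> Y\<close>, by
  letting \<open>x \<otimes> y\<close> evaluate forms at \<open>(x, y)\<close>.  We take the image of this embedding as the model of
  the tensor product; its universal property is \<open>tensor_universal\<close> and \<open>tensor_lin_unique\<close> below.
  The value \<open>0\<close> on functions which are not bilinear on the carriers is a normalization.\<close>

type_synonym ('a, 'b, 'k) tensor = "('a \<Rightarrow> 'b \<Rightarrow> 'k) \<Rightarrow> 'k"

definition pure :: "('k::field, 'a::ab_group_add) vspace \<Rightarrow> ('k, 'b::ab_group_add) vspace \<Rightarrow>
    'a \<Rightarrow> 'b \<Rightarrow> ('a, 'b, 'k) tensor"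
  where "pure X Y x y = (\<lambda>B. if bilin_form X Y B then B x y else 0)"

definition tscale :: "'k::field \<Rightarrow> ('a, 'b, 'k) tensor \<Rightarrow> ('a, 'b, 'k) tensor" where
  "tscale c t = (\<lambda>B. c * t B)"

definition tensor :: "('k::field, 'a::ab_group_add) vspace \<Rightarrow> ('k, 'b::ab_group_add) vspace \<Rightarrow>
    ('k, ('a, 'b, 'k) tensor) vspace"
  where "tensor X Y = \<lparr>smul = tscale,
    carr = module.span tscale {pure X Y x y | x y. x \<in> carr X \<and> y \<in> carr Y}\<rparr>"

text \<open>In the following four definitions, a tensor \<open>t\<close> is evaluated at the pullback of a form.
  They are the linear maps determined by, respectively, \<open>x \<otimes> y \<mapsto> f x \<otimes> g y\<close>,
  \<open>x \<otimes> y \<mapsto> y \<otimes> x\<close>, \<open>(x \<otimes> y) \<otimes> z \<mapsto> x \<otimes> (y \<otimes> z)\<close> and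
  \<open>(x \<otimes> y) \<otimes> (z \<otimes> w) \<mapsto> (x \<otimes> z) \<otimes> (y \<otimes> w)\<close>; see the lemmas \<open>tensor_map_pure\<close> etc.\<close>

definition tensor_map :: "('k::field, 'c::ab_group_add) vspace \<Rightarrow> ('k, 'd::ab_group_add) vspace \<Rightarrow>
    ('a \<Rightarrow> 'c) \<Rightarrow> ('b \<Rightarrow> 'd) \<Rightarrow> ('a, 'b, 'k) tensor \<Rightarrow> ('c, 'd, 'k) tensor"
  where "tensor_map X' Y' f g t =
    (\<lambda>B. if bilin_form X' Y' B then t (\<lambda>x y. B (f x) (g y)) else 0)"

definition tensor_swap :: "('k::field, 'a::ab_group_add) vspace \<Rightarrow> ('k, 'b::ab_group_add) vspace \<Rightarrow>
    ('a, 'b, 'k) tensor \<Rightarrow> ('b, 'a, 'k) tensor"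
  where "tensor_swap X Y t = (\<lambda>B. if bilin_form Y X B then t (\<lambda>x y. B y x) else 0)"

definition tensor_assoc :: "('k::field, 'a::ab_group_add) vspace \<Rightarrow> ('k, 'b::ab_group_add) vspace \<Rightarrow>
    ('k, 'c::ab_group_add) vspace \<Rightarrow>
    (('a, 'b, 'k) tensor, 'c, 'k) tensor \<Rightarrow> ('a, ('b, 'c, 'k) tensor, 'k) tensor"
  where "tensor_assoc X Y Z t =
    (\<lambda>B. if bilin_form X (tensor Y Z) B
         then t (\<lambda>u z. u (\<lambda>x y. B x (pure Y Z y z))) else 0)"

definition tensor_mid :: "('k::field, 'a::ab_group_add) vspace \<Rightarrow> ('k, 'b::ab_group_add) vspace \<Rightarrow>
    ('k, 'c::ab_group_add) vspace \<Rightarrow> ('k, 'd::ab_group_add) vspace \<Rightarrow>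
    (('a, 'b, 'k) tensor, ('c, 'd, 'k) tensor, 'k) tensor \<Rightarrow>
    (('a, 'c, 'k) tensor, ('b, 'd, 'k) tensor, 'k) tensor"
  where "tensor_mid X Y Z W t =
    (\<lambda>B. if bilin_form (tensor X Z) (tensor Y W) B
         then t (\<lambda>u v. u (\<lambda>x y. v (\<lambda>z w. B (pure X Z x z) (pure Y W y w)))) else 0)"


section \<open>Connected species\<close>

text \<open>Species live on the finite subsets of a label type \<open>'l\<close>.  \<open>act p S \<sigma>\<close> is
  \<open>p[\<sigma>] : p[S] \<rightarrow> p[\<sigma>(S)]\<close> for \<open>\<sigma>\<close> injective on \<open>S\<close>; all data is unconstrained elsewhere.\<close>

record ('l, 'k, 'v) species =
  obj :: "'l set \<Rightarrow> ('k, 'v) vspace"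
  act :: "'l set \<Rightarrow> ('l \<Rightarrow> 'l) \<Rightarrow> 'v \<Rightarrow> 'v"
  uni :: "'k \<Rightarrow> 'v"
  couni :: "'v \<Rightarrow> 'k"

abbreviation sp :: "('l, 'k, 'v, 'm) species_scheme \<Rightarrow> 'l set \<Rightarrow> 'v set" where
  "sp p S \<equiv> carr (obj p S)"

definition vector_species :: "('l, 'k::field, 'v::ab_group_add, 'm) species_scheme \<Rightarrow> bool" where
  "vector_species p \<longleftrightarrow>
    (\<forall>S. finite S \<longrightarrow> is_vspace (obj p S)) \<and>
    (\<forall>S \<sigma>. finite S \<and> inj_on \<sigma> S \<longrightarrow> lin (obj p S) (obj p (\<sigma> ` S)) (act p S \<sigma>)) \<and>
    (\<forall>S \<sigma> \<sigma>'. finite S \<and> inj_on \<sigma> S \<and> (\<forall>i\<in>S. \<sigma> i = \<sigma>' i) \<longrightarrow>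
       (\<forall>x\<in>sp p S. act p S \<sigma> x = act p S \<sigma>' x)) \<and>
    (\<forall>S. finite S \<longrightarrow> (\<forall>x\<in>sp p S. act p S id x = x)) \<and>
    (\<forall>S \<sigma> \<tau>. finite S \<and> inj_on \<sigma> S \<and> inj_on \<tau> (\<sigma> ` S) \<longrightarrow>
       (\<forall>x\<in>sp p S. act p S (\<tau> \<circ> \<sigma>) x = act p (\<sigma> ` S) \<tau> (act p S \<sigma> x)))"

definition connected_species :: "('l, 'k::field, 'v::ab_group_add, 'm) species_scheme \<Rightarrow> bool" where
  "connected_species p \<longleftrightarrow> vector_species p \<and>
    lin base_field (obj p {}) (uni p) \<and> lin (obj p {}) base_field (couni p) \<and>
    (\<forall>c. couni p (uni p c) = c) \<and> (\<forall>x\<in>sp p {}. uni p (couni p x) = x)"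

definition one_of :: "('l, 'k::field, 'v, 'm) species_scheme \<Rightarrow> 'v" where
  "one_of p = uni p 1"

definition finite_dimensional :: "('l, 'k::field, 'v::ab_group_add, 'm) species_scheme \<Rightarrow> bool" where
  "finite_dimensional p \<longleftrightarrow>
    (\<forall>S. finite S \<longrightarrow> (\<exists>B. finite B \<and> sp p S = module.span (smul (obj p S)) B))"

definition set_subspecies ::
  "('l, 'k::field, 'v::ab_group_add, 'm) species_scheme \<Rightarrow> ('l set \<Rightarrow> 'v set) \<Rightarrow> bool" where
  "set_subspecies p P \<longleftrightarrow>
    (\<forall>S. finite S \<longrightarrow> P S \<subseteq> sp p S) \<and>
    (\<forall>S \<sigma>. finite S \<and> inj_on \<sigma> S \<longrightarrow> act p S \<sigma> ` P S \<subseteq> P (\<sigma> ` S))"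

definition is_basis ::
  "('l, 'k::field, 'v::ab_group_add, 'm) species_scheme \<Rightarrow> ('l set \<Rightarrow> 'v set) \<Rightarrow> bool" where
  "is_basis p P \<longleftrightarrow> set_subspecies p P \<and>
    (\<forall>S. finite S \<longrightarrow> \<not> module.dependent (smul (obj p S)) (P S) \<and>
                      module.span (smul (obj p S)) (P S) = sp p S) \<and>
    P {} = {one_of p}"

definition connected_species_hom :: "('l, 'k::field, 'v::ab_group_add, 'm) species_scheme \<Rightarrow>
    ('l, 'k, 'w::ab_group_add, 'n) species_scheme \<Rightarrow> ('l set \<Rightarrow> 'v \<Rightarrow> 'w) \<Rightarrow> bool" where
  "connected_species_hom p q f \<longleftrightarrow>
    (\<forall>S. finite S \<longrightarrow> lin (obj p S) (obj q S) (f S)) \<and>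
    (\<forall>S \<sigma>. finite S \<and> inj_on \<sigma> S \<longrightarrow>
       (\<forall>x\<in>sp p S. f (\<sigma> ` S) (act p S \<sigma> x) = act q S \<sigma> (f S x))) \<and>
    f {} (one_of p) = one_of q"


section \<open>Connected Hopf monoids\<close>

record ('l, 'k, 'v) hopf = "('l, 'k, 'v) species" +
  nabla :: "'l set \<Rightarrow> 'l set \<Rightarrow> ('v, 'v, 'k) tensor \<Rightarrow> 'v"
  delta :: "'l set \<Rightarrow> 'l set \<Rightarrow> 'v \<Rightarrow> ('v, 'v, 'k) tensor"

definition disj :: "'l set \<Rightarrow> 'l set \<Rightarrow> bool" where
  "disj S T \<longleftrightarrow> finite S \<and> finite T \<and> S \<inter> T = {}"

abbreviation obj2 :: "('l, 'k::field, 'v::ab_group_add, 'm) species_scheme \<Rightarrow> 'l set \<Rightarrow> 'l set \<Rightarrow>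
    ('k, ('v, 'v, 'k) tensor) vspace" where
  "obj2 p S T \<equiv> tensor (obj p S) (obj p T)"

abbreviation tens :: "('l, 'k::field, 'v::ab_group_add, 'm) species_scheme \<Rightarrow> 'l set \<Rightarrow> 'l set \<Rightarrow>
    'v \<Rightarrow> 'v \<Rightarrow> ('v, 'v, 'k) tensor" where
  "tens p S T x y \<equiv> pure (obj p S) (obj p T) x y"

definition mult :: "('l, 'k::field, 'v::ab_group_add) hopf \<Rightarrow> 'l set \<Rightarrow> 'l set \<Rightarrow> 'v \<Rightarrow> 'v \<Rightarrow> 'v" where
  "mult h S T x y = nabla h S T (tens h S T x y)"

definition nabla_image :: "('l, 'k::field, 'v::ab_group_add) hopf \<Rightarrow> 'l set \<Rightarrow> 'l set \<Rightarrow> 'v set" where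
  "nabla_image h S T = nabla h S T ` carr (obj2 h S T)"

definition is_product :: "('l, 'k::field, 'v::ab_group_add) hopf \<Rightarrow> bool" where
  "is_product h \<longleftrightarrow> (\<forall>S T. disj S T \<longrightarrow>
    lin (obj2 h S T) (obj h (S \<union> T)) (nabla h S T) \<and>
    (\<forall>\<sigma>. inj_on \<sigma> (S \<union> T) \<longrightarrow> (\<forall>t\<in>carr (obj2 h S T).
       act h (S \<union> T) \<sigma> (nabla h S T t) =
       nabla h (\<sigma> ` S) (\<sigma> ` T)
         (tensor_map (obj h (\<sigma> ` S)) (obj h (\<sigma> ` T)) (act h S \<sigma>) (act h T \<sigma>) t))))"

definition is_coproduct :: "('l, 'k::field, 'v::ab_group_add) hopf \<Rightarrow> bool" where
  "is_coproduct h \<longleftrightarrow> (\<forall>S T. disj S T \<longrightarrow>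
    lin (obj h (S \<union> T)) (obj2 h S T) (delta h S T) \<and>
    (\<forall>\<sigma>. inj_on \<sigma> (S \<union> T) \<longrightarrow> (\<forall>x\<in>sp h (S \<union> T).
       delta h (\<sigma> ` S) (\<sigma> ` T) (act h (S \<union> T) \<sigma> x) =
       tensor_map (obj h (\<sigma> ` S)) (obj h (\<sigma> ` T)) (act h S \<sigma>) (act h T \<sigma>) (delta h S T x))))"

definition connected_monoid :: "('l, 'k::field, 'v::ab_group_add) hopf \<Rightarrow> bool" where
  "connected_monoid h \<longleftrightarrow> connected_species h \<and> is_product h \<and>
    (\<forall>R S T. disj R S \<and> disj R T \<and> disj S T \<longrightarrow>
       (\<forall>x\<in>sp h R. \<forall>y\<in>sp h S. \<forall>z\<in>sp h T.
          mult h (R \<union> S) T (mult h R S x y) z = mult h R (S \<union> T) x (mult h S T y z))) \<and>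
    (\<forall>S. finite S \<longrightarrow> (\<forall>x\<in>sp h S. mult h {} S (one_of h) x = x \<and> mult h S {} x (one_of h) = x))"

definition connected_comonoid :: "('l, 'k::field, 'v::ab_group_add) hopf \<Rightarrow> bool" where
  "connected_comonoid h \<longleftrightarrow> connected_species h \<and> is_coproduct h \<and>
    (\<forall>R S T. disj R S \<and> disj R T \<and> disj S T \<longrightarrow>
       (\<forall>x\<in>sp h (R \<union> S \<union> T).
          tensor_assoc (obj h R) (obj h S) (obj h T)
            (tensor_map (obj2 h R S) (obj h T) (delta h R S) id (delta h (R \<union> S) T x)) =
          tensor_map (obj h R) (obj2 h S T) id (delta h S T) (delta h R (S \<union> T) x))) \<and>
    (\<forall>S. finite S \<longrightarrow> (\<forall>x\<in>sp h S. delta h {} S x = tens h {} S (one_of h) x \<and>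
                                   delta h S {} x = tens h S {} x (one_of h)))"

definition hopf_compatible :: "('l, 'k::field, 'v::ab_group_add) hopf \<Rightarrow> bool" where
  "hopf_compatible h \<longleftrightarrow>
    (\<forall>R R' S S'. disj R R' \<and> disj S S' \<and> R \<union> R' = S \<union> S' \<longrightarrow>
      (let A = R \<inter> S; B = R \<inter> S'; A' = R' \<inter> S; B' = R' \<inter> S' in
       \<forall>t\<in>carr (obj2 h R R').
         delta h S S' (nabla h R R' t) =
         tensor_map (obj h S) (obj h S') (nabla h A A') (nabla h B B')
           (tensor_mid (obj h A) (obj h B) (obj h A') (obj h B')
             (tensor_map (obj2 h A B) (obj2 h A' B') (delta h A B) (delta h A' B') t))))"

definition connected_hopf_monoid :: "('l, 'k::field, 'v::ab_group_add) hopf \<Rightarrow> bool" where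
  "connected_hopf_monoid h \<longleftrightarrow> connected_monoid h \<and> connected_comonoid h \<and> hopf_compatible h"

definition commutative :: "('l, 'k::field, 'v::ab_group_add) hopf \<Rightarrow> bool" where
  "commutative h \<longleftrightarrow> (\<forall>S T. disj S T \<longrightarrow>
     (\<forall>x\<in>sp h S. \<forall>y\<in>sp h T. mult h S T x y = mult h T S y x))"

definition cocommutative :: "('l, 'k::field, 'v::ab_group_add) hopf \<Rightarrow> bool" where
  "cocommutative h \<longleftrightarrow> (\<forall>S T. disj S T \<longrightarrow>
     (\<forall>x\<in>sp h (S \<union> T). tensor_swap (obj h S) (obj h T) (delta h S T x) = delta h T S x))"

definition connected_monoid_hom :: "('l, 'k::field, 'v::ab_group_add) hopf \<Rightarrow>
    ('l, 'k, 'w::ab_group_add) hopf \<Rightarrow> ('l set \<Rightarrow> 'v \<Rightarrow> 'w) \<Rightarrow> bool" where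
  "connected_monoid_hom h h' f \<longleftrightarrow> connected_species_hom h h' f \<and>
    (\<forall>S T. disj S T \<longrightarrow> (\<forall>t\<in>carr (obj2 h S T).
       f (S \<union> T) (nabla h S T t) =
       nabla h' S T (tensor_map (obj h' S) (obj h' T) (f S) (f T) t)))"

definition connected_comonoid_hom :: "('l, 'k::field, 'v::ab_group_add) hopf \<Rightarrow>
    ('l, 'k, 'w::ab_group_add) hopf \<Rightarrow> ('l set \<Rightarrow> 'v \<Rightarrow> 'w) \<Rightarrow> bool" where
  "connected_comonoid_hom h h' f \<longleftrightarrow> connected_species_hom h h' f \<and>
    (\<forall>S T. disj S T \<longrightarrow> (\<forall>x\<in>sp h (S \<union> T).
       delta h' S T (f (S \<union> T) x) =
       tensor_map (obj h' S) (obj h' T) (f S) (f T) (delta h S T x)))"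

definition connected_hopf_hom :: "('l, 'k::field, 'v::ab_group_add) hopf \<Rightarrow>
    ('l, 'k, 'w::ab_group_add) hopf \<Rightarrow> ('l set \<Rightarrow> 'v \<Rightarrow> 'w) \<Rightarrow> bool" where
  "connected_hopf_hom h h' f \<longleftrightarrow> connected_monoid_hom h h' f \<and> connected_comonoid_hom h h' f"

text \<open>\<open>hom\<close> is the predicate selecting the morphisms of the category in question.\<close>

definition iso_in :: "(('l, 'k::field, 'v::ab_group_add) hopf \<Rightarrow> ('l, 'k, 'v) hopf \<Rightarrow>
      ('l set \<Rightarrow> 'v \<Rightarrow> 'v) \<Rightarrow> bool) \<Rightarrow>
    ('l, 'k, 'v) hopf \<Rightarrow> ('l, 'k, 'v) hopf \<Rightarrow> ('l set \<Rightarrow> 'v \<Rightarrow> 'v) \<Rightarrow> bool" where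
  "iso_in hom h h' f \<longleftrightarrow> hom h h' f \<and> (\<exists>g. hom h' h g \<and>
    (\<forall>S. finite S \<longrightarrow> (\<forall>x\<in>sp h S. g S (f S x) = x) \<and> (\<forall>y\<in>sp h' S. f S (g S y) = y)))"


section \<open>Linearization and strong self-duality\<close>

definition linearized ::
  "('l, 'k::field, 'v::ab_group_add) hopf \<Rightarrow> ('l set \<Rightarrow> 'v set) \<Rightarrow> bool" where
  "linearized h P \<longleftrightarrow> (\<forall>S T. disj S T \<longrightarrow>
    (\<forall>a\<in>P S. \<forall>b\<in>P T. mult h S T a b \<in> P (S \<union> T)) \<and>
    (\<forall>l\<in>P (S \<union> T). \<exists>a\<in>P S. \<exists>b\<in>P T. delta h S T l = tens h S T a b))"

definition indecomposables ::
  "('l, 'k::field, 'v::ab_group_add) hopf \<Rightarrow> ('l set \<Rightarrow> 'v set) \<Rightarrow> 'l set \<Rightarrow> 'v set" where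
  "indecomposables h P I = (if I = {} then {} else
    {l \<in> P I. \<forall>S T. disj S T \<and> S \<union> T = I \<and> S \<noteq> {} \<and> T \<noteq> {} \<longrightarrow> l \<notin> nabla_image h S T})"

definition strongly_linearized ::
  "('l, 'k::field, 'v::ab_group_add) hopf \<Rightarrow> ('l set \<Rightarrow> 'v set) \<Rightarrow> bool" where
  "strongly_linearized h P \<longleftrightarrow> linearized h P \<and>
    (\<forall>S T. disj S T \<and> S \<noteq> {} \<and> T \<noteq> {} \<longrightarrow>
      (\<forall>l\<in>indecomposables h P (S \<union> T).
         \<exists>a\<in>indecomposables h P S. \<exists>b\<in>indecomposables h P T. delta h S T l = tens h S T a b))"

definition strongly_self_dual ::
  "('l, 'k::field, 'v::ab_group_add) hopf \<Rightarrow> ('l set \<Rightarrow> 'v set) \<Rightarrow> bool" where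
  "strongly_self_dual h P \<longleftrightarrow> (\<forall>S T. disj S T \<longrightarrow>
    (\<forall>a\<in>P S. \<forall>b\<in>P T. mult h S T a b \<in> P (S \<union> T)) \<and>
    finite (P (S \<union> T)) \<and>
    P (S \<union> T) \<subseteq> nabla_image h S T \<union> {x \<in> sp h (S \<union> T). delta h S T x = 0})"

text \<open>\<open>split_pair h P S T \<lambda> = (\<lambda>|\<^sub>S, \<lambda>|\<^sub>T)\<close>\<close>

definition split_pair :: "('l, 'k::field, 'v::ab_group_add) hopf \<Rightarrow> ('l set \<Rightarrow> 'v set) \<Rightarrow>
    'l set \<Rightarrow> 'l set \<Rightarrow> 'v \<Rightarrow> 'v \<times> 'v" where
  "split_pair h P S T l =
    (THE ab. fst ab \<in> P S \<and> snd ab \<in> P T \<and> delta h S T l = tens h S T (fst ab) (snd ab))"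

definition res1 :: "('l, 'k::field, 'v::ab_group_add) hopf \<Rightarrow> ('l set \<Rightarrow> 'v set) \<Rightarrow>
    'l set \<Rightarrow> 'l set \<Rightarrow> 'v \<Rightarrow> 'v" where
  "res1 h P S T l = fst (split_pair h P S T l)"

definition res2 :: "('l, 'k::field, 'v::ab_group_add) hopf \<Rightarrow> ('l set \<Rightarrow> 'v set) \<Rightarrow>
    'l set \<Rightarrow> 'l set \<Rightarrow> 'v \<Rightarrow> 'v" where
  "res2 h P S T l = snd (split_pair h P S T l)"


section \<open>The partial order and the four families\<close>

text \<open>Moebius function of the finite poset \<open>A\<close> with strict order \<open>lt\<close>, by recursion on the second
  argument; \<open>mobius_eq\<close> below is the resulting equation.\<close>

definition mobius :: "'a set \<Rightarrow> ('a \<Rightarrow> 'a \<Rightarrow> bool) \<Rightarrow> 'a \<Rightarrow> 'a \<Rightarrow> int" where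
  "mobius A lt x = wfrec {(z, y). z \<in> A \<and> y \<in> A \<and> lt z y}
    (\<lambda>m y. if y = x then 1
           else if lt x y then - (\<Sum>z\<in>{z \<in> A. (z = x \<or> lt x z) \<and> lt z y}. m z)
           else 0)"

definition prec :: "('l, 'k::field, 'v::ab_group_add) hopf \<Rightarrow> ('l set \<Rightarrow> 'v set) \<Rightarrow> 'l set \<Rightarrow>
    'v \<Rightarrow> 'v \<Rightarrow> bool" where
  "prec h P I l l' \<longleftrightarrow> (l, l') \<in> trancl {(a, b). a \<in> P I \<and> b \<in> P I \<and> a \<noteq> b \<and>
     (\<exists>S T. disj S T \<and> S \<union> T = I \<and> a = nabla h S T (delta h S T b))}"

definition preceq :: "('l, 'k::field, 'v::ab_group_add) hopf \<Rightarrow> ('l set \<Rightarrow> 'v set) \<Rightarrow> 'l set \<Rightarrow>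
    'v \<Rightarrow> 'v \<Rightarrow> bool" where
  "preceq h P I l l' \<longleftrightarrow> prec h P I l l' \<or> l = l'"

definition mu2 :: "('l, 'k::field, 'v::ab_group_add) hopf \<Rightarrow> ('l set \<Rightarrow> 'v set) \<Rightarrow> 'l set \<Rightarrow>
    'v \<Rightarrow> 'v \<Rightarrow> int" where
  "mu2 h P I = mobius (P I) (prec h P I)"

definition bottom_of :: "('l, 'k::field, 'v::ab_group_add) hopf \<Rightarrow> ('l set \<Rightarrow> 'v set) \<Rightarrow> 'l set \<Rightarrow>
    'v \<Rightarrow> 'v" where
  "bottom_of h P I l = (THE z. z \<in> {l' \<in> P I. preceq h P I l' l} \<and>
     \<not> (\<exists>y \<in> {l' \<in> P I. preceq h P I l' l}. prec h P I y z))"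

definition mu1 :: "('l, 'k::field, 'v::ab_group_add) hopf \<Rightarrow> ('l set \<Rightarrow> 'v set) \<Rightarrow> 'l set \<Rightarrow>
    'v \<Rightarrow> int" where
  "mu1 h P I l = mu2 h P I (bottom_of h P I l) l"

definition p_elt :: "('l, 'k::field, 'v::ab_group_add) hopf \<Rightarrow> ('l set \<Rightarrow> 'v set) \<Rightarrow> 'l set \<Rightarrow>
    'v \<Rightarrow> 'v" where
  "p_elt h P I l =
    (\<Sum>l'\<in>{l' \<in> P I. preceq h P I l' l}. smul (obj h I) (of_int (mu2 h P I l' l)) l')"

definition m_elt :: "('l, 'k::field, 'v::ab_group_add) hopf \<Rightarrow> ('l set \<Rightarrow> 'v set) \<Rightarrow> 'l set \<Rightarrow>
    'v \<Rightarrow> 'v" where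
  "m_elt h P I l =
    (\<Sum>l'\<in>{l' \<in> P I. preceq h P I l l'}. smul (obj h I) (of_int (mu2 h P I l l')) (p_elt h P I l'))"

definition e_elt :: "('l, 'k::field, 'v::ab_group_add) hopf \<Rightarrow> ('l set \<Rightarrow> 'v set) \<Rightarrow> 'l set \<Rightarrow>
    'v \<Rightarrow> 'v" where
  "e_elt h P I l =
    (\<Sum>l'\<in>{l' \<in> P I. preceq h P I l' l}. smul (obj h I) (of_int (mu1 h P I l')) (p_elt h P I l'))"

definition h_elt :: "('l, 'k::field, 'v::ab_group_add) hopf \<Rightarrow> ('l set \<Rightarrow> 'v set) \<Rightarrow> 'l set \<Rightarrow>
    'v \<Rightarrow> 'v" where
  "h_elt h P I l =
    (\<Sum>l'\<in>{l' \<in> P I. preceq h P I l' l}. smul (obj h I) (of_int \<bar>mu1 h P I l'\<bar>) (p_elt h P I l'))"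

definition family_set :: "('l set \<Rightarrow> 'v set) \<Rightarrow> ('l set \<Rightarrow> 'v \<Rightarrow> 'v) \<Rightarrow> 'l set \<Rightarrow> 'v set" where
  "family_set P x I = x I ` P I"

definition change_of_basis :: "('l, 'k::field, 'v::ab_group_add) hopf \<Rightarrow> ('l set \<Rightarrow> 'v set) \<Rightarrow>
    ('l set \<Rightarrow> 'v \<Rightarrow> 'v) \<Rightarrow> ('l set \<Rightarrow> 'v \<Rightarrow> 'v) \<Rightarrow> ('l set \<Rightarrow> 'v \<Rightarrow> 'v) \<Rightarrow> bool" where
  "change_of_basis h P x y f \<longleftrightarrow> (\<forall>I. finite I \<longrightarrow>
    lin (obj h I) (obj h I) (f I) \<and> (\<forall>l\<in>P I. f I (x I l) = y I l))"

definition natural_iso :: "(('l, 'k::field, 'v::ab_group_add) hopf \<Rightarrow> ('l, 'k, 'v) hopf \<Rightarrow>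
      ('l set \<Rightarrow> 'v \<Rightarrow> 'v) \<Rightarrow> bool) \<Rightarrow> ('l, 'k, 'v) hopf \<Rightarrow> ('l set \<Rightarrow> 'v set) \<Rightarrow>
    ('l set \<Rightarrow> 'v \<Rightarrow> 'v) \<Rightarrow> ('l set \<Rightarrow> 'v \<Rightarrow> 'v) \<Rightarrow> bool" where
  "natural_iso hom h P x y \<longleftrightarrow> (\<exists>f. change_of_basis h P x y f) \<and>
    (\<forall>f. change_of_basis h P x y f \<longrightarrow> iso_in hom h h f)"


section \<open>Sanity lemmas\<close>

lemma vector_space_tscale:
  "vector_space (tscale :: 'k::field \<Rightarrow> ('a, 'b, 'k) tensor \<Rightarrow> ('a, 'b, 'k) tensor)"
  by unfold_locales (auto simp: tscale_def fun_eq_iff algebra_simps)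

lemma is_vspaceD:
  assumes "is_vspace X"
  shows "0 \<in> carr X" "x \<in> carr X \<Longrightarrow> y \<in> carr X \<Longrightarrow> x + y \<in> carr X"
    "x \<in> carr X \<Longrightarrow> smul X c x \<in> carr X"
  using assms by (auto simp: is_vspace_def module.subspace_def module_iff_vector_space)

lemma is_vspace_tensor:
  fixes X :: "('k::field, 'a::ab_group_add) vspace" and Y :: "('k, 'b::ab_group_add) vspace"
  shows "is_vspace (tensor X Y)"
proof -
  interpret vector_space "tscale :: 'k \<Rightarrow> ('a, 'b, 'k) tensor \<Rightarrow> ('a, 'b, 'k) tensor"
    by (rule vector_space_tscale)
  show ?thesis by (simp add: is_vspace_def tensor_def vector_space_tscale)
qed

lemma is_vspace_base_field: "is_vspace (base_field :: ('k::field, 'k) vspace)"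
proof -
  interpret vector_space "(*) :: 'k \<Rightarrow> 'k \<Rightarrow> 'k" by unfold_locales (auto simp: algebra_simps)
  show ?thesis by (simp add: is_vspace_def base_field_def vector_space_axioms)
qed

lemma pure_in_tensor:
  fixes X :: "('k::field, 'a::ab_group_add) vspace" and Y :: "('k, 'b::ab_group_add) vspace"
  assumes "x \<in> carr X" "y \<in> carr Y"
  shows "pure X Y x y \<in> carr (tensor X Y)"
proof -
  interpret vector_space "tscale :: 'k \<Rightarrow> ('a, 'b, 'k) tensor \<Rightarrow> ('a, 'b, 'k) tensor"
    by (rule vector_space_tscale)
  show ?thesis using assms unfolding tensor_def by (auto intro!: span_base)
qed

lemma bilin_pure:
  fixes X :: "('k::field, 'a::ab_group_add) vspace" and Y :: "('k, 'b::ab_group_add) vspace"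
  shows "bilin X Y (tensor X Y) (pure X Y)"
proof -
  have add: "pure X Y (x + x') y = pure X Y x y + pure X Y x' y"
    and scale: "pure X Y (smul X c x) y = tscale c (pure X Y x y)"
    if "x \<in> carr X" "x' \<in> carr X" "y \<in> carr Y" for x x' y c
    using that by (auto simp: tscale_def pure_def fun_eq_iff bilin_def lin_def base_field_def)
  have add': "pure X Y x (y + y') = pure X Y x y + pure X Y x y'"
    and scale': "pure X Y x (smul Y c y) = tscale c (pure X Y x y)"
    if "x \<in> carr X" "y \<in> carr Y" "y' \<in> carr Y" for x y y' c
    using that by (auto simp: tscale_def pure_def fun_eq_iff bilin_def lin_def base_field_def)
  have "smul (tensor X Y) = tscale" by (simp add: tensor_def)
  then show ?thesis
    unfolding bilin_def lin_def by (simp add: pure_in_tensor add scale add' scale')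
qed

lemma tensor_induct [consumes 1, case_names zero add scale pure]:
  fixes X :: "('k::field, 'a::ab_group_add) vspace" and Y :: "('k, 'b::ab_group_add) vspace"
  assumes "t \<in> carr (tensor X Y)"
    and "Q 0"
    and "\<And>s t. s \<in> carr (tensor X Y) \<Longrightarrow> t \<in> carr (tensor X Y) \<Longrightarrow> Q s \<Longrightarrow> Q t \<Longrightarrow> Q (s + t)"
    and "\<And>c t. t \<in> carr (tensor X Y) \<Longrightarrow> Q t \<Longrightarrow> Q (tscale c t)"
    and "\<And>x y. x \<in> carr X \<Longrightarrow> y \<in> carr Y \<Longrightarrow> Q (pure X Y x y)"
  shows "Q t"
proof -
  interpret vector_space "tscale :: 'k \<Rightarrow> ('a, 'b, 'k) tensor \<Rightarrow> ('a, 'b, 'k) tensor"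
    by (rule vector_space_tscale)
  let ?G = "{pure X Y x y | x y. x \<in> carr X \<and> y \<in> carr Y}"
  have c: "carr (tensor X Y) = span ?G" by (simp add: tensor_def)
  have "t \<in> span ?G" using assms(1) c by simp
  then have "t \<in> span ?G \<and> Q t"
  proof (induction rule: span_induct)
    case base
    then show ?case
      unfolding mem_Collect_eq subspace_def
      using assms(2-4)[unfolded c] by (auto intro: span_add span_scale span_zero)
  next
    case (step x)
    then show ?case using assms(5) by (auto intro: span_base)
  qed
  then show ?thesis by blast
qed

lemma tensor_lin_unique:
  assumes "lin (tensor X Y) Z L" "lin (tensor X Y) Z L'"
    and "\<And>x y. x \<in> carr X \<Longrightarrow> y \<in> carr Y \<Longrightarrow> L (pure X Y x y) = L' (pure X Y x y)"
    and "t \<in> carr (tensor X Y)"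
  shows "L t = L' t"
  using assms(4)
proof (induction rule: tensor_induct)
  case zero
  have z: "0 \<in> carr (tensor X Y)"
    by (rule is_vspaceD[OF is_vspace_tensor])
  have "L 0 = 0" "L' 0 = 0"
    using assms(1,2) z unfolding lin_def by (metis add_cancel_right_right)+
  then show ?case by (simp only:)
next
  case (add s t)
  then show ?case using assms(1,2) unfolding lin_def by metis
next
  case (scale c t)
  moreover have "smul (tensor X Y) = tscale" by (simp add: tensor_def)
  ultimately show ?case using assms(1,2) unfolding lin_def by metis
next
  case (pure x y)
  then show ?case by (rule assms(3))
qed

lemma tensor_universal:
  fixes X :: "('k::field, 'a::ab_group_add) vspace" and Y :: "('k, 'b::ab_group_add) vspace"
    and Z :: "('k, 'c::ab_group_add) vspace"
  assumes Z: "is_vspace Z" and b: "bilin X Y Z b"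
  shows "\<exists>L. lin (tensor X Y) Z L \<and> (\<forall>x\<in>carr X. \<forall>y\<in>carr Y. L (pure X Y x y) = b x y)"
proof -
  interpret T: vector_space "tscale :: 'k \<Rightarrow> ('a, 'b, 'k) tensor \<Rightarrow> ('a, 'b, 'k) tensor"
    by (rule vector_space_tscale)
  interpret Z: vector_space "smul Z" using Z by (simp add: is_vspace_def)
  interpret K: vector_space "(*) :: 'k \<Rightarrow> 'k \<Rightarrow> 'k" by unfold_locales (auto simp: algebra_simps)
  interpret TZ: vector_space_pair "tscale :: 'k \<Rightarrow> ('a, 'b, 'k) tensor \<Rightarrow> ('a, 'b, 'k) tensor" "smul Z" ..
  interpret ZK: vector_space_pair "smul Z" "(*) :: 'k \<Rightarrow> 'k \<Rightarrow> 'k" ..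
  let ?G = "{pure X Y x y | x y. x \<in> carr X \<and> y \<in> carr Y}"
  obtain E where E: "E \<subseteq> ?G" "T.independent E" "?G \<subseteq> T.span E"
    using T.maximal_independent_subset[of ?G] by blast
  have "\<forall>e\<in>E. \<exists>xy. fst xy \<in> carr X \<and> snd xy \<in> carr Y \<and> e = pure X Y (fst xy) (snd xy)"
    using E(1) by fastforce
  from bchoice[OF this] obtain xy where xy: "\<And>e. e \<in> E \<Longrightarrow> fst (xy e) \<in> carr X \<and> snd (xy e) \<in> carr Y \<and>
      e = pure X Y (fst (xy e)) (snd (xy e))"
    by blast
  obtain L where L: "Vector_Spaces.linear tscale (smul Z) L"
    "\<forall>e\<in>E. L e = b (fst (xy e)) (snd (xy e))"
    using TZ.linear_independent_extend[OF E(2), of "\<lambda>e. b (fst (xy e)) (snd (xy e))"] by blast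
  interpret L: Vector_Spaces.linear tscale "smul Z" L by (fact L)
  have Lb: "L (pure X Y x y) = b x y" if "x \<in> carr X" "y \<in> carr Y" for x y
  proof (rule ccontr)
    define z where "z = L (pure X Y x y) - b x y"
    assume "L (pure X Y x y) \<noteq> b x y"
    then have "z \<noteq> 0" by (simp add: z_def)
    then have "Z.independent {z}" by (simp add: Z.dependent_single)
    then obtain g where g: "Vector_Spaces.linear (smul Z) (*) g" "g z = 1"
      using ZK.linear_independent_extend[of "{z}" "\<lambda>_. 1"] by auto
    interpret g: Vector_Spaces.linear "smul Z" "(*)" g by (fact g)
    have form: "bilin_form X Y (\<lambda>x y. g (b x y))"
      using b unfolding bilin_def lin_def base_field_def by (auto simp: g.add g.scale)
    have "g (L t) = t (\<lambda>x y. g (b x y))" if "t \<in> T.span E" for t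
      using that
    proof (induction rule: T.span_induct)
      case base
      then show ?case
        unfolding T.subspace_def mem_Collect_eq L.zero g.zero L.add g.add L.scale g.scale
        by (simp add: tscale_def)
    next
      case (step e)
      then show ?case using xy[OF step] L(2) form by (metis pure_def)
    qed
    from this[of "pure X Y x y"] have "g (L (pure X Y x y)) = g (b x y)"
      using that E(3) form by (auto simp: pure_def)
    then have "g z = 0" by (simp add: z_def g.diff)
    then show False using g(2) by simp
  qed
  have "L t \<in> carr Z" if "t \<in> carr (tensor X Y)" for t
    using that
  proof (induction rule: tensor_induct)
    case zero
    then show ?case unfolding L.zero by (rule is_vspaceD[OF Z])
  next
    case (add s t)
    from add(3,4) show ?case unfolding L.add by (rule is_vspaceD[OF Z])
  next
    case (scale c t)
    from scale(2) show ?case unfolding L.scale by (rule is_vspaceD[OF Z])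
  next
    case (pure x y)
    then show ?case using Lb b by (simp add: bilin_def lin_def)
  qed
  moreover have "smul (tensor X Y) = tscale" by (simp add: tensor_def)
  ultimately have "lin (tensor X Y) Z L"
    unfolding lin_def using L.add L.scale by simp
  then show ?thesis using Lb by blast
qed

lemma lin_comp: "lin X Y f \<Longrightarrow> lin Y Z g \<Longrightarrow> lin X Z (\<lambda>x. g (f x))"
  by (simp add: lin_def)

lemma tensor_map_pure:
  assumes "lin X X' f" "lin Y Y' g" "x \<in> carr X" "y \<in> carr Y"
  shows "tensor_map X' Y' f g (pure X Y x y) = pure X' Y' (f x) (g y)"
proof -
  have "bilin_form X Y (\<lambda>x y. B (f x) (g y))" if "bilin_form X' Y' B" for B
    using that assms(1,2) unfolding bilin_def lin_def by auto
  then show ?thesis by (auto simp: tensor_map_def pure_def fun_eq_iff)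
qed

lemma tensor_swap_pure: "tensor_swap X Y (pure X Y x y) = pure Y X y x"
  by (auto simp: tensor_swap_def pure_def fun_eq_iff bilin_def)

lemma tensor_assoc_pure:
  assumes "is_vspace X" "is_vspace Y" "is_vspace Z" "x \<in> carr X" "y \<in> carr Y" "z \<in> carr Z"
  shows "tensor_assoc X Y Z (pure (tensor X Y) Z (pure X Y x y) z) =
         pure X (tensor Y Z) x (pure Y Z y z)"
proof -
  have p: "bilin Y Z (tensor Y Z) (pure Y Z)" using assms bilin_pure by blast
  have b1: "bilin_form X Y (\<lambda>x y. B x (pure Y Z y z))"
    if "bilin_form X (tensor Y Z) B" "z \<in> carr Z" for B z
    using that p lin_comp[of Y "tensor Y Z" "\<lambda>y. pure Y Z y z" base_field]
    by (auto simp: bilin_def lin_def)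
  have b2: "bilin_form (tensor X Y) Z (\<lambda>u z. u (\<lambda>x y. B x (pure Y Z y z)))"
    if B: "bilin_form X (tensor Y Z) B" for B
  proof -
    have "lin Z base_field (\<lambda>z. u (\<lambda>x y. B x (pure Y Z y z)))" if "u \<in> carr (tensor X Y)" for u
      using that
    proof (induction rule: tensor_induct)
      case (pure x y)
      have "lin Z base_field (\<lambda>z. B x (Defs.pure Y Z y z))"
        using pure B p lin_comp[of Z "tensor Y Z" "\<lambda>z. Defs.pure Y Z y z" base_field "B x"]
        by (auto simp: bilin_def)
      then show ?case
        using b1[OF B] assms(3) by (auto simp: pure_def[of X Y] lin_def is_vspace_def
          module.subspace_def module_iff_vector_space)
    qed (auto simp: lin_def base_field_def tscale_def algebra_simps)
    then show ?thesis
      by (auto simp: bilin_def lin_def base_field_def tensor_def tscale_def)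
  qed
  show ?thesis
    using b1 b2 assms by (auto simp: tensor_assoc_def pure_def[of X] pure_def[of "tensor X Y"] fun_eq_iff)
qed

lemma lin_cong:
  assumes "is_vspace X" "lin X Y f" "\<And>x. x \<in> carr X \<Longrightarrow> g x = f x"
  shows "lin X Y g"
  using assms(2) unfolding lin_def by (simp add: assms(3) is_vspaceD[OF assms(1)])

lemma tensor_mid_pure:
  assumes X: "is_vspace X" and Y: "is_vspace Y"
    and x: "x \<in> carr X" and y: "y \<in> carr Y" and z: "z \<in> carr Z" and w: "w \<in> carr W"
  shows "tensor_mid X Y Z W (pure (tensor X Y) (tensor Z W) (pure X Y x y) (pure Z W z w)) =
         pure (tensor X Z) (tensor Y W) (pure X Z x z) (pure Y W y w)"
proof -
  have p: "bilin X Z (tensor X Z) (pure X Z)" "bilin Y W (tensor Y W) (pure Y W)"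
    by (rule bilin_pure)+
  have b1: "bilin_form X Y (\<lambda>x y. B (pure X Z x z) (pure Y W y w))"
    if B: "bilin_form (tensor X Z) (tensor Y W) B" and "z \<in> carr Z" "w \<in> carr W" for B z w
    using p that unfolding bilin_def lin_def by simp
  have b2: "bilin_form Z W (\<lambda>z w. B (pure X Z x z) (pure Y W y w))"
    if B: "bilin_form (tensor X Z) (tensor Y W) B" and "x \<in> carr X" "y \<in> carr Y" for B x y
    using p that unfolding bilin_def lin_def by simp
  have b3: "bilin_form X Y (\<lambda>x y. v (\<lambda>z w. B (pure X Z x z) (pure Y W y w)))"
    if B: "bilin_form (tensor X Z) (tensor Y W) B" and v: "v \<in> carr (tensor Z W)" for B v
    using v
  proof (induction rule: tensor_induct)
    case (pure z w)
    let ?g = "\<lambda>x y. B (Defs.pure X Z x z) (Defs.pure Y W y w)"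
    have "Defs.pure Z W z w (\<lambda>z w. B (Defs.pure X Z x z) (Defs.pure Y W y w)) = ?g x y"
      if "x \<in> carr X" "y \<in> carr Y" for x y
      using b2[OF B that] by (simp add: pure_def[of Z W])
    with b1[OF B pure] show ?case
      unfolding bilin_def lin_def by (simp add: is_vspaceD[OF X] is_vspaceD[OF Y])
  qed (auto simp: bilin_def lin_def base_field_def tscale_def algebra_simps)
  have b4: "bilin_form (tensor X Y) (tensor Z W)
      (\<lambda>u v. u (\<lambda>x y. v (\<lambda>z w. B (pure X Z x z) (pure Y W y w))))"
    if B: "bilin_form (tensor X Z) (tensor Y W) B" for B
  proof -
    have "lin (tensor Z W) base_field (\<lambda>v. u (\<lambda>x y. v (\<lambda>z w. B (pure X Z x z) (pure Y W y w))))"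
      if "u \<in> carr (tensor X Y)" for u
      using that
    proof (induction rule: tensor_induct)
      case (pure x y)
      have ev: "Defs.pure X Y x y (\<lambda>x y. v (\<lambda>z w. B (Defs.pure X Z x z) (Defs.pure Y W y w))) =
          v (\<lambda>z w. B (Defs.pure X Z x z) (Defs.pure Y W y w))"
        if "v \<in> carr (tensor Z W)" for v
        using b3[OF B that] by (simp add: pure_def[of X Y])
      have sm: "smul (tensor Z W) c v u = c * v u" for c v u by (simp add: tensor_def tscale_def)
      have "lin (tensor Z W) base_field (\<lambda>v. v (\<lambda>z w. B (Defs.pure X Z x z) (Defs.pure Y W y w)))"
        by (simp add: lin_def sm base_field_def)
      then show ?case by (rule lin_cong[OF is_vspace_tensor]) (rule ev)
    qed (auto simp: lin_def base_field_def tscale_def algebra_simps)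
    then show ?thesis
      by (auto simp: bilin_def lin_def base_field_def tensor_def[of X Y] tscale_def)
  qed
  show ?thesis
  proof
    fix B
    show "tensor_mid X Y Z W (pure (tensor X Y) (tensor Z W) (pure X Y x y) (pure Z W z w)) B =
         pure (tensor X Z) (tensor Y W) (pure X Z x z) (pure Y W y w) B"
    proof (cases "bilin_form (tensor X Z) (tensor Y W) B")
      case True
      let ?F = "\<lambda>x y v. v (\<lambda>z w. B (pure X Z x z) (pure Y W y w))"
      have "tensor_mid X Y Z W (pure (tensor X Y) (tensor Z W) (pure X Y x y) (pure Z W z w)) B =
          pure X Y x y (\<lambda>x y. ?F x y (pure Z W z w))"
        by (simp only: tensor_mid_def True pure_def[of "tensor X Y"] b4[OF True] if_True)
      also have "\<dots> = ?F x y (pure Z W z w)"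
        by (simp only: pure_def[of X Y] b3[OF True pure_in_tensor[OF z w]] if_True)
      also have "\<dots> = B (pure X Z x z) (pure Y W y w)"
        by (simp only: pure_def[of Z W] b2[OF True x y] if_True)
      also have "\<dots> = pure (tensor X Z) (tensor Y W) (pure X Z x z) (pure Y W y w) B"
        by (simp only: pure_def[of "tensor X Z"] True if_True)
      finally show ?thesis .
    next
      case False
      then show ?thesis by (simp only: tensor_mid_def pure_def[of "tensor X Z"] if_False)
    qed
  qed
qed

lemma mobius_eq:
  assumes fin: "finite A" and irr: "\<And>x. x \<in> A \<Longrightarrow> \<not> lt x x"
    and tr: "\<And>x y z. \<lbrakk>x \<in> A; y \<in> A; z \<in> A; lt x y; lt y z\<rbrakk> \<Longrightarrow> lt x z"
    and y: "y \<in> A"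
  shows "mobius A lt x y =
    (if y = x then 1
     else if lt x y then - (\<Sum>z\<in>{z \<in> A. (z = x \<or> lt x z) \<and> lt z y}. mobius A lt x z)
     else 0)"
proof -
  let ?r = "{(z, y). z \<in> A \<and> y \<in> A \<and> lt z y}"
  have "trans ?r" by (rule transI) (use tr in blast)
  moreover have "irrefl ?r" using irr by (auto simp: irrefl_def)
  ultimately have "acyclic ?r" by (simp add: acyclic_irrefl)
  moreover have "finite ?r" by (rule finite_subset[of _ "A \<times> A"]) (use fin in auto)
  ultimately have wf: "wf ?r" by (rule finite_acyclic_wf[rotated])
  have "(\<Sum>z\<in>{z \<in> A. (z = x \<or> lt x z) \<and> lt z y}. cut (mobius A lt x) ?r y z) =
      (\<Sum>z\<in>{z \<in> A. (z = x \<or> lt x z) \<and> lt z y}. mobius A lt x z)"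
    using y by (intro sum.cong refl) (simp add: cut_apply)
  moreover have "mobius A lt x y = (if y = x then 1
      else if lt x y then - (\<Sum>z\<in>{z \<in> A. (z = x \<or> lt x z) \<and> lt z y}. cut (mobius A lt x) ?r y z)
      else 0)"
    by (rule def_wfrec[OF eq_reflection[OF mobius_def] wf])
  ultimately show ?thesis by (simp only:)
qed

end

theory Submission
  imports Defs
begin

text \<open>On basis elements the Hopf monoid consists of a commutative product \<open>a \<cdot> b\<close> and of restrictions
  \<open>l|S\<close>, which are functorial by coassociativity and cocommutativity, and the compatibility of the two
  says that restriction is multiplicative.  The whole theorem is read off from this set-theoretic
  structure, here the locale \<open>set_hopf\<close>.

  The order is generated by the cuts \<open>l \<mapsto> l|S \<cdot> l|(I - S)\<close>.  Cuts commute, so whenever an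
  element splits along \<open>S\<close>, everything below it does too (\<open>le_splits\<close>).  Moreover product and restriction
  are adjoint: \<open>a \<cdot> b \<preceq> l\<close> iff \<open>a \<preceq> l|S\<close> and \<open>b \<preceq> l|T\<close> (\<open>mul_le_iff\<close>).  Hence
  multiplication identifies the product of the down-sets of \<open>l|S\<close> and \<open>l|T\<close> with the elements below
  \<open>l\<close> that split along \<open>S\<close>, and likewise for up-sets when \<open>l\<close> itself splits.

  Moebius inversion gives \<open>l = (\<Sum>x\<preceq>l. p x)\<close> and \<open>p l = (\<Sum>x\<succeq>l. m x)\<close>, and a function on a
  finite poset is determined by its sums over down-sets, or over up-sets.  So each formula for
  \<open>p\<close> and \<open>m\<close> may be checked after summation, where it becomes the
  corresponding formula one step earlier, by the identification above: the product and
  coproduct of \<open>P\<close> give those of \<open>p\<close>, which give those of \<open>m\<close>.  In the same way the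
  Moebius numbers \<open>\<mu>(l)\<close> are multiplicative, being determined by their sums over down-sets, which are
  \<open>1\<close> for minimal \<open>l\<close> and \<open>0\<close> otherwise.  Any multiplicative weight \<open>w\<close> turns \<open>p\<close> into a family
  \<open>\<Sum>x\<preceq>l. w(x) p x\<close> that multiplies and comultiplies like \<open>P\<close>; the families \<open>e\<close> and \<open>h\<close> are
  the weights \<open>\<mu>\<close> and \<open>\<bar>\<mu>\<bar>\<close> (\<open>weighted_family\<close>).

  Strong linearization makes \<open>\<mu>(l)\<close> nonzero, so that \<open>e\<close> and \<open>h\<close> are bases.  By
  multiplicativity it is enough to treat an indecomposable \<open>l\<close>.  An element below \<open>l\<close> is then given by its
  block \<open>B\<close> at a fixed point \<open>i\<close> and an arbitrary element below \<open>l|(I - B)\<close>; summing \<open>\<mu>\<close> leaves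
  \<open>\<mu>(l) = - (\<Sum>j\<noteq>i. \<mu>(l|(I - {j})))\<close>, whence \<open>\<mu>(l) = (-1)\<^sup>n\<^sup>-\<^sup>1 (n - 1)!\<close> with \<open>n\<close> the number
  of points of \<open>I\<close> (\<open>c_indec\<close>).

  The changes of basis are morphisms because the two families obey the same formulas.\<close>

section \<open>Finite posets and their Moebius functions\<close>

locale finite_poset =
  fixes A :: "'a set" and le :: "'a \<Rightarrow> 'a \<Rightarrow> bool"
  assumes finite_A: "finite A"
    and le_refl: "x \<in> A \<Longrightarrow> le x x"
    and le_antisym: "\<lbrakk>x \<in> A; y \<in> A; le x y; le y x\<rbrakk> \<Longrightarrow> x = y"
    and le_trans: "\<lbrakk>x \<in> A; y \<in> A; z \<in> A; le x y; le y z\<rbrakk> \<Longrightarrow> le x z"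

lemma finite_poset_dual: "finite_poset A le \<Longrightarrow> finite_poset A (\<lambda>x y. le y x)"
  unfolding finite_poset_def by blast

lemma finite_poset_prod:
  assumes "finite_poset A leA" "finite_poset B leB"
  shows "finite_poset (A \<times> B) (\<lambda>x y. leA (fst x) (fst y) \<and> leB (snd x) (snd y))"
proof -
  interpret A: finite_poset A leA by fact
  interpret B: finite_poset B leB by fact
  show ?thesis
  proof
    show "finite (A \<times> B)" by (simp add: A.finite_A B.finite_A)
  next
    fix x y assume "x \<in> A \<times> B" "y \<in> A \<times> B"
      "leA (fst x) (fst y) \<and> leB (snd x) (snd y)" "leA (fst y) (fst x) \<and> leB (snd y) (snd x)"
    then show "x = y" using A.le_antisym B.le_antisym by (simp add: mem_Times_iff prod_eq_iff)
  next
    fix x y z assume "x \<in> A \<times> B" "y \<in> A \<times> B" "z \<in> A \<times> B"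
      "leA (fst x) (fst y) \<and> leB (snd x) (snd y)" "leA (fst y) (fst z) \<and> leB (snd y) (snd z)"
    then show "leA (fst x) (fst z) \<and> leB (snd x) (snd z)"
      using A.le_trans[of "fst x" "fst y" "fst z"] B.le_trans[of "snd x" "snd y" "snd z"]
      by (simp add: mem_Times_iff)
  qed (auto intro: A.le_refl B.le_refl)
qed

context finite_poset
begin

abbreviation mu :: "'a \<Rightarrow> 'a \<Rightarrow> int" where
  "mu \<equiv> mobius A (\<lambda>x y. le x y \<and> x \<noteq> y)"

text \<open>The system that expresses the sums over principal down-sets is unitriangular.  Below, this
  takes the place of explicit Moebius inversion: two families are identified by comparing
  their sums over down-sets, which are simpler.  Up-sets are covered by the dual poset.\<close>

lemma eq_if_downset_sums_eq:
  fixes F G :: "'a \<Rightarrow> 'b::ab_group_add"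
  assumes sums: "\<And>l. l \<in> A \<Longrightarrow> sum F {x \<in> A. le x l} = sum G {x \<in> A. le x l}"
    and "l \<in> A"
  shows "F l = G l"
  using assms(2)
proof (induction "card {x \<in> A. le x l}" arbitrary: l rule: less_induct)
  case less
  let ?D = "{x \<in> A. le x l}"
  have "F x = G x" if "x \<in> ?D - {l}" for x
  proof (rule less.hyps)
    have "{y \<in> A. le y x} \<subset> ?D"
      using that less.prems le_refl le_trans le_antisym by blast
    then show "card {y \<in> A. le y x} < card ?D"
      using finite_A by (intro psubset_card_mono) auto
  qed (use that in auto)
  then have "sum F (?D - {l}) = sum G (?D - {l})" by (intro sum.cong) auto
  moreover have "sum H ?D = H l + sum H (?D - {l})" for H :: "'a \<Rightarrow> 'b"
    using less.prems finite_A le_refl by (intro sum.remove) auto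
  ultimately show ?case using sums[OF less.prems] by simp
qed

lemma mu_rec:
  assumes "y \<in> A"
  shows "mu x y = (if y = x then 1
    else if le x y \<and> x \<noteq> y
      then - (\<Sum>z\<in>{z \<in> A. (z = x \<or> le x z \<and> x \<noteq> z) \<and> le z y \<and> z \<noteq> y}. mu x z)
    else 0)"
proof (rule mobius_eq[OF finite_A _ _ assms])
  fix u v w assume "u \<in> A" "v \<in> A" "w \<in> A" "le u v \<and> u \<noteq> v" "le v w \<and> v \<noteq> w"
  then show "le u w \<and> u \<noteq> w" using le_trans[of u v w] le_antisym[of u v] by blast
qed simp

lemma mu_refl: "x \<in> A \<Longrightarrow> mu x x = 1"
  using mu_rec[of x x] by simp

lemma mu_sum_lower:
  assumes "x \<in> A" "y \<in> A"
  shows "(\<Sum>z | z \<in> A \<and> le x z \<and> le z y. mu x z) = (if x = y then 1 else 0)"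
proof (cases "le x y \<and> x \<noteq> y")
  case False
  then consider "x = y" | "x \<noteq> y" "\<not> le x y" by blast
  then show ?thesis
  proof cases
    case 1
    then have "{z. z \<in> A \<and> le x z \<and> le z y} = {x}" using assms le_antisym le_refl by blast
    then show ?thesis using 1 assms by (simp add: mu_refl)
  next
    case 2
    then have "{z. z \<in> A \<and> le x z \<and> le z y} = {}" using assms le_trans by blast
    then show ?thesis using 2 by (simp only: sum.empty if_False)
  qed
next
  case True
  let ?I = "{z. z \<in> A \<and> le x z \<and> le z y}"
  have "(\<Sum>z\<in>?I. mu x z) = mu x y + (\<Sum>z\<in>?I - {y}. mu x z)"
    using assms le_refl finite_A True by (intro sum.remove) auto
  also have "?I - {y} = {z \<in> A. (z = x \<or> le x z \<and> x \<noteq> z) \<and> le z y \<and> z \<noteq> y}"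
    using True assms le_refl by blast
  also have "mu x y = - (\<Sum>z\<in>{z \<in> A. (z = x \<or> le x z \<and> x \<noteq> z) \<and> le z y \<and> z \<noteq> y}. mu x z)"
    using True not_sym[of x y] by (simp only: mu_rec[OF assms(2), of x] if_True if_False simp_thms)
  finally show ?thesis using True by (simp only: if_False)
qed

text \<open>By \<open>mu_sum_lower\<close>, \<open>mu\<close> is a left inverse of the zeta function in the incidence algebra.  It is
  also a right inverse: with \<open>F\<close> the product of zeta and \<open>mu\<close> in the wrong order, \<open>conv\<close> says that
  \<open>mu \<cdot> F = mu\<close>, and \<open>mu\<close>, being unitriangular, can be cancelled.\<close>

lemma mu_sum_upper:
  assumes x: "x \<in> A" and y: "y \<in> A"
  shows "(\<Sum>z | z \<in> A \<and> le x z \<and> le z y. mu z y) = (if x = y then 1 else 0)"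
proof -
  define F where "F w = (\<Sum>z | z \<in> A \<and> le w z \<and> le z y. mu z y)" for w
  have conv: "(\<Sum>w | w \<in> A \<and> le x w. mu x w * F w) = (\<Sum>w | w \<in> A \<and> le x w. mu x w * of_bool (w = y))"
    if x: "x \<in> A" for x
  proof -
    have "(\<Sum>w | w \<in> A \<and> le x w. mu x w * F w)
        = (\<Sum>w\<in>{w \<in> A. le x w}. \<Sum>z | z \<in> {z\<in>A. le z y} \<and> le w z. mu x w * mu z y)"
      unfolding F_def sum_distrib_left by (intro sum.cong) auto
    also have "\<dots> = (\<Sum>z\<in>{z\<in>A. le z y}. \<Sum>w | w \<in> {w \<in> A. le x w} \<and> le w z. mu x w * mu z y)"
      using finite_A by (intro sum.swap_restrict) auto
    also have "\<dots> = (\<Sum>z\<in>{z\<in>A. le z y}. if x = z then mu z y else 0)"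
    proof (intro sum.cong refl)
      fix z assume z: "z \<in> {z\<in>A. le z y}"
      have "(\<Sum>w | w \<in> {w \<in> A. le x w} \<and> le w z. mu x w) = (if x = z then 1 else 0)"
        using x z unfolding mem_Collect_eq conj_assoc by (intro mu_sum_lower) auto
      then show "(\<Sum>w | w \<in> {w \<in> A. le x w} \<and> le w z. mu x w * mu z y) = (if x = z then mu z y else 0)"
        unfolding sum_distrib_right[symmetric] by simp
    qed
    also have "\<dots> = (if le x y then mu x y else 0)"
      using x finite_A by (subst sum.delta') auto
    also have "\<dots> = (\<Sum>w\<in>{w \<in> A. le x w}. if w = y then mu x w else 0)"
      using y finite_A by (subst sum.delta) auto
    also have "\<dots> = (\<Sum>w | w \<in> A \<and> le x w. mu x w * of_bool (w = y))"
      by (intro sum.cong) auto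
    finally show ?thesis .
  qed
  have "F x = of_bool (x = y)"
    using x
  proof (induction "card {w \<in> A. le x w}" arbitrary: x rule: less_induct)
    case less
    let ?U = "{w. w \<in> A \<and> le x w}"
    have IH: "F w = of_bool (w = y)" if "w \<in> ?U - {x}" for w
    proof (rule less.hyps)
      have "{v \<in> A. le w v} \<subset> {w \<in> A. le x w}"
        using that less.prems le_refl le_trans le_antisym by blast
      then show "card {v \<in> A. le w v} < card {w \<in> A. le x w}"
        using finite_A by (intro psubset_card_mono) auto
    qed (use that in auto)
    have rm: "sum H ?U = H x + sum H (?U - {x})" for H :: "'a \<Rightarrow> int"
      using less.prems finite_A le_refl by (intro sum.remove) auto
    have "(\<Sum>w\<in>?U - {x}. mu x w * F w) = (\<Sum>w\<in>?U - {x}. mu x w * of_bool (w = y))"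
      using IH by (intro sum.cong) auto
    with conv[OF less.prems] show ?case unfolding rm using less.prems by (simp add: mu_refl)
  qed
  then show ?thesis by (simp add: F_def of_bool_def)
qed

lemma mobius_inversion_below:
  fixes s :: "'k::field \<Rightarrow> 'b::ab_group_add \<Rightarrow> 'b"
  assumes "vector_space s"
    and f: "\<And>l. l \<in> A \<Longrightarrow> f l = (\<Sum>x | x \<in> A \<and> le x l. s (of_int (mu x l)) (g x))"
    and l: "l \<in> A"
  shows "(\<Sum>x | x \<in> A \<and> le x l. f x) = g l"
proof -
  interpret vector_space s by fact
  have "(\<Sum>z | z \<in> A \<and> le z l. f z)
      = (\<Sum>z\<in>{z\<in>A. le z l}. \<Sum>x | x \<in> A \<and> le x z. s (of_int (mu x z)) (g x))"
    using f by (intro sum.cong) auto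
  also have "\<dots> = (\<Sum>x\<in>A. \<Sum>z | z \<in> {z\<in>A. le z l} \<and> le x z. s (of_int (mu x z)) (g x))"
    using finite_A by (intro sum.swap_restrict) auto
  also have "\<dots> = (\<Sum>x\<in>A. if x = l then g x else 0)"
  proof (intro sum.cong refl)
    fix x assume x: "x \<in> A"
    have "{z. z \<in> {z\<in>A. le z l} \<and> le x z} = {z. z \<in> A \<and> le x z \<and> le z l}" by auto
    then have "(\<Sum>z | z \<in> {z\<in>A. le z l} \<and> le x z. mu x z) = (if x = l then 1 else 0)"
      using mu_sum_lower[OF x l] by (simp only:)
    then show "(\<Sum>z | z \<in> {z\<in>A. le z l} \<and> le x z. s (of_int (mu x z)) (g x)) = (if x = l then g x else 0)"
      unfolding scale_sum_left[symmetric] of_int_sum[symmetric] by (cases "x = l") (simp_all only: if_True if_False simp_thms of_int_1 of_int_0 scale_one scale_zero_left)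
  qed
  also have "\<dots> = g l" using l finite_A by (subst sum.delta) auto
  finally show ?thesis .
qed

lemma mobius_inversion_above:
  fixes s :: "'k::field \<Rightarrow> 'b::ab_group_add \<Rightarrow> 'b"
  assumes "vector_space s"
    and f: "\<And>l. l \<in> A \<Longrightarrow> f l = (\<Sum>x | x \<in> A \<and> le l x. s (of_int (mu l x)) (g x))"
    and l: "l \<in> A"
  shows "(\<Sum>x | x \<in> A \<and> le l x. f x) = g l"
proof -
  interpret vector_space s by fact
  have "(\<Sum>z | z \<in> A \<and> le l z. f z)
      = (\<Sum>z\<in>{z\<in>A. le l z}. \<Sum>x | x \<in> A \<and> le z x. s (of_int (mu z x)) (g x))"
    using f by (intro sum.cong) auto
  also have "\<dots> = (\<Sum>x\<in>A. \<Sum>z | z \<in> {z\<in>A. le l z} \<and> le z x. s (of_int (mu z x)) (g x))"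
    using finite_A by (intro sum.swap_restrict) auto
  also have "\<dots> = (\<Sum>x\<in>A. if x = l then g x else 0)"
  proof (intro sum.cong refl)
    fix x assume x: "x \<in> A"
    have "{z. z \<in> {z\<in>A. le l z} \<and> le z x} = {z. z \<in> A \<and> le l z \<and> le z x}" by auto
    then have "(\<Sum>z | z \<in> {z\<in>A. le l z} \<and> le z x. mu z x) = (if l = x then 1 else 0)"
      using mu_sum_upper[OF l x] by (simp only:)
    then show "(\<Sum>z | z \<in> {z\<in>A. le l z} \<and> le z x. s (of_int (mu z x)) (g x)) = (if x = l then g x else 0)"
      unfolding scale_sum_left[symmetric] of_int_sum[symmetric] by (cases "x = l") (simp_all only: if_True if_False simp_thms of_int_1 of_int_0 scale_one scale_zero_left eq_commute[of l x])
  qed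
  also have "\<dots> = g l" using l finite_A by (subst sum.delta) auto
  finally show ?thesis .
qed

end

section \<open>Commutative cocommutative Hopf monoids in set species\<close>

text \<open>\<open>mul S T a b\<close> is \<open>a \<cdot> b\<close> and \<open>res I S l\<close> is the restriction of \<open>l \<in> P I\<close> to \<open>S\<close>.  That \<open>res\<close> takes no
  further argument expresses cocommutativity, \<open>res_res\<close> is coassociativity and \<open>res_mul\<close> the
  compatibility of product and coproduct.\<close>

locale set_hopf =
  fixes P :: "'l set \<Rightarrow> 'v set"
    and mul :: "'l set \<Rightarrow> 'l set \<Rightarrow> 'v \<Rightarrow> 'v \<Rightarrow> 'v"
    and res :: "'l set \<Rightarrow> 'l set \<Rightarrow> 'v \<Rightarrow> 'v"
    and u :: 'v
  assumes finite_P: "finite I \<Longrightarrow> finite (P I)"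
    and P_empty: "P {} = {u}"
    and mul_closed: "\<lbrakk>disj S T; a \<in> P S; b \<in> P T\<rbrakk> \<Longrightarrow> mul S T a b \<in> P (S \<union> T)"
    and mul_comm: "\<lbrakk>disj S T; a \<in> P S; b \<in> P T\<rbrakk> \<Longrightarrow> mul S T a b = mul T S b a"
    and mul_assoc: "\<lbrakk>disj R S; disj R T; disj S T; a \<in> P R; b \<in> P S; c \<in> P T\<rbrakk> \<Longrightarrow>
      mul (R \<union> S) T (mul R S a b) c = mul R (S \<union> T) a (mul S T b c)"
    and mul_unit: "\<lbrakk>finite S; a \<in> P S\<rbrakk> \<Longrightarrow> mul {} S u a = a"
    and res_closed: "\<lbrakk>finite I; S \<subseteq> I; l \<in> P I\<rbrakk> \<Longrightarrow> res I S l \<in> P S"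
    and res_self: "\<lbrakk>finite I; l \<in> P I\<rbrakk> \<Longrightarrow> res I I l = l"
    and res_res: "\<lbrakk>finite I; S \<subseteq> I; R \<subseteq> S; l \<in> P I\<rbrakk> \<Longrightarrow> res S R (res I S l) = res I R l"
    and res_mul: "\<lbrakk>disj R R'; S \<subseteq> R \<union> R'; a \<in> P R; b \<in> P R'\<rbrakk> \<Longrightarrow>
      res (R \<union> R') S (mul R R' a b) =
      mul (R \<inter> S) (R' \<inter> S) (res R (R \<inter> S) a) (res R' (R' \<inter> S) b)"
begin

definition cut :: "'l set \<Rightarrow> 'l set \<Rightarrow> 'v \<Rightarrow> 'v" where
  "cut I S l = mul S (I - S) (res I S l) (res I (I - S) l)"

text \<open>These are the generators in the definition of \<open>prec\<close>.\<close>

definition step :: "'l set \<Rightarrow> ('v \<times> 'v) set" where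
  "step I = {(a, b). a \<in> P I \<and> b \<in> P I \<and> a \<noteq> b \<and> (\<exists>S\<subseteq>I. a = cut I S b)}"

definition le :: "'l set \<Rightarrow> 'v \<Rightarrow> 'v \<Rightarrow> bool" where
  "le I a b \<longleftrightarrow> (a, b) \<in> (step I)\<^sup>*"

text \<open>These are the products of elements over singletons.  They are the minimal elements of the order,
  see \<open>discrete_iff_minimal\<close>.\<close>

definition discrete :: "'l set \<Rightarrow> 'v \<Rightarrow> bool" where
  "discrete I l \<longleftrightarrow> l \<in> P I \<and> (\<forall>S\<subseteq>I. cut I S l = l)"

definition indec :: "'l set \<Rightarrow> 'v \<Rightarrow> bool" where
  "indec I l \<longleftrightarrow> I \<noteq> {} \<and> l \<in> P I \<and> (\<forall>S\<subseteq>I. cut I S l = l \<longrightarrow> S = {} \<or> S = I)"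

lemma disj_Diff: "finite I \<Longrightarrow> S \<subseteq> I \<Longrightarrow> disj S (I - S)"
  by (auto simp: disj_def finite_subset)

lemma mul_unit_right: "\<lbrakk>finite S; a \<in> P S\<rbrakk> \<Longrightarrow> mul S {} a u = a"
  using mul_comm[of S "{}" a u] mul_unit[of S a] P_empty by (simp add: disj_def)

lemma res_empty: "finite I \<Longrightarrow> l \<in> P I \<Longrightarrow> res I {} l = u"
  using res_closed[of I "{}" l] P_empty by simp

text \<open>Compatibility for the decomposition \<open>S \<squnion> T\<close> itself: the two off-diagonal factors lie over the
  empty set.  In particular products determine their factors.\<close>

lemma res_mul_left: "\<lbrakk>disj S T; a \<in> P S; b \<in> P T\<rbrakk> \<Longrightarrow> res (S \<union> T) S (mul S T a b) = a"
  by (subst res_mul) (auto simp: disj_def Int_commute res_self res_empty mul_unit_right)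

lemma res_mul_right:
  assumes "disj S T" "a \<in> P S" "b \<in> P T"
  shows "res (S \<union> T) T (mul S T a b) = b"
proof -
  have "res (T \<union> S) T (mul T S b a) = b"
    using assms by (intro res_mul_left) (auto simp: disj_def)
  then show ?thesis using mul_comm[OF assms] by (simp add: Un_commute)
qed

text \<open>Both sides are the product of the four factors, bracketed and ordered differently.\<close>

lemma mul_mul_swap:
  assumes d: "disj A B" "disj A C" "disj A D" "disj B C" "disj B D" "disj C D"
    and m: "a \<in> P A" "b \<in> P B" "c \<in> P C" "d \<in> P D"
  shows "mul (A \<union> B) (C \<union> D) (mul A B a b) (mul C D c d) =
         mul (A \<union> C) (B \<union> D) (mul A C a c) (mul B D b d)"
proof -
  have dj: "disj X (Y \<union> Z)" if "disj X Y" "disj X Z" for X Y Z :: "'l set"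
    using that by (auto simp: disj_def)
  have dc: "disj Y X" if "disj X Y" for X Y :: "'l set"
    using that by (auto simp: disj_def)
  have "mul (A \<union> B) (C \<union> D) (mul A B a b) (mul C D c d) =
        mul A (B \<union> (C \<union> D)) a (mul B (C \<union> D) b (mul C D c d))"
    using d m by (intro mul_assoc dj mul_closed)
  also have "mul B (C \<union> D) b (mul C D c d) = mul (B \<union> C) D (mul B C b c) d"
    using d m by (intro mul_assoc[symmetric])
  also have "mul B C b c = mul C B c b" using d m by (intro mul_comm)
  also have "mul (B \<union> C) D (mul C B c b) d = mul C (B \<union> D) c (mul B D b d)"
    using d m dc[OF d(4)] by (subst Un_commute[of B C]) (intro mul_assoc)
  also have "B \<union> (C \<union> D) = C \<union> (B \<union> D)" by blast
  also have "mul A (C \<union> (B \<union> D)) a (mul C (B \<union> D) c (mul B D b d)) =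
             mul (A \<union> C) (B \<union> D) (mul A C a c) (mul B D b d)"
    using d m dc[OF d(4)] by (intro mul_assoc[symmetric] dj mul_closed)
  finally show ?thesis .
qed

lemma cut_closed: "\<lbrakk>finite I; S \<subseteq> I; l \<in> P I\<rbrakk> \<Longrightarrow> cut I S l \<in> P I"
  using mul_closed[OF disj_Diff, of I S "res I S l" "res I (I - S) l"]
  by (auto simp: cut_def res_closed Un_absorb1)

lemma cut_empty: "finite I \<Longrightarrow> l \<in> P I \<Longrightarrow> cut I {} l = l"
  by (simp add: cut_def res_empty res_self mul_unit)

lemma cut_all: "finite I \<Longrightarrow> l \<in> P I \<Longrightarrow> cut I I l = l"
  by (simp add: cut_def res_empty res_self mul_unit_right)

lemma cut_compl:
  assumes "finite I" "S \<subseteq> I" "l \<in> P I"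
  shows "cut I (I - S) l = cut I S l"
proof -
  have "I - (I - S) = S" using assms(2) by blast
  then show ?thesis
    unfolding cut_def using assms by (simp add: mul_comm[OF disj_Diff] res_closed)
qed

lemma res_cut:
  assumes "finite I" "S \<subseteq> I" "R \<subseteq> I" "l \<in> P I"
  shows "res I S (cut I R l) = cut S (R \<inter> S) (res I S l)"
proof -
  have I: "R \<union> (I - R) = I" "(I - R) \<inter> S = S - R \<inter> S" using assms by blast+
  have "res (R \<union> (I - R)) S (cut I R l) =
      mul (R \<inter> S) ((I - R) \<inter> S) (res R (R \<inter> S) (res I R l)) (res (I - R) ((I - R) \<inter> S) (res I (I - R) l))"
    unfolding cut_def using assms by (intro res_mul disj_Diff res_closed) auto
  also have "\<dots> = mul (R \<inter> S) ((I - R) \<inter> S) (res I (R \<inter> S) l) (res I ((I - R) \<inter> S) l)"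
    using assms by (simp add: res_res)
  also have "\<dots> = cut S (R \<inter> S) (res I S l)"
    unfolding cut_def I using assms by (simp add: res_res)
  finally show ?thesis unfolding I .
qed

lemma res_cut_self:
  assumes "finite I" "S \<subseteq> I" "l \<in> P I"
  shows "res I S (cut I S l) = res I S l"
  using res_mul_left[OF disj_Diff[OF assms(1,2)] res_closed[OF assms] res_closed[OF assms(1) _ assms(3), of "I - S"]]
    assms(2) by (simp add: cut_def Un_absorb1)

lemma cut_mul_absorb:
  assumes "disj S T" "a \<in> P S" "b \<in> P T"
  shows "cut (S \<union> T) S (mul S T a b) = mul S T a b"
proof -
  have "S \<union> T - S = T" using assms by (auto simp: disj_def)
  then show ?thesis using assms by (simp add: cut_def res_mul_left res_mul_right)
qed

text \<open>The right-hand side is symmetric in \<open>S\<close> and \<open>R\<close> up to the order of the two middle factors.\<close>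

lemma cut_cut:
  assumes "finite I" "S \<subseteq> I" "R \<subseteq> I" "l \<in> P I"
  shows "cut I S (cut I R l) =
    mul (S \<inter> R \<union> (S - R)) ((R - S) \<union> (I - (S \<union> R)))
      (mul (S \<inter> R) (S - R) (res I (S \<inter> R) l) (res I (S - R) l))
      (mul (R - S) (I - (S \<union> R)) (res I (R - S) l) (res I (I - (S \<union> R)) l))"
proof -
  have e: "S \<inter> R \<union> (S - R) = S" "(R - S) \<union> (I - (S \<union> R)) = I - S"
    "R \<inter> S = S \<inter> R" "S - S \<inter> R = S - R" "R \<inter> (I - S) = R - S" "I - S - (R - S) = I - (S \<union> R)"
    using assms by blast+
  have "cut I S (cut I R l) = mul S (I - S) (cut S (R \<inter> S) (res I S l)) (cut (I - S) (R \<inter> (I - S)) (res I (I - S) l))"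
    using assms unfolding cut_def[of I S] by (simp add: res_cut)
  also have "cut S (R \<inter> S) (res I S l) = mul (S \<inter> R) (S - R) (res I (S \<inter> R) l) (res I (S - R) l)"
    unfolding cut_def e using assms by (auto simp: res_res)
  also have "cut (I - S) (R \<inter> (I - S)) (res I (I - S) l) =
      mul (R - S) (I - (S \<union> R)) (res I (R - S) l) (res I (I - (S \<union> R)) l)"
  proof -
    have "R - S \<subseteq> I - S" "I - (S \<union> R) \<subseteq> I - S" using assms by blast+
    then show ?thesis unfolding cut_def e using assms by (simp add: res_res)
  qed
  finally show ?thesis unfolding e .
qed

lemma cut_commute:
  assumes "finite I" "S \<subseteq> I" "R \<subseteq> I" "l \<in> P I"
  shows "cut I S (cut I R l) = cut I R (cut I S l)"
proof -
  have fin: "finite S" "finite R" using assms finite_subset by blast+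
  have e: "R \<inter> S = S \<inter> R" "R \<union> S = S \<union> R" by blast+
  have sub: "S \<inter> R \<subseteq> I" "S - R \<subseteq> I" "R - S \<subseteq> I" "I - (S \<union> R) \<subseteq> I" using assms by blast+
  have "disj (S \<inter> R) (S - R)" "disj (S \<inter> R) (R - S)" "disj (S \<inter> R) (I - (S \<union> R))"
    "disj (S - R) (R - S)" "disj (S - R) (I - (S \<union> R))" "disj (R - S) (I - (S \<union> R))"
    using fin assms(1) by (auto simp: disj_def)
  from mul_mul_swap[OF this res_closed[OF assms(1) sub(1) assms(4)] res_closed[OF assms(1) sub(2) assms(4)]
      res_closed[OF assms(1) sub(3) assms(4)] res_closed[OF assms(1) sub(4) assms(4)]]
  show ?thesis unfolding cut_cut[OF assms] cut_cut[OF assms(1,3,2,4)] e .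
qed

lemma cut_idem:
  assumes "finite I" "S \<subseteq> I" "l \<in> P I"
  shows "cut I S (cut I S l) = cut I S l"
proof -
  have "res I (I - S) (cut I S l) = res I (I - S) l"
    using res_cut_self[OF assms(1) Diff_subset[of I S] assms(3)] cut_compl[OF assms] by simp
  then show ?thesis using res_cut_self[OF assms] by (simp add: cut_def)
qed

text \<open>A cut of the first factor is a cut of the product that keeps the second factor together
  with one of the two pieces.\<close>

lemma cut_mul_left:
  assumes "disj S T" "R \<subseteq> S" "a \<in> P S" "b \<in> P T"
  shows "cut (S \<union> T) (R \<union> T) (mul S T a b) = mul S T (cut S R a) b"
proof -
  have f: "finite S" "finite T" "S \<inter> T = {}" using assms by (auto simp: disj_def)
  have fR: "finite R" "finite (S - R)" using assms f finite_subset by blast+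
  have e: "S \<inter> (R \<union> T) = R" "T \<inter> (R \<union> T) = T" "S \<union> T - (R \<union> T) = S - R"
     "S \<inter> (S - R) = S - R" "T \<inter> (S - R) = {}" "(S - R) \<union> R = S"
    using f assms by blast+
  have m: "res S R a \<in> P R" "res S (S - R) a \<in> P (S - R)"
    using assms f by (auto intro: res_closed)
  have 1: "res (S \<union> T) (R \<union> T) (mul S T a b) = mul R T (res S R a) b"
    using assms f e by (subst res_mul) (auto simp: res_self)
  have 2: "res (S \<union> T) (S - R) (mul S T a b) = res S (S - R) a"
    using assms f e m fR by (subst res_mul) (auto simp: res_empty mul_unit_right)
  have dRT: "disj R T" "disj (S - R) R" "disj (S - R) T" "disj (R \<union> T) (S - R)"
    using f fR assms by (auto simp: disj_def)
  have "cut (S \<union> T) (R \<union> T) (mul S T a b) = mul (R \<union> T) (S - R) (mul R T (res S R a) b) (res S (S - R) a)"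
    unfolding cut_def e 1 2 ..
  also have "\<dots> = mul (S - R) (R \<union> T) (res S (S - R) a) (mul R T (res S R a) b)"
    using dRT m assms by (intro mul_comm mul_closed)
  also have "\<dots> = mul ((S - R) \<union> R) T (mul (S - R) R (res S (S - R) a) (res S R a)) b"
    using dRT m assms by (intro mul_assoc[symmetric])
  also have "mul (S - R) R (res S (S - R) a) (res S R a) = cut S R a"
    unfolding cut_def using dRT m by (intro mul_comm)
  finally show ?thesis unfolding e .
qed

subsection \<open>The order by successive cuts\<close>

lemma le_refl [simp]: "le I a a"
  by (simp add: le_def)

lemma le_trans: "le I a b \<Longrightarrow> le I b c \<Longrightarrow> le I a c"
  by (auto simp: le_def)

lemma le_closed: "le I a b \<Longrightarrow> b \<in> P I \<Longrightarrow> a \<in> P I"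
  unfolding le_def by (erule converse_rtranclE) (auto simp: step_def)

lemma cut_le: "\<lbrakk>finite I; S \<subseteq> I; l \<in> P I\<rbrakk> \<Longrightarrow> le I (cut I S l) l"
  unfolding le_def using cut_closed[of I S l]
  by (cases "cut I S l = l") (auto simp: step_def intro!: r_into_rtrancl)

lemma le_res:
  assumes "finite I" "S \<subseteq> I" "le I a b"
  shows "le S (res I S a) (res I S b)"
  using assms(3) unfolding le_def
proof (induction rule: rtrancl_induct)
  case (step b c)
  then obtain R where R: "R \<subseteq> I" "b = cut I R c" "c \<in> P I" by (auto simp: step_def)
  have "finite S" using assms finite_subset by blast
  then have "le S (cut S (R \<inter> S) (res I S c)) (res I S c)"
    using R assms by (intro cut_le res_closed) auto
  then have "le S (res I S b) (res I S c)"
    using R assms by (simp add: res_cut)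
  with step.IH show ?case by (simp add: le_def)
qed auto

lemma le_mul_left:
  assumes "disj S T" "le S a a'" "a' \<in> P S" "b \<in> P T"
  shows "le (S \<union> T) (mul S T a b) (mul S T a' b)"
  using assms(2) unfolding le_def
proof (induction rule: converse_rtrancl_induct)
  case (step a c)
  then obtain R where R: "R \<subseteq> S" "a = cut S R c" "c \<in> P S" by (auto simp: step_def)
  have "le (S \<union> T) (cut (S \<union> T) (R \<union> T) (mul S T c b)) (mul S T c b)"
    using assms R by (intro cut_le mul_closed) (auto simp: disj_def)
  then have "le (S \<union> T) (mul S T a b) (mul S T c b)"
    using R assms by (simp add: cut_mul_left)
  with step.IH show ?case by (simp add: le_def)
qed auto

lemma le_mul:
  assumes "disj S T" "le S a a'" "le T b b'" "a' \<in> P S" "b' \<in> P T"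
  shows "le (S \<union> T) (mul S T a b) (mul S T a' b')"
proof -
  have m: "a \<in> P S" "b \<in> P T" using assms le_closed by blast+
  have d: "disj T S" using assms(1) by (auto simp: disj_def)
  have "le (T \<union> S) (mul T S b a') (mul T S b' a')"
    by (rule le_mul_left[OF d assms(3,5,4)])
  then have "le (S \<union> T) (mul S T a' b) (mul S T a' b')"
    using assms m mul_comm[of S T a'] by (simp add: Un_commute)
  with le_mul_left[OF assms(1,2,4) m(2)] show ?thesis by (rule le_trans)
qed

text \<open>Cuts commute, so every way of splitting \<open>b\<close> as a product also splits each \<open>a\<close> below it.\<close>

lemma le_splits:
  assumes "finite I" "S \<subseteq> I" "le I a b" "cut I S b = b"
  shows "cut I S a = a"
  using assms(3) unfolding le_def
proof (induction rule: converse_rtrancl_induct)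
  case base
  then show ?case using assms by simp
next
  case (step a c)
  then obtain R where R: "R \<subseteq> I" "a = cut I R c" "c \<in> P I" by (auto simp: step_def)
  then show ?case using cut_commute[OF assms(1,2) R(1,3)] step.IH by simp
qed

text \<open>Going strictly down creates a new splitting and destroys none.\<close>

lemma step_trancl_splits:
  assumes "finite I" "(a, b) \<in> (step I)\<^sup>+"
  shows "{S. S \<subseteq> I \<and> cut I S b = b} \<subset> {S. S \<subseteq> I \<and> cut I S a = a}"
proof -
  from assms(2) obtain c where c: "(a, c) \<in> (step I)\<^sup>*" "(c, b) \<in> step I"
    by (meson tranclD2)
  then obtain R where R: "R \<subseteq> I" "c = cut I R b" "b \<in> P I" "c \<noteq> b"
    by (auto simp: step_def)
  have ab: "le I a b" "le I a c" using assms(2) c by (auto simp: le_def)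
  have "cut I R c = c" using R assms by (simp add: cut_idem)
  then have "cut I R a = a" using le_splits[OF assms(1) R(1) ab(2)] by simp
  moreover have "cut I R b \<noteq> b" using R by simp
  ultimately show ?thesis using le_splits[OF assms(1) _ ab(1)] R(1) by blast
qed

lemma step_trancl_irrefl: "finite I \<Longrightarrow> (a, a) \<notin> (step I)\<^sup>+"
  using step_trancl_splits by blast

lemma le_antisym: "\<lbrakk>finite I; le I a b; le I b a\<rbrakk> \<Longrightarrow> a = b"
  using step_trancl_irrefl[of I a] unfolding le_def
  by (metis rtranclD rtrancl_trancl_trancl)

lemma finite_poset_le: "finite I \<Longrightarrow> finite_poset (P I) (le I)"
  by unfold_locales (auto intro: finite_P le_antisym le_trans)

text \<open>Product and restriction are adjoint: from left to right restrict both sides, from right to left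
  insert the cut of \<open>l\<close> along \<open>S\<close>.\<close>

lemma mul_le_iff:
  assumes "disj S T" "a \<in> P S" "b \<in> P T" "l \<in> P (S \<union> T)"
  shows "le (S \<union> T) (mul S T a b) l \<longleftrightarrow> le S a (res (S \<union> T) S l) \<and> le T b (res (S \<union> T) T l)"
    (is "?L \<longleftrightarrow> ?R")
proof
  have fin: "finite (S \<union> T)" "S \<union> T - S = T" using assms(1) by (auto simp: disj_def)
  show ?R if ?L
    using le_res[OF fin(1) _ that, of S] le_res[OF fin(1) _ that, of T] assms
    by (simp add: res_mul_left res_mul_right)
  show ?L if ?R
  proof (rule le_trans)
    show "le (S \<union> T) (mul S T a b) (cut (S \<union> T) S l)"
      unfolding cut_def fin(2) using that assms fin by (intro le_mul res_closed) auto
    show "le (S \<union> T) (cut (S \<union> T) S l) l" using fin assms by (intro cut_le) auto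
  qed
qed

lemma bij_mul:
  assumes "disj S T"
  shows "bij_betw (\<lambda>x. mul S T (fst x) (snd x)) (P S \<times> P T) {g \<in> P (S \<union> T). cut (S \<union> T) S g = g}"
proof (rule bij_betw_byWitness[where f' = "\<lambda>g. (res (S \<union> T) S g, res (S \<union> T) T g)"])
  have fin: "finite (S \<union> T)" "S \<union> T - S = T" using assms(1) by (auto simp: disj_def)
  show "\<forall>g\<in>{g \<in> P (S \<union> T). cut (S \<union> T) S g = g}.
      mul S T (fst (res (S \<union> T) S g, res (S \<union> T) T g)) (snd (res (S \<union> T) S g, res (S \<union> T) T g)) = g"
    by (simp add: cut_def fin)
qed (use assms in \<open>auto simp: res_mul_left res_mul_right mul_closed cut_mul_absorb disj_def intro!: res_closed\<close>)

lemma splits_mul_iff: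
  assumes "disj S T" "g \<in> P (S \<union> T)"
  shows "cut (S \<union> T) S g = g \<longleftrightarrow> (\<exists>a\<in>P S. \<exists>b\<in>P T. g = mul S T a b)"
proof
  assume "cut (S \<union> T) S g = g"
  then have "g \<in> (\<lambda>x. mul S T (fst x) (snd x)) ` (P S \<times> P T)"
    using bij_betw_imp_surj_on[OF bij_mul[OF assms(1)]] assms(2) by simp
  then show "\<exists>a\<in>P S. \<exists>b\<in>P T. g = mul S T a b" by force
qed (use assms cut_mul_absorb in auto)

text \<open>The two sides are indexed by the same elements, by adjointness.\<close>

lemma sum_below_splits:
  assumes "disj S T" "l \<in> P (S \<union> T)"
  shows "(\<Sum>g | g \<in> P (S \<union> T) \<and> le (S \<union> T) g l \<and> cut (S \<union> T) S g = g. F g) =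
    (\<Sum>x | x \<in> P S \<times> P T \<and> le S (fst x) (res (S \<union> T) S l) \<and> le T (snd x) (res (S \<union> T) T l).
       F (mul S T (fst x) (snd x)))"
proof (rule sum.reindex_bij_betw[symmetric], rule bij_betw_subset[OF bij_mul[OF assms(1)]])
  show "(\<lambda>x. mul S T (fst x) (snd x)) `
      {x \<in> P S \<times> P T. le S (fst x) (res (S \<union> T) S l) \<and> le T (snd x) (res (S \<union> T) T l)} =
      {g \<in> P (S \<union> T). le (S \<union> T) g l \<and> cut (S \<union> T) S g = g}"
    using assms by (auto simp: splits_mul_iff mul_closed mul_le_iff image_iff) blast+
qed auto

lemma sum_above_splits:
  assumes "disj S T" "a \<in> P S" "b \<in> P T"
  shows "(\<Sum>g | g \<in> P (S \<union> T) \<and> le (S \<union> T) (mul S T a b) g \<and> cut (S \<union> T) S g = g. F g) =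
    (\<Sum>x | x \<in> P S \<times> P T \<and> le S a (fst x) \<and> le T b (snd x). F (mul S T (fst x) (snd x)))"
proof (rule sum.reindex_bij_betw[symmetric], rule bij_betw_subset[OF bij_mul[OF assms(1)]])
  show "(\<lambda>x. mul S T (fst x) (snd x)) ` {x \<in> P S \<times> P T. le S a (fst x) \<and> le T b (snd x)} =
      {g \<in> P (S \<union> T). le (S \<union> T) (mul S T a b) g \<and> cut (S \<union> T) S g = g}"
    using assms by (auto simp: splits_mul_iff mul_closed mul_le_iff res_mul_left res_mul_right image_iff) blast+
qed auto

lemma sum_below_mul:
  assumes "disj S T" "a \<in> P S" "b \<in> P T"
  shows "(\<Sum>g | g \<in> P (S \<union> T) \<and> le (S \<union> T) g (mul S T a b). F g) =
    (\<Sum>x | x \<in> P S \<times> P T \<and> le S (fst x) a \<and> le T (snd x) b. F (mul S T (fst x) (snd x)))"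
proof -
  have "finite (S \<union> T)" using assms by (auto simp: disj_def)
  from le_splits[OF this Un_upper1 _ cut_mul_absorb[OF assms]]
  have "{g. g \<in> P (S \<union> T) \<and> le (S \<union> T) g (mul S T a b)} =
      {g. g \<in> P (S \<union> T) \<and> le (S \<union> T) g (mul S T a b) \<and> cut (S \<union> T) S g = g}" by auto
  then show ?thesis
    using sum_below_splits[OF assms(1) mul_closed[OF assms], of F] assms
    by (simp add: res_mul_left res_mul_right)
qed

subsection \<open>Discrete elements\<close>

lemma discrete_le: "finite I \<Longrightarrow> discrete I l \<Longrightarrow> le I x l \<Longrightarrow> x = l"
  unfolding le_def by (erule rtranclE) (auto simp: discrete_def step_def)

lemma discrete_iff_minimal:
  assumes "finite I"
  shows "discrete I l \<longleftrightarrow> l \<in> P I \<and> (\<forall>x\<in>P I. le I x l \<longrightarrow> x = l)"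
  using assms discrete_le cut_le cut_closed by (metis discrete_def)

lemma discrete_res:
  assumes "finite I" "discrete I l" "S \<subseteq> I"
  shows "discrete S (res I S l)"
  unfolding discrete_def
proof (intro conjI allI impI)
  show "res I S l \<in> P S" using assms by (simp add: discrete_def res_closed)
  fix R assume R: "R \<subseteq> S"
  then have "res I S (cut I R l) = cut S (R \<inter> S) (res I S l)"
    using assms by (intro res_cut) (auto simp: discrete_def)
  moreover have "R \<inter> S = R" "cut I R l = l" using R assms by (auto simp: discrete_def)
  ultimately show "cut S R (res I S l) = res I S l" by simp
qed

lemma discrete_mul_iff:
  assumes "disj S T" "a \<in> P S" "b \<in> P T"
  shows "discrete (S \<union> T) (mul S T a b) \<longleftrightarrow> discrete S a \<and> discrete T b"
proof
  have fin: "finite (S \<union> T)" "finite S" "finite T" using assms by (auto simp: disj_def)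
  show "discrete S a \<and> discrete T b" if "discrete (S \<union> T) (mul S T a b)"
    using discrete_res[OF fin(1) that, of S] discrete_res[OF fin(1) that, of T] assms
    by (simp add: res_mul_left res_mul_right)
  show "discrete (S \<union> T) (mul S T a b)" if d: "discrete S a \<and> discrete T b"
  proof -
    have "x = mul S T a b" if x: "x \<in> P (S \<union> T)" "le (S \<union> T) x (mul S T a b)" for x
    proof -
      have "cut (S \<union> T) S x = x"
        using le_splits[OF fin(1) _ x(2)] cut_mul_absorb[OF assms] by simp
      then obtain a' b' where ab: "x = mul S T a' b'" "a' \<in> P S" "b' \<in> P T"
        using x splits_mul_iff[OF assms(1)] by auto
      then have "le S a' a" "le T b' b"
        using x(2) assms mul_le_iff[OF assms(1) ab(2,3) mul_closed[OF assms]]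
        by (simp_all add: res_mul_left res_mul_right)
      then show ?thesis using d fin ab discrete_le by metis
    qed
    then show ?thesis using fin assms by (auto simp: discrete_iff_minimal mul_closed)
  qed
qed

lemma discrete_singleton: "l \<in> P {i} \<Longrightarrow> discrete {i} l"
  unfolding discrete_def by (auto simp: subset_singleton_iff cut_empty cut_all)

lemma discrete_below_ex:
  assumes "finite I" "l \<in> P I"
  shows "\<exists>z. discrete I z \<and> le I z l"
  using assms(2)
proof (induction "card {x \<in> P I. le I x l}" arbitrary: l rule: less_induct)
  case less
  show ?case
  proof (cases "discrete I l")
    case False
    then obtain x where x: "x \<in> P I" "le I x l" "x \<noteq> l"
      using less.prems by (auto simp: discrete_iff_minimal[OF assms(1)])
    then have "{y \<in> P I. le I y x} \<subset> {y \<in> P I. le I y l}"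
      using less.prems le_trans le_antisym[OF assms(1)] le_refl by blast
    then have "card {y \<in> P I. le I y x} < card {y \<in> P I. le I y l}"
      using finite_P[OF assms(1)] by (intro psubset_card_mono) auto
    from less.hyps[OF this x(1)] show ?thesis using x le_trans by blast
  qed auto
qed

text \<open>Below \<open>l\<close>, the factor of a discrete element at the point \<open>i\<close> must be the restriction of \<open>l\<close> to \<open>i\<close>, as
  the order over a singleton is trivial.\<close>

lemma discrete_below_unique:
  assumes "finite I" "discrete I z" "discrete I z'" "le I z l" "le I z' l" "l \<in> P I"
  shows "z = z'"
  using assms
proof (induction I arbitrary: z z' l rule: finite_induct)
  case empty
  then show ?case using P_empty by (auto simp: discrete_def)
next
  case (insert i I)
  let ?J = "insert i I"
  have J: "finite ?J" "{i} \<subseteq> ?J" "?J - {i} = I" "I \<subseteq> ?J" using insert by auto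
  have *: "z = mul {i} I (res ?J {i} l) (res ?J I z)" if z: "discrete ?J z" "le ?J z l" for z
  proof -
    have "cut ?J {i} z = z" using z by (simp add: discrete_def)
    then have "z = mul {i} I (res ?J {i} z) (res ?J I z)" unfolding cut_def J by simp
    also have "res ?J {i} z = res ?J {i} l"
    proof (rule discrete_le)
      show "discrete {i} (res ?J {i} l)"
        using J insert.prems(5) by (intro discrete_singleton res_closed)
      show "le {i} (res ?J {i} z) (res ?J {i} l)" using J z by (intro le_res)
    qed simp
    finally show ?thesis .
  qed
  have "res ?J I z = res ?J I z'"
    using insert.prems J by (intro insert.IH[of _ _ "res ?J I l"] discrete_res le_res res_closed)
  then show ?case using *[of z] *[of z'] insert.prems by simp
qed

end

section \<open>The Moebius function from the bottom\<close>

text \<open>The sums over down-sets determine \<open>c\<close>.  For an arbitrary \<open>l\<close> the number \<open>c I l\<close> is the Moebius function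
  of the interval from the discrete element below \<open>l\<close> up to \<open>l\<close>, so \<open>c\<close> stands for \<open>mu1\<close>.\<close>

locale bottom_mobius = set_hopf P mul res u
  for P :: "'l set \<Rightarrow> 'v set" and mul res u +
  fixes c :: "'l set \<Rightarrow> 'v \<Rightarrow> int"
  assumes sum_c: "\<lbrakk>finite I; l \<in> P I\<rbrakk> \<Longrightarrow>
      (\<Sum>x | x \<in> P I \<and> le I x l. c I x) = (if discrete I l then 1 else 0)"
begin

text \<open>Both sides have the same sums over the down-sets of \<open>P S \<times> P T\<close>, because a product is discrete iff
  its factors are.\<close>

lemma c_mul:
  assumes d: "disj S T" and a: "a \<in> P S" and b: "b \<in> P T"
  shows "c (S \<union> T) (mul S T a b) = c S a * c T b"
proof -
  have fin: "finite S" "finite T" "finite (S \<union> T)" using d by (auto simp: disj_def)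
  interpret prod: finite_poset "P S \<times> P T" "\<lambda>x y. le S (fst x) (fst y) \<and> le T (snd x) (snd y)"
    using fin by (intro finite_poset_prod finite_poset_le)
  have "c (S \<union> T) (mul S T (fst y) (snd y)) = c S (fst y) * c T (snd y)" if "y \<in> P S \<times> P T" for y
    using _ that
  proof (rule prod.eq_if_downset_sums_eq)
    fix y assume "y \<in> P S \<times> P T"
    then obtain a b where y: "y = (a, b)" "a \<in> P S" "b \<in> P T" by auto
    have "(\<Sum>x | x \<in> P S \<times> P T \<and> le S (fst x) (fst y) \<and> le T (snd x) (snd y). c (S \<union> T) (mul S T (fst x) (snd x)))
        = (if discrete (S \<union> T) (mul S T a b) then 1 else 0)"
      using sum_below_mul[OF d y(2,3), of "c (S \<union> T)"] sum_c[OF fin(3) mul_closed[OF d y(2,3)]] y by simp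
    also have "\<dots> = (\<Sum>x | x \<in> P S \<and> le S x a. c S x) * (\<Sum>x | x \<in> P T \<and> le T x b. c T x)"
      using fin y d by (simp add: sum_c discrete_mul_iff)
    also have "\<dots> = (\<Sum>x\<in>{x \<in> P S. le S x a} \<times> {x \<in> P T. le T x b}. c S (fst x) * c T (snd x))"
      by (simp add: sum_product sum.cartesian_product case_prod_unfold)
    also have "{x \<in> P S. le S x a} \<times> {x \<in> P T. le T x b} =
        {x \<in> P S \<times> P T. le S (fst x) (fst y) \<and> le T (snd x) (snd y)}" using y by auto
    finally show "(\<Sum>x | x \<in> P S \<times> P T \<and> le S (fst x) (fst y) \<and> le T (snd x) (snd y). c (S \<union> T) (mul S T (fst x) (snd x)))
        = (\<Sum>x | x \<in> P S \<times> P T \<and> le S (fst x) (fst y) \<and> le T (snd x) (snd y). c S (fst x) * c T (snd x))" .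
  qed
  from this[of "(a, b)"] show ?thesis using a b by simp
qed

end

context set_hopf
begin

text \<open>An element strictly below another one is a proper cut, hence decomposable.\<close>

lemma indec_le: "finite I \<Longrightarrow> indec I a \<Longrightarrow> le I a b \<Longrightarrow> a = b"
  unfolding le_def
proof (erule converse_rtranclE)
  fix c assume *: "finite I" "indec I a" "(a, c) \<in> step I"
  then obtain R where R: "R \<subseteq> I" "a = cut I R c" "c \<in> P I" "a \<noteq> c" by (auto simp: step_def)
  then have "cut I R a = a" using * cut_idem by auto
  then have "R = {} \<or> R = I" using * R by (auto simp: indec_def)
  then show "a = b" using R * by (auto simp: cut_empty cut_all)
qed

text \<open>Among the sets containing \<open>i\<close> along which \<open>x\<close> splits choose a smallest one, \<open>B\<close>.  If the restriction to
  \<open>B\<close> could be split further, so could \<open>x\<close>, and the part containing \<open>i\<close> would be smaller.\<close>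

lemma indec_block_ex:
  assumes "finite I" "x \<in> P I" "i \<in> I"
  shows "\<exists>B\<subseteq>I. i \<in> B \<and> cut I B x = x \<and> indec B (res I B x)"
proof -
  let ?Q = "\<lambda>B. B \<subseteq> I \<and> i \<in> B \<and> cut I B x = x"
  have "?Q I" using assms by (auto simp: cut_all)
  then obtain B where B: "?Q B" and min: "\<And>C. ?Q C \<Longrightarrow> card B \<le> card C"
    using ex_has_least_nat[of ?Q I card] by blast
  have fB: "finite B" using B assms finite_subset by blast
  have xB: "res I B x \<in> P B" "res I (I - B) x \<in> P (I - B)" using B assms by (auto intro: res_closed)
  have whole: "S = B" if S: "S \<subseteq> B" "cut B S (res I B x) = res I B x" "i \<in> S" for S
  proof (rule card_subset_eq[OF fB S(1)])
    have f: "finite S" "finite (B - S)" "finite (I - B)" using S fB assms finite_subset by blast+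
    then have d: "disj S (B - S)" "disj S (I - B)" "disj (B - S) (I - B)" using S by (auto simp: disj_def)
    have e: "S \<union> (B - S) = B" "B \<union> (I - B) = I" "(B - S) \<union> (I - B) = I - S" using S B by blast+
    have m: "res B S (res I B x) \<in> P S" "res B (B - S) (res I B x) \<in> P (B - S)"
      using xB fB S by (auto intro: res_closed)
    have "x = mul B (I - B) (res I B x) (res I (I - B) x)" using B by (simp add: cut_def)
    also have "res I B x = mul S (B - S) (res B S (res I B x)) (res B (B - S) (res I B x))"
      using S by (simp add: cut_def)
    also have "mul B (I - B) \<dots> (res I (I - B) x) = mul S (I - S) (res B S (res I B x))
        (mul (B - S) (I - B) (res B (B - S) (res I B x)) (res I (I - B) x))"
      using mul_assoc[OF d m xB(2)] unfolding e .
    finally have x: "x = mul S (I - S) (res B S (res I B x))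
        (mul (B - S) (I - B) (res B (B - S) (res I B x)) (res I (I - B) x))" .
    have "mul (B - S) (I - B) (res B (B - S) (res I B x)) (res I (I - B) x) \<in> P (I - S)"
      using mul_closed[OF d(3) m(2) xB(2)] unfolding e .
    moreover have "disj S (I - S)" "S \<union> (I - S) = I" using f assms S B by (auto simp: disj_def)
    ultimately have "cut I S x = x" using cut_mul_absorb[of S "I - S", OF _ m(1)] x by metis
    then have "card B \<le> card S" using S B by (intro min) auto
    then show "card S = card B" using card_mono[OF fB S(1)] by simp
  qed
  have "indec B (res I B x)"
    unfolding indec_def
  proof (intro conjI allI impI)
    show "B \<noteq> {}" using B by auto
    fix S assume S: "S \<subseteq> B" "cut B S (res I B x) = res I B x"
    show "S = {} \<or> S = B"
    proof (cases "i \<in> S")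
      case False
      have "B - S = B" using S B False xB fB by (intro whole) (auto simp: cut_compl)
      then show ?thesis using S by auto
    qed (use whole[OF S] in auto)
  qed (rule xB)
  then show ?thesis using B by blast
qed

end

text \<open>This is the combinatorial content of strong linearization.\<close>

locale strong_set_hopf = set_hopf P mul res u
  for P :: "'l set \<Rightarrow> 'v set" and mul res u +
  assumes indec_res: "\<lbrakk>finite I; indec I l; S \<subseteq> I; S \<noteq> {}\<rbrakk> \<Longrightarrow> indec S (res I S l)"
begin

text \<open>An element below an indecomposable \<open>l\<close> is given by the block \<open>B\<close> of a fixed point \<open>i\<close>,
  on which it restricts to an indecomposable element and hence agrees with \<open>l\<close>, and an arbitrary
  element below the restriction of \<open>l\<close> to the complement of \<open>B\<close>.\<close>

lemma bij_blocks_below: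
  assumes "finite I" "indec I l" "i \<in> I"
  shows "bij_betw (\<lambda>(B, y). mul B (I - B) (res I B l) y)
    (SIGMA B:{B. i \<in> B \<and> B \<subseteq> I}. {y \<in> P (I - B). le (I - B) y (res I (I - B) l)})
    {x \<in> P I. le I x l}"
  unfolding bij_betw_def
proof
  have l: "l \<in> P I" using assms by (simp add: indec_def)
  have B: "disj B (I - B)" "B \<union> (I - B) = I" "finite B" "indec B (res I B l)" "res I B l \<in> P B"
    if "B \<subseteq> I" "i \<in> B" for B
    using that assms l finite_subset[OF that(1)] by (auto simp: disj_def intro: indec_res res_closed)
  let ?x = "\<lambda>B y. mul B (I - B) (res I B l) y"
  have x: "?x B y \<in> P I" "cut I B (?x B y) = ?x B y" "res I B (?x B y) = res I B l" "res I (I - B) (?x B y) = y"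
    if "B \<subseteq> I" "i \<in> B" "y \<in> P (I - B)" for B y
    using mul_closed[OF B(1,5) that(3)] cut_mul_absorb[OF B(1,5) that(3)]
      res_mul_left[OF B(1,5) that(3)] res_mul_right[OF B(1,5) that(3)] that(1,2) B(2)[OF that(1,2)] by auto
  have sub: "B \<subseteq> C" if BC: "B \<subseteq> I" "i \<in> B" "C \<subseteq> I" "i \<in> C" "y \<in> P (I - B)" "z \<in> P (I - C)"
    "?x B y = ?x C z" for B C y z
  proof -
    have "res I B (cut I C (?x B y)) = cut B (C \<inter> B) (res I B (?x B y))"
      using BC assms x by (intro res_cut) auto
    then have "cut B (C \<inter> B) (res I B l) = res I B l" using x(2)[OF BC(3,4,6)] x(3)[OF BC(1,2,5)] BC(7) by simp
    then show ?thesis using B(4)[OF BC(1,2)] BC by (auto simp: indec_def)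
  qed
  show "inj_on (\<lambda>(B, y). ?x B y)
    (SIGMA B:{B. i \<in> B \<and> B \<subseteq> I}. {y \<in> P (I - B). le (I - B) y (res I (I - B) l)})"
  proof (rule inj_onI, clarsimp)
    fix B y C z
    assume h: "i \<in> B" "B \<subseteq> I" "y \<in> P (I - B)" "i \<in> C" "C \<subseteq> I" "z \<in> P (I - C)" "?x B y = ?x C z"
    have "B = C" by (rule equalityI[OF sub[OF h(2,1,5,4,3,6,7)] sub[OF h(5,4,2,1,6,3) h(7)[symmetric]]])
    moreover from this have "y = z" using x(4)[OF h(2,1,3)] x(4)[OF h(5,4,6)] h(7) by metis
    ultimately show "B = C \<and> y = z" ..
  qed
  show "(\<lambda>(B, y). ?x B y) `
    (SIGMA B:{B. i \<in> B \<and> B \<subseteq> I}. {y \<in> P (I - B). le (I - B) y (res I (I - B) l)}) = {x \<in> P I. le I x l}"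
  proof (intro equalityI subsetI)
    fix w assume "w \<in> (\<lambda>(B, y). ?x B y) `
      (SIGMA B:{B. i \<in> B \<and> B \<subseteq> I}. {y \<in> P (I - B). le (I - B) y (res I (I - B) l)})"
    then obtain C y where w: "w = ?x C y" "i \<in> C" "C \<subseteq> I" "y \<in> P (I - C)" "le (I - C) y (res I (I - C) l)"
      by auto
    have "le I w l"
      using mul_le_iff[OF B(1,5) w(4), of l] B(2)[OF w(3,2)] w l by simp
    then show "w \<in> {x \<in> P I. le I x l}" using x(1) w by simp
  next
    fix w assume w: "w \<in> {x \<in> P I. le I x l}"
    then obtain C where C: "C \<subseteq> I" "i \<in> C" "cut I C w = w" "indec C (res I C w)"
      using indec_block_ex[OF assms(1) _ assms(3), of w] by auto
    have "res I C w = res I C l"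
      using w by (intro indec_le[OF B(3)[OF C(1,2)] C(4)] le_res[OF assms(1) C(1)]) simp
    then have "w = ?x C (res I (I - C) w)" using C(3) by (simp add: cut_def)
    moreover have "res I (I - C) w \<in> P (I - C)" "le (I - C) (res I (I - C) w) (res I (I - C) l)"
      using w assms by (auto intro: res_closed le_res)
    ultimately show "w \<in> (\<lambda>(B, y). ?x B y) `
      (SIGMA B:{B. i \<in> B \<and> B \<subseteq> I}. {y \<in> P (I - B). le (I - B) y (res I (I - B) l)})"
      using C by force
  qed
qed

end

locale strong_bottom_mobius = strong_set_hopf P mul res u + bottom_mobius P mul res u c
  for P :: "'l set \<Rightarrow> 'v set" and mul res u c
begin

text \<open>The principal down-set of an indecomposable element is the lattice of partitions of \<open>I\<close>, and this
  is its Moebius number.  In the sum over the blocks \<open>B\<close> at \<open>i\<close>, the inner sum over the elements below the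
  restriction \<open>l|(I - B)\<close> is \<open>1\<close> or \<open>0\<close> according to whether this restriction is discrete; as it is
  indecomposable, this leaves the blocks that omit at most one point.\<close>

lemma c_indec:
  assumes "finite I" "indec I l"
  shows "c I l = (-1) ^ (card I - 1) * fact (card I - 1)"
  using assms
proof (induction "card I" arbitrary: I l rule: less_induct)
  case less
  then have l: "l \<in> P I" "I \<noteq> {}" by (auto simp: indec_def)
  then obtain i where i: "i \<in> I" by blast
  show ?case
  proof (cases "I = {i}")
    case True
    then have d: "discrete I l" using l discrete_singleton by auto
    then have "{x. x \<in> P I \<and> le I x l} = {l}" using discrete_le[OF less.prems(1)] l by auto
    with sum_c[OF less.prems(1) l(1)] d True show ?thesis by simp
  next
    case False
    have nd: "\<not> discrete J (res I J l)" if "J \<subseteq> I" "j \<in> J" "J \<noteq> {j}" for J j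
    proof
      assume "discrete J (res I J l)"
      then have "cut J {j} (res I J l) = res I J l" using that by (simp add: discrete_def)
      moreover have "indec J (res I J l)" using that less.prems by (intro indec_res) auto
      ultimately show False using that by (auto simp: indec_def)
    qed
    \<comment> \<open>the value of the inner sum\<close>
    define D where "D B = (if discrete (I - B) (res I (I - B) l) then 1 else 0 :: int)" for B
    let ?M = "{B. i \<in> B \<and> B \<subseteq> I}"
    have finM: "finite ?M" using less.prems by simp
    have "0 = (\<Sum>x | x \<in> P I \<and> le I x l. c I x)"
      using sum_c[OF less.prems(1) l(1)] nd[of I i] i False res_self[OF less.prems(1) l(1)] by simp
    also have "\<dots> = (\<Sum>z\<in>(SIGMA B:?M. {y \<in> P (I - B). le (I - B) y (res I (I - B) l)}).
        c I (mul (fst z) (I - fst z) (res I (fst z) l) (snd z)))"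
      using sum.reindex_bij_betw[OF bij_blocks_below[OF less.prems i], of "c I"]
      by (simp add: case_prod_unfold)
    also have "\<dots> = (\<Sum>z\<in>(SIGMA B:?M. {y \<in> P (I - B). le (I - B) y (res I (I - B) l)}).
        c (fst z) (res I (fst z) l) * c (I - fst z) (snd z))"
    proof (intro sum.cong refl, clarsimp)
      fix B y assume B: "B \<subseteq> I" "y \<in> P (I - B)"
      have "c (B \<union> (I - B)) (mul B (I - B) (res I B l) y) = c B (res I B l) * c (I - B) y"
        using B less.prems l by (intro c_mul res_closed disj_Diff) auto
      then show "c I (mul B (I - B) (res I B l) y) = c B (res I B l) * c (I - B) y"
        using B by (simp add: Un_absorb1)
    qed
    also have "\<dots> = (\<Sum>B\<in>?M. \<Sum>y\<in>{y \<in> P (I - B). le (I - B) y (res I (I - B) l)}.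
        c B (res I B l) * c (I - B) y)"
      using finM finite_P less.prems by (subst sum.Sigma) (auto simp: case_prod_unfold)
    also have "\<dots> = (\<Sum>B\<in>?M. c B (res I B l) * D B)"
      unfolding D_def sum_distrib_left[symmetric] using less.prems l
      by (intro sum.cong refl arg_cong2[where f = "(*)"] sum_c res_closed) auto
    also have "\<dots> = (\<Sum>B\<in>insert I ((\<lambda>j. I - {j}) ` (I - {i})). c B (res I B l) * D B)"
    proof (rule sum.mono_neutral_right[OF finM])
      show "\<forall>B\<in>?M - insert I ((\<lambda>j. I - {j}) ` (I - {i})). c B (res I B l) * D B = 0"
      proof
        fix B assume B: "B \<in> ?M - insert I ((\<lambda>j. I - {j}) ` (I - {i}))"
        then obtain j where j: "j \<in> I" "j \<notin> B" by blast
        have "I - B \<noteq> {j}"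
        proof
          assume "I - B = {j}"
          then have "B = I - {j}" using B by blast
          then show False using B j by auto
        qed
        then have "D B = 0" unfolding D_def using nd[of "I - B" j] j by simp
        then show "c B (res I B l) * D B = 0" by simp
      qed
    qed (use i in auto)
    also have "\<dots> = c I l * D I + (\<Sum>B\<in>(\<lambda>j. I - {j}) ` (I - {i}). c B (res I B l) * D B)"
      using less.prems l by (subst sum.insert) (auto simp: res_self)
    also have "D I = 1"
      using l less.prems P_empty by (simp add: D_def res_empty discrete_def cut_empty)
    also have "(\<Sum>B\<in>(\<lambda>j. I - {j}) ` (I - {i}). c B (res I B l) * D B) =
        (\<Sum>j\<in>I - {i}. c (I - {j}) (res I (I - {j}) l) * D (I - {j}))"
      by (subst sum.reindex) (auto simp: inj_on_def)
    also have "\<dots> = (\<Sum>j\<in>I - {i}. (-1) ^ (card I - 2) * fact (card I - 2))"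
    proof (intro sum.cong refl)
      fix j assume j: "j \<in> I - {i}"
      have e: "I - (I - {j}) = {j}" "I - {j} \<noteq> {}" using i j by auto
      have "D (I - {j}) = 1"
        unfolding D_def e using j less.prems l discrete_singleton[OF res_closed[of I "{j}" l]] by simp
      moreover have "card (I - {j}) = card I - 1" "card (I - {j}) < card I"
        using j less.prems card_Diff1_less[of I j] by (auto simp: card_Diff_singleton)
      moreover have "indec (I - {j}) (res I (I - {j}) l)"
        using e less.prems by (intro indec_res) auto
      ultimately show "c (I - {j}) (res I (I - {j}) l) * D (I - {j}) = (-1) ^ (card I - 2) * fact (card I - 2)"
        using less.hyps[of "I - {j}" "res I (I - {j}) l"] less.prems by (simp add: numeral_2_eq_2)
    qed
    also have "\<dots> = (int (card I) - 1) * ((-1) ^ (card I - 2) * fact (card I - 2))"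
      using i less.prems card_gt_0_iff[of I] by (auto simp: of_nat_diff)
    finally have rec: "c I l = - ((int (card I) - 1) * ((-1) ^ (card I - 2) * fact (card I - 2)))" by simp
    have "\<not> card I \<le> 1" using False i less.prems card_le_Suc0_iff_eq[of I] by auto
    then obtain n where "card I = Suc (Suc n)" by (metis One_nat_def le_SucE le_simps(3) not_less_eq_eq not0_implies_Suc le0)
    then show ?thesis using rec by simp
  qed
qed

lemma c_nonzero: "finite I \<Longrightarrow> l \<in> P I \<Longrightarrow> c I l \<noteq> 0"
proof (induction "card I" arbitrary: I l rule: less_induct)
  case less
  consider (empty) "I = {}" | (indec) "indec I l" | (dec) S where "S \<subseteq> I" "cut I S l = l" "S \<noteq> {}" "S \<noteq> I"
    using less.prems by (auto simp: indec_def)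
  then show ?case
  proof cases
    case empty
    then have "{x. x \<in> P I \<and> le I x l} = {u}" "l = u" using less.prems P_empty by auto
    moreover have "discrete I l" using empty less.prems by (simp add: discrete_def cut_empty)
    ultimately show ?thesis using sum_c[OF less.prems] by auto
  next
    case indec
    then show ?thesis using c_indec less.prems by simp
  next
    case dec
    have S: "S \<union> (I - S) = I" "finite S" "card S < card I" "card (I - S) < card I"
      using dec less.prems finite_subset by (auto intro!: psubset_card_mono)
    have m: "res I S l \<in> P S" "res I (I - S) l \<in> P (I - S)" using dec less.prems by (auto intro: res_closed)
    have "c I l = c S (res I S l) * c (I - S) (res I (I - S) l)"
      using c_mul[OF disj_Diff m] dec less.prems S by (simp add: cut_def)
    then show ?thesis using less.hyps S m less.prems by simp
  qed
qed

end

section \<open>Linear maps, bilinear maps and pure tensors\<close>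

lemma lin_closed: "lin X Y f \<Longrightarrow> x \<in> carr X \<Longrightarrow> f x \<in> carr Y"
  by (simp add: lin_def)

lemma lin_add: "lin X Y f \<Longrightarrow> x \<in> carr X \<Longrightarrow> y \<in> carr X \<Longrightarrow> f (x + y) = f x + f y"
  by (simp add: lin_def)

lemma lin_scale: "lin X Y f \<Longrightarrow> x \<in> carr X \<Longrightarrow> f (smul X c x) = smul Y c (f x)"
  by (simp add: lin_def)

lemma lin_zero:
  assumes "is_vspace X" "lin X Y f"
  shows "f 0 = 0"
proof -
  have "f (0 + 0) = f 0 + f 0" using assms is_vspaceD(1) unfolding lin_def by blast
  then show ?thesis by simp
qed

lemma carr_sum: "is_vspace X \<Longrightarrow> (\<And>i. i \<in> A \<Longrightarrow> g i \<in> carr X) \<Longrightarrow> sum g A \<in> carr X"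
  by (induction A rule: infinite_finite_induct) (auto intro: is_vspaceD)

lemma lin_sum:
  assumes "is_vspace X" "lin X Y f" "\<And>i. i \<in> A \<Longrightarrow> g i \<in> carr X"
  shows "f (sum g A) = (\<Sum>i\<in>A. f (g i))"
  using assms(3)
proof (induction A rule: infinite_finite_induct)
  case (insert i A)
  then have "sum g A \<in> carr X" "g i \<in> carr X" using carr_sum[OF assms(1), of A g] by auto
  then have "f (g i + sum g A) = f (g i) + f (sum g A)" using assms(2) by (simp add: lin_def)
  then show ?case using insert by simp
qed (auto intro: lin_zero assms)

lemma bilin_sum:
  assumes "is_vspace X" "is_vspace Y" "bilin X Y Z b"
    and "\<And>i. i \<in> A \<Longrightarrow> f i \<in> carr X" "\<And>j. j \<in> B \<Longrightarrow> g j \<in> carr Y"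
  shows "b (sum f A) (sum g B) = (\<Sum>x\<in>A \<times> B. b (f (fst x)) (g (snd x)))"
proof -
  have "b (sum f A) (sum g B) = (\<Sum>i\<in>A. b (f i) (sum g B))"
    using assms carr_sum[OF assms(2), of B g]
    by (intro lin_sum[OF assms(1), of Z "\<lambda>x. b x (sum g B)"]) (auto simp: bilin_def)
  also have "\<dots> = (\<Sum>i\<in>A. \<Sum>j\<in>B. b (f i) (g j))"
    using assms by (intro sum.cong refl lin_sum[OF assms(2)]) (auto simp: bilin_def)
  finally show ?thesis by (simp add: sum.cartesian_product case_prod_unfold)
qed

lemma bilin_scale:
  assumes "is_vspace X" "is_vspace Y" "is_vspace Z" "bilin X Y Z b" "x \<in> carr X" "y \<in> carr Y"
  shows "b (smul X c x) (smul Y d y) = smul Z (c * d) (b x y)"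
proof -
  interpret Z: vector_space "smul Z" using assms(3) by (simp add: is_vspace_def)
  have "b (smul X c x) (smul Y d y) = smul Z c (b x (smul Y d y))"
    using assms is_vspaceD(3)[OF assms(2)] by (simp add: bilin_def lin_def)
  also have "b x (smul Y d y) = smul Z d (b x y)" using assms by (simp add: bilin_def lin_def)
  finally show ?thesis by simp
qed

lemma bilin_comp: "bilin X Y W b \<Longrightarrow> lin W Z g \<Longrightarrow> bilin X Y Z (\<lambda>x y. g (b x y))"
  by (simp add: bilin_def lin_def)

lemma lin_eq_on_span:
  assumes "is_vspace X" "lin X Y f" "lin X Y g" "B \<subseteq> carr X"
    and "module.span (smul X) B = carr X" "\<And>b. b \<in> B \<Longrightarrow> f b = g b" "x \<in> carr X"
  shows "f x = g x"
proof -
  interpret vector_space "smul X" using assms(1) by (simp add: is_vspace_def)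
  have "x \<in> span B" using assms by simp
  then have "x \<in> carr X \<and> f x = g x"
  proof (induction rule: span_induct)
    case base
    show ?case unfolding subspace_def mem_Collect_eq
      using lin_zero[OF assms(1,2)] lin_zero[OF assms(1,3)] assms(2,3) is_vspaceD[OF assms(1)]
      by (simp add: lin_def)
  qed (use assms in auto)
  then show ?thesis by blast
qed

lemma lin_tensor_map:
  assumes "lin X X' f" "lin Y Y' g"
  shows "lin (tensor X Y) (tensor X' Y') (tensor_map X' Y' f g)"
proof -
  have map_add: "tensor_map X' Y' f g (s + t) = tensor_map X' Y' f g s + tensor_map X' Y' f g t"
    and map_scale: "tensor_map X' Y' f g (tscale c t) = tscale c (tensor_map X' Y' f g t)" for s t c
    by (auto simp: tensor_map_def tscale_def fun_eq_iff)
  have smul: "smul (tensor X Y) = tscale" "smul (tensor X' Y') = tscale" by (simp_all add: tensor_def)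
  have "tensor_map X' Y' f g t \<in> carr (tensor X' Y')" if "t \<in> carr (tensor X Y)" for t
    using that
  proof (induction rule: tensor_induct)
    case zero
    have "tensor_map X' Y' f g 0 = 0" by (auto simp: tensor_map_def fun_eq_iff)
    then show ?case by (simp only: is_vspaceD[OF is_vspace_tensor])
  next
    case (add s t)
    show ?case unfolding map_add by (rule is_vspaceD[OF is_vspace_tensor]) fact+
  next
    case (scale c t)
    show ?case unfolding map_scale smul(2)[symmetric]
      by (rule is_vspaceD[OF is_vspace_tensor]) fact
  next
    case (pure x y)
    then show ?case using assms by (simp add: tensor_map_pure pure_in_tensor lin_closed)
  qed
  then show ?thesis unfolding lin_def smul by (simp add: map_add map_scale)
qed

lemma coordinate_functional:
  fixes X :: "('k::field, 'a::ab_group_add) vspace"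
  assumes "is_vspace X" "\<not> module.dependent (smul X) A"
  obtains f where "Vector_Spaces.linear (smul X) (*) f" "\<And>b. b \<in> A \<Longrightarrow> f b = (if b = a then 1 else 0)"
proof -
  interpret X: vector_space "smul X" using assms(1) by (simp add: is_vspace_def)
  interpret K: vector_space "(*) :: 'k \<Rightarrow> 'k \<Rightarrow> 'k" by unfold_locales (auto simp: algebra_simps)
  interpret XK: vector_space_pair "smul X" "(*) :: 'k \<Rightarrow> 'k \<Rightarrow> 'k" ..
  show ?thesis
    using XK.linear_independent_extend[OF assms(2), of "\<lambda>b. if b = a then 1 else 0"] that by auto
qed

lemma nonzero_functional:
  fixes X :: "('k::field, 'a::ab_group_add) vspace"
  assumes "is_vspace X" "x \<noteq> 0"
  obtains f where "Vector_Spaces.linear (smul X) (*) f" "f x = 1"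
proof -
  interpret X: vector_space "smul X" using assms(1) by (simp add: is_vspace_def)
  have "X.independent {x}" using assms by simp
  from coordinate_functional[OF assms(1) this, of x] show ?thesis using that by auto
qed

lemma pure_functionals:
  assumes "Vector_Spaces.linear (smul X) (*) f" "Vector_Spaces.linear (smul Y) (*) g"
  shows "pure X Y x y (\<lambda>x y. f x * g y) = f x * g y"
proof -
  interpret f: Vector_Spaces.linear "smul X" "(*)" f by fact
  interpret g: Vector_Spaces.linear "smul Y" "(*)" g by fact
  have "bilin_form X Y (\<lambda>x y. f x * g y)"
    unfolding bilin_def lin_def base_field_def
    by (simp add: f.add g.add f.scale g.scale distrib_left distrib_right mult.left_commute)
  then show ?thesis by (simp add: pure_def)
qed

lemma pure_nonzero:
  assumes X: "is_vspace X" and Y: "is_vspace Y" and "x \<noteq> 0" "y \<noteq> 0"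
  shows "pure X Y x y \<noteq> 0"
proof
  assume z: "pure X Y x y = 0"
  obtain f where f: "Vector_Spaces.linear (smul X) (*) f" "f x = 1"
    using nonzero_functional[OF X] assms by blast
  obtain g where g: "Vector_Spaces.linear (smul Y) (*) g" "g y = 1"
    using nonzero_functional[OF Y] assms by blast
  show False using pure_functionals[OF f(1) g(1), of x y] f g by (simp add: z)
qed

text \<open>In general only the line spanned by each factor of a nonzero pure tensor is determined; the
  scalar is pinned down as soon as one factor is known to lie in an independent set.\<close>

lemma pure_cancel:
  assumes X: "is_vspace X" and Y: "is_vspace Y" and A: "\<not> module.dependent (smul X) A"
    and a: "a \<in> A" "a' \<in> A" and eq: "pure X Y a t = pure X Y a' t'" and t: "t \<noteq> 0"
  shows "a = a' \<and> t = t'"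
proof -
  obtain f where f: "Vector_Spaces.linear (smul X) (*) f" "\<And>b. b \<in> A \<Longrightarrow> f b = (if b = a then 1 else 0)"
    using coordinate_functional[OF X A] by blast
  have *: "g t = f a' * g t'" if "Vector_Spaces.linear (smul Y) (*) g" for g
    using pure_functionals[OF f(1) that, of a t] pure_functionals[OF f(1) that, of a' t'] f(2)[OF a(1)]
    by (simp add: eq)
  obtain g where g: "Vector_Spaces.linear (smul Y) (*) g" "g t = 1"
    using nonzero_functional[OF Y t] by blast
  have a': "a' = a" using *[OF g(1)] g(2) f(2)[OF a(2)] by (auto split: if_splits)
  have "t = t'"
  proof (rule ccontr)
    assume "t \<noteq> t'"
    then obtain g where g: "Vector_Spaces.linear (smul Y) (*) g" "g (t - t') = 1"
      using nonzero_functional[OF Y, of "t - t'"] by auto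
    interpret g: Vector_Spaces.linear "smul Y" "(*)" g by (fact g)
    show False using *[OF g(1)] f(2)[OF a(2)] a' g(2) by (simp add: g.diff)
  qed
  with a' show ?thesis by simp
qed

section \<open>The set-theoretic Hopf monoid on the basis\<close>

lemma bilin_mult:
  assumes "lin (obj2 h S T) (obj h (S \<union> T)) (nabla h S T)"
  shows "bilin (obj h S) (obj h T) (obj h (S \<union> T)) (mult h S T)"
  using bilin_comp[OF bilin_pure assms] by (simp add: mult_def[abs_def])

text \<open>The product is bilinear, so its image is spanned by the products of basis elements; when
  these are basis elements themselves, the image contains no other basis element.\<close>

lemma nabla_image_basis:
  fixes h :: "('l, 'k::field, 'v::ab_group_add) hopf"
  assumes vs: "vector_species h" and prd: "is_product h" and bas: "is_basis h X" and d: "disj S T"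
    and closed: "\<And>a b. a \<in> X S \<Longrightarrow> b \<in> X T \<Longrightarrow> mult h S T a b \<in> X (S \<union> T)"
    and l: "l \<in> X (S \<union> T)"
  shows "l \<in> nabla_image h S T \<longleftrightarrow> (\<exists>a\<in>X S. \<exists>b\<in>X T. l = mult h S T a b)"
proof
  have fin: "finite S" "finite T" "finite (S \<union> T)" using d by (auto simp: disj_def)
  have V: "is_vspace (obj h S)" "is_vspace (obj h T)" "is_vspace (obj h (S \<union> T))"
    using vs fin by (auto simp: vector_species_def)
  have sub: "X S \<subseteq> sp h S" "X T \<subseteq> sp h T"
    using bas fin by (auto simp: is_basis_def set_subspecies_def)
  have n: "lin (obj2 h S T) (obj h (S \<union> T)) (nabla h S T)" using prd d by (auto simp: is_product_def)
  show "l \<in> nabla_image h S T" if "\<exists>a\<in>X S. \<exists>b\<in>X T. l = mult h S T a b"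
    using that sub by (auto simp: nabla_image_def mult_def intro!: imageI pure_in_tensor)
  assume "l \<in> nabla_image h S T"
  then obtain t where t: "t \<in> carr (obj2 h S T)" "l = nabla h S T t" by (auto simp: nabla_image_def)
  interpret S: vector_space "smul (obj h S)" using V by (simp add: is_vspace_def)
  interpret T: vector_space "smul (obj h T)" using V by (simp add: is_vspace_def)
  interpret ST: vector_space "smul (obj h (S \<union> T))" using V by (simp add: is_vspace_def)
  let ?M = "{mult h S T a b | a b. a \<in> X S \<and> b \<in> X T}"
  have b: "bilin (obj h S) (obj h T) (obj h (S \<union> T)) (mult h S T)"
    using n by (rule bilin_mult)
  have 1: "y \<in> sp h T \<and> mult h S T a y \<in> ST.span ?M" if "y \<in> T.span (X T)" "a \<in> X S" for a y
    using that(1)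
  proof (induction rule: T.span_induct)
    case base
    have "lin (obj h T) (obj h (S \<union> T)) (mult h S T a)" using b sub that by (auto simp: bilin_def)
    with lin_zero[OF V(2) this] is_vspaceD[OF V(2)] show ?case
      unfolding T.subspace_def mem_Collect_eq lin_def
      by (simp add: ST.span_add ST.span_scale ST.span_zero)
  next
    case (step y)
    then show ?case using that sub by (auto intro!: ST.span_base)
  qed
  have 2: "x \<in> sp h S \<and> mult h S T x y \<in> ST.span ?M" if "x \<in> S.span (X S)" "y \<in> T.span (X T)" for x y
    using that(1)
  proof (induction rule: S.span_induct)
    case base
    have "y \<in> sp h T" using bas fin that by (auto simp: is_basis_def)
    then have "lin (obj h S) (obj h (S \<union> T)) (\<lambda>x. mult h S T x y)" using b by (auto simp: bilin_def)
    with lin_zero[OF V(1) this] is_vspaceD[OF V(1)] show ?case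
      unfolding S.subspace_def mem_Collect_eq lin_def
      by (simp add: ST.span_add ST.span_scale ST.span_zero)
  next
    case (step x)
    then show ?case using 1[OF that(2)] sub by auto
  qed
  have "nabla h S T t \<in> ST.span ?M"
    using t(1)
  proof (induction rule: tensor_induct)
    case zero
    then show ?case using lin_zero[OF is_vspace_tensor n] by (simp only: ST.span_zero)
  next
    case (add s t)
    then show ?case unfolding lin_add[OF n add(1,2)] by (intro ST.span_add)
  next
    case (scale c t)
    then have "nabla h S T (smul (obj2 h S T) c t) = smul (obj h (S \<union> T)) c (nabla h S T t)"
      using n by (simp add: lin_def)
    then show ?case using scale ST.span_scale by (simp add: tensor_def)
  next
    case (pure x y)
    then show ?case using 2[of x y] bas fin by (auto simp: is_basis_def mult_def)
  qed
  then have "l \<in> ST.span ?M" by (simp add: t)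
  moreover have "l \<notin> ST.span (X (S \<union> T) - {l})"
    using bas fin l by (auto simp: is_basis_def ST.dependent_def)
  ultimately have "\<not> ?M \<subseteq> X (S \<union> T) - {l}" using ST.span_mono by blast
  then show "\<exists>a\<in>X S. \<exists>b\<in>X T. l = mult h S T a b" using closed by auto
qed

text \<open>\<open>I - S\<close> is the other part of the decomposition, so that \<open>rest h P I S l\<close> is \<open>l|S\<close> for \<open>l \<in> P I\<close>.\<close>

definition rest :: "('l, 'k::field, 'v::ab_group_add) hopf \<Rightarrow> ('l set \<Rightarrow> 'v set) \<Rightarrow>
    'l set \<Rightarrow> 'l set \<Rightarrow> 'v \<Rightarrow> 'v" where
  "rest h P I S l = res1 h P S (I - S) l"

locale strongly_linearized_hopf =
  fixes h :: "('l, 'k::field, 'v::ab_group_add) hopf" and P :: "'l set \<Rightarrow> 'v set"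
  assumes hopf: "connected_hopf_monoid h"
    and fin_dim: "finite_dimensional h"
    and comm: "commutative h"
    and cocomm: "cocommutative h"
    and basis: "is_basis h P"
    and strong: "strongly_linearized h P"
begin

lemma species: "connected_species h" "vector_species h"
  using hopf by (auto simp: connected_hopf_monoid_def connected_monoid_def connected_species_def)

lemma product: "is_product h" and coproduct: "is_coproduct h"
  using hopf by (auto simp: connected_hopf_monoid_def connected_monoid_def connected_comonoid_def)

lemma vs: "finite S \<Longrightarrow> is_vspace (obj h S)"
  using species by (auto simp: vector_species_def)

lemma vsp: "finite S \<Longrightarrow> vector_space (smul (obj h S))"
  using vs by (simp add: is_vspace_def)

lemma P_sub: "finite S \<Longrightarrow> P S \<subseteq> sp h S"
  and P_indep: "finite S \<Longrightarrow> \<not> module.dependent (smul (obj h S)) (P S)"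
  and P_span: "finite S \<Longrightarrow> module.span (smul (obj h S)) (P S) = sp h S"
  and P_one: "P {} = {one_of h}"
  using basis by (auto simp: is_basis_def set_subspecies_def)

lemma P_finite:
  assumes "finite S"
  shows "finite (P S)"
proof -
  interpret vector_space "smul (obj h S)" using assms by (rule vsp)
  obtain B where "finite B" "sp h S = span B" using fin_dim assms by (auto simp: finite_dimensional_def)
  then show ?thesis using independent_span_bound[OF _ P_indep[OF assms]] P_sub[OF assms] by auto
qed

lemma P_nonzero:
  assumes "finite S" "a \<in> P S"
  shows "a \<noteq> 0"
proof -
  interpret vector_space "smul (obj h S)" using assms(1) by (rule vsp)
  show ?thesis using dependent_zero P_indep[OF assms(1)] assms(2) by auto
qed

lemma nabla_lin: "disj S T \<Longrightarrow> lin (obj2 h S T) (obj h (S \<union> T)) (nabla h S T)"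
  using product by (auto simp: is_product_def)

lemma delta_lin: "disj S T \<Longrightarrow> lin (obj h (S \<union> T)) (obj2 h S T) (delta h S T)"
  using coproduct by (auto simp: is_coproduct_def)

lemma mult_bilin: "disj S T \<Longrightarrow> bilin (obj h S) (obj h T) (obj h (S \<union> T)) (mult h S T)"
  by (intro bilin_mult nabla_lin)

lemma mult_P: "\<lbrakk>disj S T; a \<in> P S; b \<in> P T\<rbrakk> \<Longrightarrow> mult h S T a b \<in> P (S \<union> T)"
  using strong by (auto simp: strongly_linearized_def linearized_def)

lemma tens_cancel:
  assumes "disj S T" "a \<in> P S" "b \<in> P T" "a' \<in> P S" "b' \<in> P T" "tens h S T a b = tens h S T a' b'"
  shows "a = a' \<and> b = b'"
proof -
  have "finite S" "finite T" using assms by (auto simp: disj_def)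
  then show ?thesis using assms by (intro pure_cancel[OF vs[of S] vs[of T] P_indep] P_nonzero[of T b])
qed

lemma split_pair_eq:
  assumes "disj S T" "a \<in> P S" "b \<in> P T" "delta h S T l = tens h S T a b"
  shows "res1 h P S T l = a" "res2 h P S T l = b"
proof -
  have "split_pair h P S T l = (a, b)"
    unfolding split_pair_def
  proof (rule the_equality)
    fix ab assume "fst ab \<in> P S \<and> snd ab \<in> P T \<and> delta h S T l = tens h S T (fst ab) (snd ab)"
    then show "ab = (a, b)"
      using tens_cancel[OF assms(1-3), of "fst ab" "snd ab"] assms(4) by (simp add: prod_eq_iff)
  qed (use assms in simp)
  then show "res1 h P S T l = a" "res2 h P S T l = b" by (simp_all add: res1_def res2_def)
qed

lemma delta_split:
  assumes "disj S T" "l \<in> P (S \<union> T)"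
  shows "res1 h P S T l \<in> P S" "res2 h P S T l \<in> P T"
    "delta h S T l = tens h S T (res1 h P S T l) (res2 h P S T l)"
proof -
  obtain a b where "a \<in> P S" "b \<in> P T" "delta h S T l = tens h S T a b"
    using strong assms unfolding strongly_linearized_def linearized_def by metis
  with split_pair_eq[OF assms(1) this]
  show "res1 h P S T l \<in> P S" "res2 h P S T l \<in> P T"
    "delta h S T l = tens h S T (res1 h P S T l) (res2 h P S T l)" by auto
qed

lemma res1_eq_rest: "disj S T \<Longrightarrow> res1 h P S T l = rest h P (S \<union> T) S l"
proof -
  assume "disj S T"
  then have "S \<union> T - S = T" by (auto simp: disj_def)
  then show ?thesis by (simp add: rest_def)
qed

text \<open>By cocommutativity restriction to \<open>S\<close> does not depend on whether \<open>S\<close> is the first or the second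
  part of the decomposition.\<close>

lemma res2_eq_rest:
  assumes d: "disj S T" and l: "l \<in> P (S \<union> T)"
  shows "res2 h P S T l = rest h P (S \<union> T) T l"
proof -
  have d': "disj T S" using d by (auto simp: disj_def)
  have "delta h T S l = tensor_swap (obj h S) (obj h T) (delta h S T l)"
    using cocomm d l P_sub[of "S \<union> T"] by (auto simp: cocommutative_def disj_def)
  also have "\<dots> = tens h T S (res2 h P S T l) (res1 h P S T l)"
    by (simp add: delta_split[OF d l] tensor_swap_pure)
  finally have "res1 h P T S l = res2 h P S T l"
    using delta_split[OF d l] by (intro split_pair_eq[OF d'])
  then show ?thesis using res1_eq_rest[OF d', of l] by (simp add: Un_commute)
qed

lemma delta_rest:
  assumes "disj S T" "l \<in> P (S \<union> T)"
  shows "delta h S T l = tens h S T (rest h P (S \<union> T) S l) (rest h P (S \<union> T) T l)"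
  using delta_split[OF assms] res1_eq_rest[OF assms(1)] res2_eq_rest[OF assms] by simp

lemma rest_P: "\<lbrakk>finite I; S \<subseteq> I; l \<in> P I\<rbrakk> \<Longrightarrow> rest h P I S l \<in> P S"
  unfolding rest_def by (rule delta_split) (auto simp: disj_def Un_absorb1 finite_subset)

lemma rest_eqI:
  assumes "disj S T" "a \<in> P S" "b \<in> P T" "delta h S T l = tens h S T a b"
  shows "rest h P (S \<union> T) S l = a"
  using split_pair_eq[OF assms] res1_eq_rest[OF assms(1)] by simp

lemma rest_self: "finite I \<Longrightarrow> l \<in> P I \<Longrightarrow> rest h P I I l = l"
  using rest_eqI[of I "{}" l "one_of h" l] hopf P_one P_sub[of I]
  by (auto simp: connected_hopf_monoid_def connected_comonoid_def disj_def)

text \<open>Coassociativity for \<open>I = R \<squnion> (S - R) \<squnion> (I - S)\<close> equates two triple tensors whose first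
  factors are the two sides.\<close>

lemma rest_rest:
  assumes I: "finite I" "S \<subseteq> I" "R \<subseteq> S" "l \<in> P I"
  shows "rest h P S R (rest h P I S l) = rest h P I R l"
proof -
  define B where "B = S - R"
  define C where "C = I - S"
  have e: "R \<union> B = S" "S \<union> C = I" "R \<union> (B \<union> C) = I" using I by (auto simp: B_def C_def)
  have "finite S" using I finite_subset by blast
  moreover have "finite R" using I(3) \<open>finite S\<close> by (rule finite_subset)
  ultimately have fin: "finite R" "finite B" "finite C" "finite S" "finite (B \<union> C)"
    using I by (auto simp: B_def C_def)
  have d: "disj R B" "disj R C" "disj B C" "disj S C" "disj R (B \<union> C)"
    using fin I by (auto simp: disj_def B_def C_def)
  define lS where "lS = rest h P I S l"
  define lC where "lC = rest h P I C l"
  define lBC where "lBC = rest h P I (B \<union> C) l"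
  have m: "lS \<in> P S" "lC \<in> P C" "lBC \<in> P (B \<union> C)" "rest h P I R l \<in> P R"
    unfolding lS_def lC_def lBC_def using I e by (auto intro!: rest_P)
  have m2: "rest h P S R lS \<in> P R" "rest h P S B lS \<in> P B"
    "rest h P (B \<union> C) B lBC \<in> P B" "rest h P (B \<union> C) C lBC \<in> P C"
    using m fin e I by (auto intro!: rest_P)
  have id: "lin (obj h C) (obj h C) id" "lin (obj h R) (obj h R) id" by (auto simp: lin_def)
  have l: "l \<in> sp h (R \<union> B \<union> C)" using P_sub[OF I(1)] I e by auto
  have "tensor_assoc (obj h R) (obj h B) (obj h C)
            (tensor_map (obj2 h R B) (obj h C) (delta h R B) id (delta h (R \<union> B) C l)) =
        tensor_map (obj h R) (obj2 h B C) id (delta h B C) (delta h R (B \<union> C) l)"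
    using hopf d l by (auto simp: connected_hopf_monoid_def connected_comonoid_def)
  also have "delta h (R \<union> B) C l = tens h (R \<union> B) C lS lC"
    unfolding e using delta_rest[OF d(4), of l] I by (simp add: e lS_def lC_def)
  also have "tensor_map (obj2 h R B) (obj h C) (delta h R B) id (tens h (R \<union> B) C lS lC) =
      pure (obj2 h R B) (obj h C) (delta h R B lS) lC"
    using m fin P_sub e by (subst tensor_map_pure[OF delta_lin[OF d(1)] id(1)]) auto
  also have "delta h R B lS = tens h R B (rest h P S R lS) (rest h P S B lS)"
    using delta_rest[OF d(1), of lS] m by (simp add: e)
  also have "tensor_assoc (obj h R) (obj h B) (obj h C) (pure (obj2 h R B) (obj h C) \<dots> lC) =
      pure (obj h R) (obj2 h B C) (rest h P S R lS) (tens h B C (rest h P S B lS) lC)"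
    using m m2 fin vs P_sub by (intro tensor_assoc_pure) auto
  also have "delta h R (B \<union> C) l = tens h R (B \<union> C) (rest h P I R l) lBC"
    using delta_rest[OF d(5), of l] I by (simp add: e lBC_def)
  also have "tensor_map (obj h R) (obj2 h B C) id (delta h B C) \<dots> =
      pure (obj h R) (obj2 h B C) (rest h P I R l) (delta h B C lBC)"
    using m fin P_sub by (subst tensor_map_pure[OF id(2) delta_lin[OF d(3)]]) auto
  finally have eq: "pure (obj h R) (obj2 h B C) (rest h P S R lS) (tens h B C (rest h P S B lS) lC) =
      pure (obj h R) (obj2 h B C) (rest h P I R l) (delta h B C lBC)" .
  have "tens h B C (rest h P S B lS) lC \<noteq> 0"
    using m m2 fin by (intro pure_nonzero vs P_nonzero)
  from pure_cancel[OF vs[OF fin(1)] is_vspace_tensor P_indep[OF fin(1)] m2(1) m(4) eq this]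
  show ?thesis by (simp add: lS_def)
qed

text \<open>The compatibility axiom, evaluated at a pure tensor of basis elements, equates two pure tensors.
  Compare their first factors.\<close>

lemma rest_mult:
  assumes d: "disj R R'" and S: "S \<subseteq> R \<union> R'" and a: "a \<in> P R" and b: "b \<in> P R'"
  shows "rest h P (R \<union> R') S (mult h R R' a b) =
    mult h (R \<inter> S) (R' \<inter> S) (rest h P R (R \<inter> S) a) (rest h P R' (R' \<inter> S) b)"
proof -
  define S' where "S' = R \<union> R' - S"
  have e: "S \<union> S' = R \<union> R'" "R \<inter> S \<union> R \<inter> S' = R" "R' \<inter> S \<union> R' \<inter> S' = R'"
    "R \<inter> S \<union> R' \<inter> S = S" "R \<inter> S' \<union> R' \<inter> S' = S'"
    using S by (auto simp: S'_def)
  have fin: "finite R" "finite R'" "finite S" "finite S'"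
    using d S finite_subset by (auto simp: disj_def S'_def)
  have dj: "disj S S'" "disj (R \<inter> S) (R \<inter> S')" "disj (R' \<inter> S) (R' \<inter> S')"
      "disj (R \<inter> S) (R' \<inter> S)" "disj (R \<inter> S') (R' \<inter> S')"
    using fin d by (auto simp: disj_def S'_def)
  let ?A = "R \<inter> S" and ?B = "R \<inter> S'" and ?A' = "R' \<inter> S" and ?B' = "R' \<inter> S'"
  define a1 a2 b1 b2 where "a1 = rest h P R ?A a" "a2 = rest h P R ?B a"
    "b1 = rest h P R' ?A' b" "b2 = rest h P R' ?B' b"
  have m: "a1 \<in> P ?A" "a2 \<in> P ?B" "b1 \<in> P ?A'" "b2 \<in> P ?B'"
    unfolding a1_a2_b1_b2_def using fin a b by (auto intro: rest_P)
  have s: "a1 \<in> sp h ?A" "a2 \<in> sp h ?B" "b1 \<in> sp h ?A'" "b2 \<in> sp h ?B'" "a \<in> sp h R" "b \<in> sp h R'"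
    using m a b P_sub fin by blast+
  have "delta h S S' (mult h R R' a b) = tensor_map (obj h S) (obj h S') (nabla h ?A ?A') (nabla h ?B ?B')
           (tensor_mid (obj h ?A) (obj h ?B) (obj h ?A') (obj h ?B')
             (tensor_map (obj2 h ?A ?B) (obj2 h ?A' ?B') (delta h ?A ?B) (delta h ?A' ?B') (tens h R R' a b)))"
    unfolding mult_def
    using hopf d dj(1) e(1) pure_in_tensor[OF s(5,6)]
    by (simp add: connected_hopf_monoid_def hopf_compatible_def Let_def)
  also have "tensor_map (obj2 h ?A ?B) (obj2 h ?A' ?B') (delta h ?A ?B) (delta h ?A' ?B') (tens h R R' a b) =
      pure (obj2 h ?A ?B) (obj2 h ?A' ?B') (delta h ?A ?B a) (delta h ?A' ?B' b)"
    using delta_lin[OF dj(2)] delta_lin[OF dj(3)] s unfolding e by (intro tensor_map_pure)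
  also have "delta h ?A ?B a = tens h ?A ?B a1 a2"
    using delta_rest[OF dj(2), of a] a unfolding e a1_a2_b1_b2_def by simp
  also have "delta h ?A' ?B' b = tens h ?A' ?B' b1 b2"
    using delta_rest[OF dj(3), of b] b unfolding e a1_a2_b1_b2_def by simp
  also have "tensor_mid (obj h ?A) (obj h ?B) (obj h ?A') (obj h ?B')
      (pure (obj2 h ?A ?B) (obj2 h ?A' ?B') (tens h ?A ?B a1 a2) (tens h ?A' ?B' b1 b2)) =
      pure (obj2 h ?A ?A') (obj2 h ?B ?B') (tens h ?A ?A' a1 b1) (tens h ?B ?B' a2 b2)"
    using s fin by (intro tensor_mid_pure vs) auto
  also have "tensor_map (obj h S) (obj h S') (nabla h ?A ?A') (nabla h ?B ?B') \<dots> =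
      tens h S S' (mult h ?A ?A' a1 b1) (mult h ?B ?B' a2 b2)"
    unfolding mult_def using nabla_lin[OF dj(4)] nabla_lin[OF dj(5)] s unfolding e
    by (intro tensor_map_pure pure_in_tensor)
  finally have "delta h S S' (mult h R R' a b) = tens h S S' (mult h ?A ?A' a1 b1) (mult h ?B ?B' a2 b2)" .
  moreover have "mult h ?A ?A' a1 b1 \<in> P S" "mult h ?B ?B' a2 b2 \<in> P S'"
    using mult_P[OF dj(4) m(1,3)] mult_P[OF dj(5) m(2,4)] by (simp_all add: e)
  ultimately have "rest h P (S \<union> S') S (mult h R R' a b) = mult h ?A ?A' a1 b1"
    by (intro rest_eqI[OF dj(1)])
  then show ?thesis by (simp add: e a1_a2_b1_b2_def)
qed

sublocale set_hopf P "mult h" "rest h P" "one_of h"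
proof
  show "mult h S T a b = mult h T S b a" if "disj S T" "a \<in> P S" "b \<in> P T" for S T a b
    using comm that P_sub[of S, THEN subsetD, of a] P_sub[of T, THEN subsetD, of b]
    unfolding commutative_def disj_def by blast
  show "mult h (R \<union> S) T (mult h R S a b) c = mult h R (S \<union> T) a (mult h S T b c)"
    if "disj R S" "disj R T" "disj S T" "a \<in> P R" "b \<in> P S" "c \<in> P T" for R S T a b c
    using hopf that P_sub[of R] P_sub[of S] P_sub[of T]
    by (auto simp: connected_hopf_monoid_def connected_monoid_def disj_def subset_iff)
  show "mult h {} S (one_of h) a = a" if "finite S" "a \<in> P S" for S a
    using hopf that P_sub[of S] by (auto simp: connected_hopf_monoid_def connected_monoid_def)
qed (fact P_finite P_one mult_P rest_P rest_self rest_rest rest_mult)+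

lemma nabla_image_iff:
  assumes "disj S T" "l \<in> P (S \<union> T)"
  shows "l \<in> nabla_image h S T \<longleftrightarrow> cut (S \<union> T) S l = l"
  using nabla_image_basis[OF species(2) product basis assms(1) mult_P[OF assms(1)] assms(2)]
    splits_mul_iff[OF assms] by simp

lemma indecomposables_iff:
  assumes "finite I"
  shows "l \<in> indecomposables h P I \<longleftrightarrow> indec I l"
proof -
  have "(\<forall>S T. disj S T \<and> S \<union> T = I \<and> S \<noteq> {} \<and> T \<noteq> {} \<longrightarrow> l \<notin> nabla_image h S T) \<longleftrightarrow>
      (\<forall>S\<subseteq>I. cut I S l = l \<longrightarrow> S = {} \<or> S = I)" (is "?L \<longleftrightarrow> ?R") if l: "l \<in> P I"
  proof (intro iffI allI impI)
    fix S assume ?L "S \<subseteq> I" "cut I S l = l"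
    moreover from this have "disj S (I - S)" "S \<union> (I - S) = I" using assms by (auto simp: disj_Diff)
    ultimately show "S = {} \<or> S = I" using nabla_image_iff[of S "I - S" l] l by auto
  next
    fix S T assume ?R "disj S T \<and> S \<union> T = I \<and> S \<noteq> {} \<and> T \<noteq> {}"
    then show "l \<notin> nabla_image h S T" using nabla_image_iff[of S T l] l by (auto simp: disj_def)
  qed
  then show ?thesis by (auto simp: indecomposables_def indec_def)
qed

sublocale strong_set_hopf P "mult h" "rest h P" "one_of h"
proof
  fix I l S assume I: "finite I" "indec I l" "S \<subseteq> I" "S \<noteq> {}"
  show "indec S (rest h P I S l)"
  proof (cases "S = I")
    case True
    then show ?thesis using I rest_self[of I l] by (simp add: indec_def)
  next
    case False
    have d: "disj S (I - S)" "S \<union> (I - S) = I" "finite S"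
      using I disj_Diff finite_subset[OF I(3,1)] by auto
    moreover have "I - S \<noteq> {}" "l \<in> indecomposables h P (S \<union> (I - S))"
      using False I d by (auto simp: indecomposables_iff)
    ultimately obtain a b where ab: "a \<in> indecomposables h P S" "b \<in> indecomposables h P (I - S)"
        "delta h S (I - S) l = tens h S (I - S) a b"
      using strong I unfolding strongly_linearized_def by metis
    then have ind: "indec S a" "indec (I - S) b" using I d by (auto simp: indecomposables_iff)
    then have "rest h P I S l = a"
      using rest_eqI[OF d(1) _ _ ab(3)] d(2) by (simp add: indec_def)
    then show ?thesis using ind by simp
  qed
qed

subsection \<open>The order and the Moebius numbers\<close>

lemma nabla_delta: "\<lbrakk>disj S T; l \<in> P (S \<union> T)\<rbrakk> \<Longrightarrow> nabla h S T (delta h S T l) = cut (S \<union> T) S l"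
proof -
  assume *: "disj S T" "l \<in> P (S \<union> T)"
  then have "S \<union> T - S = T" by (auto simp: disj_def)
  then show ?thesis using * by (simp add: delta_rest cut_def mult_def)
qed

lemma step_eq:
  assumes "finite I"
  shows "{(a, b). a \<in> P I \<and> b \<in> P I \<and> a \<noteq> b \<and>
     (\<exists>S T. disj S T \<and> S \<union> T = I \<and> a = nabla h S T (delta h S T b))} = step I"
proof -
  have "(\<exists>S T. disj S T \<and> S \<union> T = I \<and> a = nabla h S T (delta h S T b)) \<longleftrightarrow> (\<exists>S\<subseteq>I. a = cut I S b)"
    (is "?L \<longleftrightarrow> ?R") if "b \<in> P I" for a b
  proof
    show ?R if ?L using that nabla_delta \<open>b \<in> P I\<close> by blast
    assume ?R
    then obtain S where S: "S \<subseteq> I" "a = cut I S b" by blast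
    then have "disj S (I - S)" "S \<union> (I - S) = I" using disj_Diff assms by auto
    then show ?L using nabla_delta[of S "I - S" b] S \<open>b \<in> P I\<close> by metis
  qed
  then show ?thesis by (simp add: step_def cong: conj_cong)
qed

lemma preceq_eq: "finite I \<Longrightarrow> preceq h P I = le I"
  by (auto simp: fun_eq_iff preceq_def prec_def step_eq le_def rtrancl_eq_or_trancl)

lemma prec_eq: "finite I \<Longrightarrow> prec h P I = (\<lambda>x y. le I x y \<and> x \<noteq> y)"
  using step_trancl_irrefl[of I]
  by (auto simp: fun_eq_iff prec_def step_eq le_def rtrancl_eq_or_trancl)

lemma mu2_eq: "finite I \<Longrightarrow> mu2 h P I = mobius (P I) (\<lambda>x y. le I x y \<and> x \<noteq> y)"
  by (simp add: mu2_def prec_eq)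

lemma bottom_eq:
  assumes "finite I" "l \<in> P I" "discrete I z" "le I z l"
  shows "bottom_of h P I l = z"
  unfolding bottom_of_def preceq_eq[OF assms(1)] prec_eq[OF assms(1)]
proof (rule the_equality)
  show "z \<in> {l' \<in> P I. le I l' l} \<and> \<not> (\<exists>y\<in>{l' \<in> P I. le I l' l}. le I y z \<and> y \<noteq> z)"
    using assms discrete_le[OF assms(1,3)] by (auto simp: discrete_def)
  fix y assume y: "y \<in> {l' \<in> P I. le I l' l} \<and> \<not> (\<exists>x\<in>{l' \<in> P I. le I l' l}. le I x y \<and> x \<noteq> y)"
  then have "discrete I y"
    using assms le_trans unfolding discrete_iff_minimal[OF assms(1)] by blast
  then show "y = z" using y assms discrete_below_unique[OF assms(1)] by blast
qed

text \<open>All elements below \<open>l\<close> have the same bottom element, so this is the defining recursion of the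
  Moebius function on the interval from there to \<open>l\<close>.\<close>

lemma sum_mu1:
  assumes "finite I" "l \<in> P I"
  shows "(\<Sum>x | x \<in> P I \<and> le I x l. mu1 h P I x) = (if discrete I l then 1 else 0)"
proof -
  interpret finite_poset "P I" "le I" using assms(1) by (rule finite_poset_le)
  obtain z where z: "discrete I z" "le I z l" using discrete_below_ex[OF assms] by blast
  have bot: "bottom_of h P I x = z \<and> le I z x" if x: "x \<in> P I" "le I x l" for x
  proof -
    obtain y where y: "discrete I y" "le I y x" using discrete_below_ex[OF assms(1) x(1)] by blast
    have "le I y l" using y(2) x(2) by (rule set_hopf.le_trans[OF set_hopf_axioms])
    then have "y = z" using discrete_below_unique[OF assms(1) y(1) z(1) _ z(2) assms(2)] by blast
    then show ?thesis using bottom_eq[OF assms(1) x(1)] y by simp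
  qed
  have "(\<Sum>x | x \<in> P I \<and> le I x l. mu1 h P I x) = (\<Sum>x | x \<in> P I \<and> le I z x \<and> le I x l. mu z x)"
    using bot by (intro sum.cong) (auto simp: mu1_def mu2_eq[OF assms(1)])
  also have "\<dots> = (if z = l then 1 else 0)"
    using assms z by (intro mu_sum_lower) (auto simp: discrete_def)
  also have "z = l \<longleftrightarrow> discrete I l" using z discrete_le[OF assms(1)] by auto
  finally show ?thesis .
qed

sublocale strong_bottom_mobius P "mult h" "rest h P" "one_of h" "mu1 h P"
  by unfold_locales (rule sum_mu1)

subsection \<open>Relabelling\<close>

lemma act_lin: "\<lbrakk>finite S; inj_on \<sigma> S\<rbrakk> \<Longrightarrow> lin (obj h S) (obj h (\<sigma> ` S)) (act h S \<sigma>)"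
  using species by (auto simp: vector_species_def)

lemma act_P:
  assumes "finite S" "inj_on \<sigma> S" "a \<in> P S"
  shows "act h S \<sigma> a \<in> P (\<sigma> ` S)"
proof -
  have "act h S \<sigma> ` P S \<subseteq> P (\<sigma> ` S)"
    using basis assms(1,2) unfolding is_basis_def set_subspecies_def by simp
  then show ?thesis using assms(3) by (rule subsetD[OF _ imageI])
qed

lemma act_cong:
  assumes "finite S" "inj_on \<sigma> S" "\<And>i. i \<in> S \<Longrightarrow> \<sigma> i = \<sigma>' i" "x \<in> sp h S"
  shows "act h S \<sigma> x = act h S \<sigma>' x"
proof -
  have "\<forall>S \<sigma> \<sigma>'. finite S \<and> inj_on \<sigma> S \<and> (\<forall>i\<in>S. \<sigma> i = \<sigma>' i) \<longrightarrow>
      (\<forall>x\<in>sp h S. act h S \<sigma> x = act h S \<sigma>' x)"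
    using species(2) unfolding vector_species_def by (elim conjE)
  from this[rule_format, of S \<sigma> \<sigma>'] show ?thesis using assms by metis
qed

lemma act_id: "finite S \<Longrightarrow> x \<in> sp h S \<Longrightarrow> act h S id x = x"
  using species(2) by (simp add: vector_species_def)

lemma act_comp:
  assumes "finite S" "inj_on \<sigma> S" "inj_on \<tau> (\<sigma> ` S)" "x \<in> sp h S"
  shows "act h (\<sigma> ` S) \<tau> (act h S \<sigma> x) = act h S (\<tau> \<circ> \<sigma>) x"
  using species(2) assms by (simp add: vector_species_def)

text \<open>On \<open>sp h S\<close> the action of a map depends only on its values on \<open>S\<close>, so any left inverse of \<open>\<sigma>\<close> there
  acts as the inverse.\<close>

lemma act_inv:
  assumes "finite S" "inj_on \<sigma> S" "x \<in> sp h S"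
  shows "act h (\<sigma> ` S) (inv_into S \<sigma>) (act h S \<sigma> x) = x"
proof -
  have "act h (\<sigma> ` S) (inv_into S \<sigma>) (act h S \<sigma> x) = act h S (inv_into S \<sigma> \<circ> \<sigma>) x"
    using assms by (intro act_comp inj_on_inv_into) auto
  also have "\<dots> = act h S id x"
    using assms by (intro act_cong) (auto intro!: comp_inj_on inj_on_inv_into)
  finally show ?thesis using act_id assms by simp
qed

lemma inv_into_image_image: "inj_on \<sigma> S \<Longrightarrow> inv_into S \<sigma> ` \<sigma> ` S = S"
  by (simp add: image_comp comp_def)

lemma bij_act:
  assumes "finite S" "inj_on \<sigma> S"
  shows "bij_betw (act h S \<sigma>) (P S) (P (\<sigma> ` S))"
  unfolding bij_betw_def
proof
  show "inj_on (act h S \<sigma>) (P S)"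
    by (rule inj_on_inverseI) (rule act_inv[OF assms subsetD[OF P_sub[OF assms(1)]]])
  let ?\<tau> = "inv_into S \<sigma>"
  have \<tau>: "inj_on ?\<tau> (\<sigma> ` S)" "?\<tau> ` \<sigma> ` S = S" "finite (\<sigma> ` S)"
    using assms inj_on_inv_into[of "\<sigma> ` S" \<sigma> S] by (auto simp: inv_into_image_image)
  have "y \<in> act h S \<sigma> ` P S" if y: "y \<in> P (\<sigma> ` S)" for y
  proof
    have ys: "y \<in> sp h (\<sigma> ` S)" using y P_sub[OF \<tau>(3)] by blast
    have "act h S \<sigma> (act h (\<sigma> ` S) ?\<tau> y) = act h (\<sigma> ` S) (\<sigma> \<circ> ?\<tau>) y"
      using act_comp[OF \<tau>(3,1) _ ys, of \<sigma>] assms(2) unfolding \<tau>(2) .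
    also have "\<dots> = act h (\<sigma> ` S) id y"
      using \<tau>(3) ys by (intro act_cong) (auto simp: inj_on_def f_inv_into_f)
    also have "\<dots> = y" using \<tau>(3) ys by (rule act_id)
    finally show "y = act h S \<sigma> (act h (\<sigma> ` S) ?\<tau> y)" by simp
    show "act h (\<sigma> ` S) ?\<tau> y \<in> P S" using act_P[OF \<tau>(3,1) y] \<tau>(2) by simp
  qed
  then show "act h S \<sigma> ` P S = P (\<sigma> ` S)" using act_P[OF assms] by auto
qed

lemma act_mult:
  assumes "disj S T" "inj_on \<sigma> (S \<union> T)" "a \<in> P S" "b \<in> P T"
  shows "act h (S \<union> T) \<sigma> (mult h S T a b) = mult h (\<sigma> ` S) (\<sigma> ` T) (act h S \<sigma> a) (act h T \<sigma> b)"
proof -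
  have f: "finite S" "finite T" "inj_on \<sigma> S" "inj_on \<sigma> T"
    using assms by (auto simp: disj_def intro: inj_on_subset)
  have m: "a \<in> sp h S" "b \<in> sp h T" using f P_sub assms by blast+
  show ?thesis
    using product assms(1,2) pure_in_tensor[OF m] tensor_map_pure[OF act_lin[OF f(1,3)] act_lin[OF f(2,4)] m]
    unfolding mult_def is_product_def by metis
qed

lemma act_rest:
  assumes "finite I" "inj_on \<sigma> I" "S \<subseteq> I" "l \<in> P I"
  shows "rest h P (\<sigma> ` I) (\<sigma> ` S) (act h I \<sigma> l) = act h S \<sigma> (rest h P I S l)"
proof -
  define T where "T = I - S"
  have d: "disj S T" "S \<union> T = I" "\<sigma> ` S \<union> \<sigma> ` T = \<sigma> ` I" "disj (\<sigma> ` S) (\<sigma> ` T)"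
    using assms disj_Diff[of I S] inj_on_image_Int[OF assms(2), of S "I - S"]
    by (auto simp: disj_def T_def)
  have f: "finite S" "finite T" "inj_on \<sigma> S" "inj_on \<sigma> T"
    using d assms by (auto simp: disj_def intro: inj_on_subset)
  have m: "rest h P I S l \<in> P S" "rest h P I T l \<in> P T" using assms d by (auto intro!: rest_P)
  then have m': "rest h P I S l \<in> sp h S" "rest h P I T l \<in> sp h T" using f P_sub by blast+
  have "delta h (\<sigma> ` S) (\<sigma> ` T) (act h I \<sigma> l) =
       tensor_map (obj h (\<sigma> ` S)) (obj h (\<sigma> ` T)) (act h S \<sigma>) (act h T \<sigma>) (delta h S T l)"
    using coproduct d(1,2) assms P_sub[OF assms(1)] unfolding is_coproduct_def by blast
  also have "delta h S T l = tens h S T (rest h P I S l) (rest h P I T l)"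
    using delta_rest[OF d(1)] d(2) assms by simp
  also have "tensor_map (obj h (\<sigma> ` S)) (obj h (\<sigma> ` T)) (act h S \<sigma>) (act h T \<sigma>) \<dots> =
      tens h (\<sigma> ` S) (\<sigma> ` T) (act h S \<sigma> (rest h P I S l)) (act h T \<sigma> (rest h P I T l))"
    by (rule tensor_map_pure[OF act_lin[OF f(1,3)] act_lin[OF f(2,4)] m'])
  finally show ?thesis
    using rest_eqI[OF d(4) act_P[OF f(1,3) m(1)] act_P[OF f(2,4) m(2)]] d(3) by simp
qed

lemma act_cut:
  assumes "finite I" "inj_on \<sigma> I" "S \<subseteq> I" "l \<in> P I"
  shows "act h I \<sigma> (cut I S l) = cut (\<sigma> ` I) (\<sigma> ` S) (act h I \<sigma> l)"
proof -
  have "act h (S \<union> (I - S)) \<sigma> (cut I S l) = mult h (\<sigma> ` S) (\<sigma> ` (I - S))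
      (act h S \<sigma> (rest h P I S l)) (act h (I - S) \<sigma> (rest h P I (I - S) l))"
    unfolding cut_def using assms by (intro act_mult disj_Diff rest_P) (auto simp: Un_absorb1)
  moreover have "\<sigma> ` (I - S) = \<sigma> ` I - \<sigma> ` S" using assms by (intro inj_on_image_set_diff) auto
  moreover have "S \<union> (I - S) = I" using assms by blast
  ultimately show ?thesis
    using assms act_rest[OF assms(1,2), of "I - S" l] by (simp add: cut_def act_rest)
qed

lemma act_le:
  assumes "finite I" "inj_on \<sigma> I" "le I a b"
  shows "le (\<sigma> ` I) (act h I \<sigma> a) (act h I \<sigma> b)"
  using assms(3) unfolding le_def
proof (induction rule: rtrancl_induct)
  case (step b c)
  then obtain R where R: "R \<subseteq> I" "b = cut I R c" "c \<in> P I" by (auto simp: step_def)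
  have "le (\<sigma> ` I) (cut (\<sigma> ` I) (\<sigma> ` R) (act h I \<sigma> c)) (act h I \<sigma> c)"
    using assms R act_P by (intro cut_le) auto
  then have "le (\<sigma> ` I) (act h I \<sigma> b) (act h I \<sigma> c)" using R assms by (simp add: act_cut)
  with step.IH show ?case by (simp add: le_def)
qed auto

lemma act_le_iff:
  assumes "finite I" "inj_on \<sigma> I" "a \<in> P I" "b \<in> P I"
  shows "le (\<sigma> ` I) (act h I \<sigma> a) (act h I \<sigma> b) \<longleftrightarrow> le I a b"
proof
  assume le: "le (\<sigma> ` I) (act h I \<sigma> a) (act h I \<sigma> b)"
  have "inj_on (inv_into I \<sigma>) (\<sigma> ` I)" by (rule inj_on_inv_into) simp
  from act_le[OF _ this le] show "le I a b"
    using assms P_sub[OF assms(1)] by (simp add: act_inv inv_into_image_image subset_iff)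
qed (rule act_le[OF assms(1,2)])

lemma act_downset:
  assumes "finite I" "inj_on \<sigma> I" "l \<in> P I"
  shows "(\<Sum>y | y \<in> P (\<sigma> ` I) \<and> le (\<sigma> ` I) y (act h I \<sigma> l). F y) =
    (\<Sum>x | x \<in> P I \<and> le I x l. F (act h I \<sigma> x))"
proof (rule sum.reindex_bij_betw[symmetric], rule bij_betw_subset[OF bij_act[OF assms(1,2)]])
  show "act h I \<sigma> ` {x \<in> P I. le I x l} = {y \<in> P (\<sigma> ` I). le (\<sigma> ` I) y (act h I \<sigma> l)}"
    using bij_betw_imp_surj_on[OF bij_act[OF assms(1,2)], symmetric] assms act_le_iff by auto
qed auto

lemma act_upset:
  assumes "finite I" "inj_on \<sigma> I" "l \<in> P I"
  shows "(\<Sum>y | y \<in> P (\<sigma> ` I) \<and> le (\<sigma> ` I) (act h I \<sigma> l) y. F y) =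
    (\<Sum>x | x \<in> P I \<and> le I l x. F (act h I \<sigma> x))"
proof (rule sum.reindex_bij_betw[symmetric], rule bij_betw_subset[OF bij_act[OF assms(1,2)]])
  show "act h I \<sigma> ` {x \<in> P I. le I l x} = {y \<in> P (\<sigma> ` I). le (\<sigma> ` I) (act h I \<sigma> l) y}"
    using bij_betw_imp_surj_on[OF bij_act[OF assms(1,2)], symmetric] assms act_le_iff by auto
qed auto

lemma act_discrete:
  assumes "finite I" "inj_on \<sigma> I" "l \<in> P I"
  shows "discrete (\<sigma> ` I) (act h I \<sigma> l) \<longleftrightarrow> discrete I l"
proof -
  have i: "inj_on (act h I \<sigma>) (P I)" using bij_act[OF assms(1,2)] by (simp add: bij_betw_def)
  have "discrete (\<sigma> ` I) (act h I \<sigma> l) \<longleftrightarrow>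
      (\<forall>x\<in>P I. le (\<sigma> ` I) (act h I \<sigma> x) (act h I \<sigma> l) \<longrightarrow> act h I \<sigma> x = act h I \<sigma> l)"
    using discrete_iff_minimal[of "\<sigma> ` I" "act h I \<sigma> l"] act_P[OF assms] assms(1)
      bij_betw_imp_surj_on[OF bij_act[OF assms(1,2)], symmetric] by auto
  also have "\<dots> \<longleftrightarrow> discrete I l"
    using discrete_iff_minimal[OF assms(1)] assms act_le_iff[OF assms(1,2)] inj_onD[OF i] by blast
  finally show ?thesis .
qed

text \<open>Both sides have the same sums over down-sets, since relabelling preserves the order and
  discreteness.\<close>

lemma act_mu1:
  assumes "finite I" "inj_on \<sigma> I" "l \<in> P I"
  shows "mu1 h P (\<sigma> ` I) (act h I \<sigma> l) = mu1 h P I l"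
proof -
  interpret finite_poset "P I" "le I" using assms(1) by (rule finite_poset_le)
  show ?thesis
  proof (rule eq_if_downset_sums_eq[OF _ assms(3)])
    fix l assume l: "l \<in> P I"
    show "(\<Sum>x\<in>{x \<in> P I. le I x l}. mu1 h P (\<sigma> ` I) (act h I \<sigma> x)) = sum (mu1 h P I) {x \<in> P I. le I x l}"
      using act_downset[OF assms(1,2) l, of "mu1 h P (\<sigma> ` I)", symmetric] sum_mu1[OF assms(1) l]
        sum_mu1[of "\<sigma> ` I", OF _ act_P[OF assms(1,2) l]] assms act_discrete[OF assms(1,2) l] by simp
  qed
qed

end

section \<open>The power sum and monomial families\<close>

lemma Collect_times: "{x \<in> A \<times> B. Q (fst x) \<and> R (snd x)} = {x \<in> A. Q x} \<times> {y \<in> B. R y}"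
  by auto

context strongly_linearized_hopf
begin

abbreviation p :: "'l set \<Rightarrow> 'v \<Rightarrow> 'v" where "p \<equiv> p_elt h P"
abbreviation m :: "'l set \<Rightarrow> 'v \<Rightarrow> 'v" where "m \<equiv> m_elt h P"

lemma P_in_sp: "finite I \<Longrightarrow> l \<in> P I \<Longrightarrow> l \<in> sp h I"
  using P_sub by blast

lemma p_sp: "finite I \<Longrightarrow> p I l \<in> sp h I"
  unfolding p_elt_def by (intro carr_sum vs is_vspaceD(3)) (auto intro: P_in_sp)

lemma m_sp: "finite I \<Longrightarrow> m I l \<in> sp h I"
  unfolding m_elt_def by (intro carr_sum vs is_vspaceD(3) p_sp)

lemma sum_p:
  assumes "finite I" "l \<in> P I"
  shows "(\<Sum>x | x \<in> P I \<and> le I x l. p I x) = l"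
proof -
  interpret finite_poset "P I" "le I" using assms(1) by (rule finite_poset_le)
  show ?thesis
    by (rule mobius_inversion_below[OF vsp[OF assms(1)] _ assms(2)])
      (simp add: p_elt_def preceq_eq mu2_eq assms)
qed

lemma sum_m:
  assumes "finite I" "l \<in> P I"
  shows "(\<Sum>x | x \<in> P I \<and> le I l x. m I x) = p I l"
proof -
  interpret finite_poset "P I" "le I" using assms(1) by (rule finite_poset_le)
  show ?thesis
    by (rule mobius_inversion_above[OF vsp[OF assms(1)] _ assms(2)])
      (simp add: m_elt_def preceq_eq mu2_eq assms)
qed

lemma bilin_tens: "bilin (obj h S) (obj h T) (obj2 h S T) (tens h S T)"
  by (rule bilin_pure)

lemma bilin_sum_pairs:
  assumes "disj S T" "bilin (obj h S) (obj h T) Z b"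
    and "\<And>x. f x \<in> sp h S" "\<And>y. g y \<in> sp h T"
  shows "(\<Sum>x | x \<in> A \<times> B \<and> Q (fst x) \<and> R (snd x). b (f (fst x)) (g (snd x))) =
    b (\<Sum>x | x \<in> A \<and> Q x. f x) (\<Sum>y | y \<in> B \<and> R y. g y)"
  unfolding Collect_times using assms
  by (intro bilin_sum[symmetric, of _ _ Z]) (auto simp: disj_def vs)

lemma sum_p_pairs:
  assumes d: "disj S T" and b: "bilin (obj h S) (obj h T) Z b" and ac: "a \<in> P S" "c \<in> P T"
  shows "(\<Sum>x | x \<in> P S \<times> P T \<and> le S (fst x) a \<and> le T (snd x) c. b (p S (fst x)) (p T (snd x))) = b a c"
proof -
  have fin: "finite S" "finite T" using d by (auto simp: disj_def)
  show ?thesis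
    using bilin_sum_pairs[where f = "p S" and g = "p T" and A = "P S" and B = "P T" and Q = "\<lambda>x. le S x a" and R = "\<lambda>y. le T y c",
        OF d b p_sp[OF fin(1)] p_sp[OF fin(2)]]
    unfolding sum_p[OF fin(1) ac(1)] sum_p[OF fin(2) ac(2)] .
qed

lemma sum_m_pairs:
  assumes d: "disj S T" and b: "bilin (obj h S) (obj h T) Z b" and ac: "a \<in> P S" "c \<in> P T"
  shows "(\<Sum>x | x \<in> P S \<times> P T \<and> le S a (fst x) \<and> le T c (snd x). b (m S (fst x)) (m T (snd x))) =
    b (p S a) (p T c)"
proof -
  have fin: "finite S" "finite T" using d by (auto simp: disj_def)
  show ?thesis
    using bilin_sum_pairs[where f = "m S" and g = "m T" and A = "P S" and B = "P T" and Q = "\<lambda>x. le S a x" and R = "\<lambda>y. le T c y",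
        OF d b m_sp[OF fin(1)] m_sp[OF fin(2)]]
    unfolding sum_m[OF fin(1) ac(1)] sum_m[OF fin(2) ac(2)] .
qed

text \<open>Summed over the down-set of \<open>(a, b)\<close> in \<open>P S \<times> P T\<close>, both sides give \<open>a \<cdot> b\<close>.\<close>

lemma mult_p:
  assumes d: "disj S T" and a: "a \<in> P S" and b: "b \<in> P T"
  shows "mult h S T (p S a) (p T b) = p (S \<union> T) (mult h S T a b)"
proof -
  have fin: "finite S" "finite T" "finite (S \<union> T)" using d by (auto simp: disj_def)
  interpret prod: finite_poset "P S \<times> P T" "\<lambda>x y. le S (fst x) (fst y) \<and> le T (snd x) (snd y)"
    using fin by (intro finite_poset_prod finite_poset_le)
  have "mult h S T (p S (fst y)) (p T (snd y)) = p (S \<union> T) (mult h S T (fst y) (snd y))"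
    if "y \<in> P S \<times> P T" for y
    using _ that
  proof (rule prod.eq_if_downset_sums_eq)
    fix y assume "y \<in> P S \<times> P T"
    then obtain a b where y: "y = (a, b)" "a \<in> P S" "b \<in> P T" by auto
    show "(\<Sum>x | x \<in> P S \<times> P T \<and> le S (fst x) (fst y) \<and> le T (snd x) (snd y).
          mult h S T (p S (fst x)) (p T (snd x))) =
        (\<Sum>x | x \<in> P S \<times> P T \<and> le S (fst x) (fst y) \<and> le T (snd x) (snd y).
          p (S \<union> T) (mult h S T (fst x) (snd x)))"
      unfolding y(1) fst_conv snd_conv sum_p_pairs[OF d mult_bilin[OF d] y(2,3)]
        sum_below_mul[OF d y(2,3), of "p (S \<union> T)", symmetric]
      by (rule sum_p[OF fin(3) mul_closed[OF d y(2,3)], symmetric])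
  qed
  from this[of "(a, b)"] show ?thesis using a b by simp
qed

text \<open>Summed over the down-set of \<open>l\<close>, both sides give \<open>l|S \<otimes> l|T\<close>: on the right, the elements
  below \<open>l\<close> that split along \<open>S \<squnion> T\<close> are the products of elements below \<open>l|S\<close> and \<open>l|T\<close>.\<close>

lemma delta_p:
  assumes d: "disj S T" and l: "l \<in> P (S \<union> T)"
  shows "delta h S T (p (S \<union> T) l) = (if cut (S \<union> T) S l = l
    then tens h S T (p S (rest h P (S \<union> T) S l)) (p T (rest h P (S \<union> T) T l)) else 0)"
proof -
  let ?I = "S \<union> T"
  have fin: "finite S" "finite T" "finite ?I" using d by (auto simp: disj_def)
  interpret finite_poset "P ?I" "le ?I" using fin by (intro finite_poset_le)
  let ?t = "\<lambda>l. tens h S T (p S (rest h P ?I S l)) (p T (rest h P ?I T l))"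
  show ?thesis
  proof (rule eq_if_downset_sums_eq[OF _ l])
    fix l assume l: "l \<in> P ?I"
    have r: "rest h P ?I S l \<in> P S" "rest h P ?I T l \<in> P T" using fin l by (auto intro: rest_P)
    have "(\<Sum>x | x \<in> P ?I \<and> le ?I x l. delta h S T (p ?I x)) = delta h S T (\<Sum>x | x \<in> P ?I \<and> le ?I x l. p ?I x)"
      using fin by (intro lin_sum[OF vs delta_lin[OF d], symmetric] p_sp)
    also have "\<dots> = tens h S T (rest h P ?I S l) (rest h P ?I T l)"
      using sum_p[OF fin(3) l] delta_rest[OF d l] by simp
    also have "\<dots> = (\<Sum>x | x \<in> P S \<times> P T \<and> le S (fst x) (rest h P ?I S l) \<and> le T (snd x) (rest h P ?I T l).
        tens h S T (p S (fst x)) (p T (snd x)))"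
      by (rule sum_p_pairs[OF d bilin_tens r, symmetric])
    also have "\<dots> = (\<Sum>x | x \<in> P S \<times> P T \<and> le S (fst x) (rest h P ?I S l) \<and> le T (snd x) (rest h P ?I T l).
        ?t (mult h S T (fst x) (snd x)))"
      using d by (intro sum.cong refl) (auto simp: res_mul_left res_mul_right)
    also have "\<dots> = (\<Sum>x | x \<in> P ?I \<and> le ?I x l \<and> cut ?I S x = x. ?t x)"
      by (rule sum_below_splits[OF d l, symmetric])
    also have "\<dots> = (\<Sum>x | x \<in> P ?I \<and> le ?I x l. if cut ?I S x = x then ?t x else 0)"
      using finite_A by (intro sum.mono_neutral_cong_left) auto
    finally show "(\<Sum>x | x \<in> P ?I \<and> le ?I x l. delta h S T (p ?I x)) =
        (\<Sum>x | x \<in> P ?I \<and> le ?I x l. if cut ?I S x = x then ?t x else 0)" .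
  qed
qed

text \<open>Summed over the up-set of \<open>l\<close>, both sides give the coproduct of \<open>p l\<close>.  If \<open>l\<close> does not split along
  \<open>S \<squnion> T\<close>, then neither does any element above it.\<close>

lemma delta_m:
  assumes d: "disj S T" and l: "l \<in> P (S \<union> T)"
  shows "delta h S T (m (S \<union> T) l) = (if cut (S \<union> T) S l = l
    then tens h S T (m S (rest h P (S \<union> T) S l)) (m T (rest h P (S \<union> T) T l)) else 0)"
proof -
  let ?I = "S \<union> T"
  have fin: "finite S" "finite T" "finite ?I" using d by (auto simp: disj_def)
  interpret finite_poset "P ?I" "\<lambda>x y. le ?I y x" by (rule finite_poset_dual[OF finite_poset_le[OF fin(3)]])
  let ?t = "\<lambda>x l. tens h S T (x S (rest h P ?I S l)) (x T (rest h P ?I T l))"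
  show ?thesis
  proof (rule eq_if_downset_sums_eq[OF _ l])
    fix l assume l: "l \<in> P ?I"
    have r: "rest h P ?I S l \<in> P S" "rest h P ?I T l \<in> P T" using fin l by (auto intro: rest_P)
    have "(\<Sum>x | x \<in> P ?I \<and> le ?I l x. delta h S T (m ?I x)) = delta h S T (\<Sum>x | x \<in> P ?I \<and> le ?I l x. m ?I x)"
      using fin by (intro lin_sum[OF vs delta_lin[OF d], symmetric] m_sp)
    also have "\<dots> = (if cut ?I S l = l then ?t p l else 0)"
      using sum_m[OF fin(3) l] delta_p[OF d l] by simp
    also have "\<dots> = (\<Sum>x | x \<in> P ?I \<and> le ?I l x \<and> cut ?I S x = x. ?t m x)"
    proof (cases "cut ?I S l = l")
      case True
      then obtain a b where ab: "a \<in> P S" "b \<in> P T" "l = mult h S T a b"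
        using splits_mul_iff[OF d l] by auto
      have "(\<Sum>x | x \<in> P ?I \<and> le ?I l x \<and> cut ?I S x = x. ?t m x) =
          (\<Sum>x | x \<in> P S \<times> P T \<and> le S a (fst x) \<and> le T b (snd x). ?t m (mult h S T (fst x) (snd x)))"
        unfolding ab(3) by (rule sum_above_splits[OF d ab(1,2)])
      also have "\<dots> = (\<Sum>x | x \<in> P S \<times> P T \<and> le S a (fst x) \<and> le T b (snd x).
          tens h S T (m S (fst x)) (m T (snd x)))"
        using d by (intro sum.cong refl) (auto simp: res_mul_left res_mul_right)
      also have "\<dots> = tens h S T (p S a) (p T b)"
        by (rule sum_m_pairs[OF d bilin_tens ab(1,2)])
      also have "\<dots> = ?t p l" using ab d by (simp add: res_mul_left res_mul_right)
      finally show ?thesis using True by simp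
    next
      case False
      then have "{x. x \<in> P ?I \<and> le ?I l x \<and> cut ?I S x = x} = {}"
        using le_splits[OF fin(3)] by blast
      then show ?thesis using False by (simp only: if_False sum.empty)
    qed
    also have "\<dots> = (\<Sum>x | x \<in> P ?I \<and> le ?I l x. if cut ?I S x = x then ?t m x else 0)"
      using finite_A by (intro sum.mono_neutral_cong_left) auto
    finally show "(\<Sum>x | x \<in> P ?I \<and> le ?I l x. delta h S T (m ?I x)) =
        (\<Sum>x | x \<in> P ?I \<and> le ?I l x. if cut ?I S x = x then ?t m x else 0)" .
  qed
qed

text \<open>Summed over the up-set of \<open>(a, b)\<close> in \<open>P S \<times> P T\<close>, both sides give \<open>p (a \<cdot> b)\<close>: on the right, by
  adjointness, every \<open>g\<close> above \<open>a \<cdot> b\<close> is counted once, at the pair of its restrictions.\<close>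

lemma mult_m:
  assumes d: "disj S T" and a: "a \<in> P S" and b: "b \<in> P T"
  shows "mult h S T (m S a) (m T b) =
    (\<Sum>g | g \<in> P (S \<union> T) \<and> rest h P (S \<union> T) S g = a \<and> rest h P (S \<union> T) T g = b. m (S \<union> T) g)"
proof -
  let ?I = "S \<union> T"
  let ?G = "\<lambda>y. (\<Sum>g | g \<in> P ?I \<and> rest h P ?I S g = fst y \<and> rest h P ?I T g = snd y. m ?I g)"
  have fin: "finite S" "finite T" "finite ?I" using d by (auto simp: disj_def)
  interpret prod: finite_poset "P S \<times> P T" "\<lambda>y x. le S (fst x) (fst y) \<and> le T (snd x) (snd y)"
    by (rule finite_poset_dual[OF finite_poset_prod[OF finite_poset_le[OF fin(1)] finite_poset_le[OF fin(2)]]])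
  have "mult h S T (m S (fst y)) (m T (snd y)) = ?G y" if "y \<in> P S \<times> P T" for y
    using _ that
  proof (rule prod.eq_if_downset_sums_eq)
    fix y assume "y \<in> P S \<times> P T"
    then obtain a b where y: "y = (a, b)" "a \<in> P S" "b \<in> P T" by auto
    let ?U = "{x. x \<in> P S \<times> P T \<and> le S (fst y) (fst x) \<and> le T (snd y) (snd x)}"
    let ?V = "{g. g \<in> P ?I \<and> le ?I (mult h S T a b) g}"
    let ?r = "\<lambda>g. (rest h P ?I S g, rest h P ?I T g)"
    have V: "g \<in> ?V \<longleftrightarrow> g \<in> P ?I \<and> ?r g \<in> ?U" for g
      using mul_le_iff[OF d y(2,3), of g] y fin by (auto intro: rest_P)
    have "(\<Sum>x\<in>?U. mult h S T (m S (fst x)) (m T (snd x))) = mult h S T (p S a) (p T b)"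
      unfolding y(1) fst_conv snd_conv by (rule sum_m_pairs[OF d mult_bilin[OF d] y(2,3)])
    also have "\<dots> = (\<Sum>g\<in>?V. m ?I g)"
      using mult_p[OF d y(2,3)] sum_m[OF fin(3) mul_closed[OF d y(2,3)]] by simp
    also have "\<dots> = (\<Sum>x\<in>?U. \<Sum>g\<in>{g \<in> ?V. ?r g = x}. m ?I g)"
    proof (rule sum.group[symmetric])
      show "finite ?V" "finite ?U" using P_finite fin by simp_all
      show "?r ` ?V \<subseteq> ?U" using V by blast
    qed
    also have "\<dots> = (\<Sum>x\<in>?U. ?G x)"
    proof (rule sum.cong[OF refl])
      fix x assume "x \<in> ?U"
      then have "g \<in> ?V \<and> ?r g = x \<longleftrightarrow> g \<in> P ?I \<and> ?r g = x" for g using V[of g] by blast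
      then have "{g \<in> ?V. ?r g = x} = {g. g \<in> P ?I \<and> rest h P ?I S g = fst x \<and> rest h P ?I T g = snd x}"
        unfolding prod_eq_iff fst_conv snd_conv by blast
      then show "(\<Sum>g\<in>{g \<in> ?V. ?r g = x}. m ?I g) = ?G x" by (simp only:)
    qed
    finally show "(\<Sum>x\<in>?U. mult h S T (m S (fst x)) (m T (snd x))) = (\<Sum>x\<in>?U. ?G x)" .
  qed
  from this[of "(a, b)"] show ?thesis using a b by simp
qed

lemma act_p:
  assumes "finite I" "inj_on \<sigma> I" "l \<in> P I"
  shows "p (\<sigma> ` I) (act h I \<sigma> l) = act h I \<sigma> (p I l)"
proof -
  interpret finite_poset "P I" "le I" using assms(1) by (rule finite_poset_le)
  show ?thesis
  proof (rule eq_if_downset_sums_eq[OF _ assms(3)])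
    fix l assume l: "l \<in> P I"
    have "(\<Sum>x\<in>{x \<in> P I. le I x l}. p (\<sigma> ` I) (act h I \<sigma> x)) = act h I \<sigma> l"
      using act_downset[OF assms(1,2) l, of "p (\<sigma> ` I)"] sum_p[OF _ act_P[OF assms(1,2) l]] assms(1) by simp
    also have "\<dots> = act h I \<sigma> (\<Sum>x | x \<in> P I \<and> le I x l. p I x)" using sum_p[OF assms(1) l] by simp
    also have "\<dots> = (\<Sum>x | x \<in> P I \<and> le I x l. act h I \<sigma> (p I x))"
      using assms(1) by (intro lin_sum[OF vs act_lin[OF assms(1,2)]] p_sp)
    finally show "(\<Sum>x\<in>{x \<in> P I. le I x l}. p (\<sigma> ` I) (act h I \<sigma> x)) =
      (\<Sum>x\<in>{x \<in> P I. le I x l}. act h I \<sigma> (p I x))" .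
  qed
qed

lemma act_m:
  assumes "finite I" "inj_on \<sigma> I" "l \<in> P I"
  shows "m (\<sigma> ` I) (act h I \<sigma> l) = act h I \<sigma> (m I l)"
proof -
  interpret finite_poset "P I" "\<lambda>x y. le I y x" by (rule finite_poset_dual[OF finite_poset_le[OF assms(1)]])
  show ?thesis
  proof (rule eq_if_downset_sums_eq[OF _ assms(3)])
    fix l assume l: "l \<in> P I"
    have "(\<Sum>x\<in>{x \<in> P I. le I l x}. m (\<sigma> ` I) (act h I \<sigma> x)) = p (\<sigma> ` I) (act h I \<sigma> l)"
      using act_upset[OF assms(1,2) l, of "m (\<sigma> ` I)"] sum_m[OF _ act_P[OF assms(1,2) l]] assms(1) by simp
    also have "\<dots> = act h I \<sigma> (\<Sum>x | x \<in> P I \<and> le I l x. m I x)"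
      using sum_m[OF assms(1) l] act_p[OF assms(1,2) l] by simp
    also have "\<dots> = (\<Sum>x | x \<in> P I \<and> le I l x. act h I \<sigma> (m I x))"
      using assms(1) by (intro lin_sum[OF vs act_lin[OF assms(1,2)]] m_sp)
    finally show "(\<Sum>x\<in>{x \<in> P I. le I l x}. m (\<sigma> ` I) (act h I \<sigma> x)) =
      (\<Sum>x\<in>{x \<in> P I. le I l x}. act h I \<sigma> (m I x))" .
  qed
qed

lemma p_one: "p {} (one_of h) = one_of h"
proof -
  have "{x. x \<in> P {} \<and> le {} x (one_of h)} = {one_of h}" using P_one by auto
  then show ?thesis using sum_p[of "{}" "one_of h"] P_one by simp
qed

lemma m_one: "m {} (one_of h) = one_of h"
proof -
  have "{x. x \<in> P {} \<and> le {} (one_of h) x} = {one_of h}" using P_one by auto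
  then show ?thesis using sum_m[of "{}" "one_of h"] P_one p_one by simp
qed

subsection \<open>Families that form bases\<close>

text \<open>Besides the basis property of the set of values, this records that the indexing by \<open>P\<close> is injective
  and natural, as needed for changes of basis to be well defined and natural.\<close>

definition basis_family :: "('l set \<Rightarrow> 'v \<Rightarrow> 'v) \<Rightarrow> bool" where
  "basis_family x \<longleftrightarrow> is_basis h (family_set P x) \<and>
    (\<forall>I. finite I \<longrightarrow> inj_on (x I) (P I)) \<and>
    (\<forall>I \<sigma>. finite I \<and> inj_on \<sigma> I \<longrightarrow> (\<forall>l\<in>P I. x (\<sigma> ` I) (act h I \<sigma> l) = act h I \<sigma> (x I l))) \<and>
    x {} (one_of h) = one_of h"

text \<open>A generating family indexed by a finite basis is itself a basis, by counting.\<close>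

lemma basis_familyI:
  assumes carr: "\<And>I l. finite I \<Longrightarrow> l \<in> P I \<Longrightarrow> x I l \<in> sp h I"
    and span: "\<And>I l. finite I \<Longrightarrow> l \<in> P I \<Longrightarrow> l \<in> module.span (smul (obj h I)) (x I ` P I)"
    and act: "\<And>I \<sigma> l. finite I \<Longrightarrow> inj_on \<sigma> I \<Longrightarrow> l \<in> P I \<Longrightarrow> x (\<sigma> ` I) (act h I \<sigma> l) = act h I \<sigma> (x I l)"
    and one: "x {} (one_of h) = one_of h"
  shows "basis_family x"
proof -
  have *: "\<not> module.dependent (smul (obj h I)) (x I ` P I) \<and>
      module.span (smul (obj h I)) (x I ` P I) = sp h I \<and> inj_on (x I) (P I)" if I: "finite I" for I
  proof -
    interpret vector_space "smul (obj h I)" using I by (rule vsp)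
    have sub: "subspace (sp h I)" using vs[OF I] by (simp add: is_vspace_def)
    obtain B where B: "B \<subseteq> x I ` P I" "independent B" "x I ` P I \<subseteq> span B"
      using maximal_independent_subset by blast
    have finB: "finite B" using B(1) P_finite[OF I] finite_subset by blast
    have sp: "P I \<subseteq> span (x I ` P I)" "span (x I ` P I) \<subseteq> span B"
      using span[OF I] B(3) span_minimal[OF B(3) subspace_span] by auto
    then have "card (P I) \<le> card B"
      using independent_span_bound[OF finB P_indep[OF I]] by blast
    then have c: "card (P I) \<le> card (x I ` P I)" "card (x I ` P I) \<le> card B"
      using card_mono[OF _ B(1)] card_image_le[OF P_finite[OF I], of "x I"] P_finite[OF I]
      by (auto intro: order_trans)
    have "B = x I ` P I" using B(1) c(2) P_finite[OF I] by (intro card_seteq) auto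
    moreover have "inj_on (x I) (P I)"
      using c(1) card_image_le[OF P_finite[OF I], of "x I"] P_finite[OF I] by (intro eq_card_imp_inj_on) auto
    moreover have "span (x I ` P I) = sp h I"
    proof
      show "span (x I ` P I) \<subseteq> sp h I" using carr[OF I] by (intro span_minimal sub) auto
      show "sp h I \<subseteq> span (x I ` P I)"
        using span_minimal[OF sp(1) subspace_span] P_span[OF I] by simp
    qed
    ultimately show ?thesis using B by simp
  qed
  have "act h I \<sigma> ` x I ` P I \<subseteq> x (\<sigma> ` I) ` P (\<sigma> ` I)" if "finite I" "inj_on \<sigma> I" for I \<sigma>
    using act[OF that, symmetric] act_P[OF that] by auto
  then have "is_basis h (family_set P x)"
    using * carr one unfolding is_basis_def set_subspecies_def family_set_def by (auto simp: P_one)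
  then show ?thesis using * act one unfolding basis_family_def by blast
qed

lemma span_p:
  assumes "finite I" and "\<And>l. l \<in> P I \<Longrightarrow> p I l \<in> module.span (smul (obj h I)) X" and "l \<in> P I"
  shows "l \<in> module.span (smul (obj h I)) X"
proof -
  interpret vector_space "smul (obj h I)" using assms(1) by (rule vsp)
  have "(\<Sum>x | x \<in> P I \<and> le I x l. p I x) \<in> span X" using assms(2) by (intro span_sum) auto
  then show ?thesis using sum_p[OF assms(1,3)] by simp
qed

lemma basis_family_p: "basis_family p"
proof (rule basis_familyI)
  fix I l assume I: "finite I" "l \<in> P I"
  interpret vector_space "smul (obj h I)" using I(1) by (rule vsp)
  show "l \<in> span (p I ` P I)" by (rule span_p[OF I(1) span_base I(2)]) (rule imageI)
qed (auto simp: p_sp act_p p_one)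

lemma basis_family_m: "basis_family m"
proof (rule basis_familyI)
  fix I l assume I: "finite I" "l \<in> P I"
  interpret vector_space "smul (obj h I)" using I(1) by (rule vsp)
  show "l \<in> span (m I ` P I)"
  proof (rule span_p[OF I(1) _ I(2)])
    fix l assume "l \<in> P I"
    moreover have "(\<Sum>x | x \<in> P I \<and> le I l x. m I x) \<in> span (m I ` P I)"
      by (rule span_sum, rule span_base) simp
    ultimately show "p I l \<in> span (m I ` P I)" using sum_m[OF I(1)] by simp
  qed
qed (auto simp: m_sp act_m m_one)

end

section \<open>Weighted sums of power sums\<close>

text \<open>The families \<open>e\<close> and \<open>h\<close> arise from the weights \<open>mu1\<close> and \<open>\<bar>mu1\<bar>\<close>.  Multiplicativity
  of the weights gives the formulas for product and coproduct, and they form a basis since the weights do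
  not vanish.\<close>

locale weighted_family = strongly_linearized_hopf h P
  for h :: "('l, 'k::field, 'v::ab_group_add) hopf" and P +
  fixes w :: "'l set \<Rightarrow> 'v \<Rightarrow> 'k"
  assumes w_mul: "\<lbrakk>disj S T; a \<in> P S; b \<in> P T\<rbrakk> \<Longrightarrow> w (S \<union> T) (mult h S T a b) = w S a * w T b"
    and w_nonzero: "\<lbrakk>finite I; l \<in> P I\<rbrakk> \<Longrightarrow> w I l \<noteq> 0"
    and w_act: "\<lbrakk>finite I; inj_on \<sigma> I; l \<in> P I\<rbrakk> \<Longrightarrow> w (\<sigma> ` I) (act h I \<sigma> l) = w I l"
begin

text \<open>With \<open>preceq\<close> instead of \<open>le\<close> the functions \<open>e_elt\<close> and \<open>h_elt\<close> are instances also at infinite \<open>I\<close>,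
  where the two relations may differ.\<close>

definition wsum :: "'l set \<Rightarrow> 'v \<Rightarrow> 'v" where
  "wsum I l = (\<Sum>x | x \<in> P I \<and> preceq h P I x l. smul (obj h I) (w I x) (p I x))"

lemma wsum_eq: "finite I \<Longrightarrow> wsum I l = (\<Sum>x | x \<in> P I \<and> le I x l. smul (obj h I) (w I x) (p I x))"
  by (simp add: wsum_def preceq_eq)

lemma wp_sp: "finite I \<Longrightarrow> smul (obj h I) (w I x) (p I x) \<in> sp h I"
  by (intro is_vspaceD(3) vs p_sp)

lemma wsum_sp: "finite I \<Longrightarrow> wsum I l \<in> sp h I"
  unfolding wsum_def by (intro carr_sum vs wp_sp)

lemma mult_wsum:
  assumes d: "disj S T" and a: "a \<in> P S" and b: "b \<in> P T"
  shows "mult h S T (wsum S a) (wsum T b) = wsum (S \<union> T) (mult h S T a b)"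
proof -
  have fin: "finite S" "finite T" "finite (S \<union> T)" using d by (auto simp: disj_def)
  have "mult h S T (wsum S a) (wsum T b) =
    (\<Sum>x | x \<in> P S \<times> P T \<and> le S (fst x) a \<and> le T (snd x) b.
      mult h S T (smul (obj h S) (w S (fst x)) (p S (fst x))) (smul (obj h T) (w T (snd x)) (p T (snd x))))"
    unfolding wsum_eq[OF fin(1)] wsum_eq[OF fin(2)]
    by (rule bilin_sum_pairs[OF d mult_bilin[OF d] wp_sp[OF fin(1)] wp_sp[OF fin(2)], symmetric])
  also have "\<dots> = (\<Sum>x | x \<in> P S \<times> P T \<and> le S (fst x) a \<and> le T (snd x) b.
      smul (obj h (S \<union> T)) (w (S \<union> T) (mult h S T (fst x) (snd x))) (p (S \<union> T) (mult h S T (fst x) (snd x))))"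
  proof (rule sum.cong[OF refl])
    fix x assume "x \<in> {x. x \<in> P S \<times> P T \<and> le S (fst x) a \<and> le T (snd x) b}"
    then have "fst x \<in> P S" "snd x \<in> P T" by auto
    then show "mult h S T (smul (obj h S) (w S (fst x)) (p S (fst x))) (smul (obj h T) (w T (snd x)) (p T (snd x))) =
      smul (obj h (S \<union> T)) (w (S \<union> T) (mult h S T (fst x) (snd x))) (p (S \<union> T) (mult h S T (fst x) (snd x)))"
      using bilin_scale[OF vs[OF fin(1)] vs[OF fin(2)] vs[OF fin(3)] mult_bilin[OF d] p_sp[OF fin(1)] p_sp[OF fin(2)]]
      by (simp only: w_mul[OF d] mult_p[OF d])
  qed
  also have "\<dots> = wsum (S \<union> T) (mult h S T a b)"
    unfolding wsum_eq[OF fin(3)] by (rule sum_below_mul[OF d a b, symmetric])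
  finally show ?thesis .
qed

text \<open>Only the elements below \<open>l\<close> that split along \<open>S \<squnion> T\<close> survive, and these are the products of
  elements below the two restrictions of \<open>l\<close>.\<close>

lemma delta_wsum:
  assumes d: "disj S T" and l: "l \<in> P (S \<union> T)"
  shows "delta h S T (wsum (S \<union> T) l) =
    tens h S T (wsum S (rest h P (S \<union> T) S l)) (wsum T (rest h P (S \<union> T) T l))"
proof -
  let ?I = "S \<union> T"
  have fin: "finite S" "finite T" "finite ?I" using d by (auto simp: disj_def)
  interpret T: vector_space "smul (obj2 h S T)" using is_vspace_tensor by (auto simp: is_vspace_def)
  let ?t = "\<lambda>l. smul (obj2 h S T) (w ?I l) (tens h S T (p S (rest h P ?I S l)) (p T (rest h P ?I T l)))"
  have "delta h S T (wsum ?I l) = (\<Sum>x | x \<in> P ?I \<and> le ?I x l. delta h S T (smul (obj h ?I) (w ?I x) (p ?I x)))"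
    unfolding wsum_eq[OF fin(3)] using fin by (intro lin_sum[OF vs delta_lin[OF d]] wp_sp)
  also have "\<dots> = (\<Sum>x | x \<in> P ?I \<and> le ?I x l \<and> cut ?I S x = x. ?t x)"
  proof (rule sum.mono_neutral_cong_right)
    fix x
    assume "x \<in> {x. x \<in> P ?I \<and> le ?I x l \<and> cut ?I S x = x}"
    then show "delta h S T (smul (obj h ?I) (w ?I x) (p ?I x)) = ?t x"
      using lin_scale[OF delta_lin[OF d] p_sp[OF fin(3)]] delta_p[OF d] by simp
  next
    show "\<forall>x\<in>{x. x \<in> P ?I \<and> le ?I x l} - {x. x \<in> P ?I \<and> le ?I x l \<and> cut ?I S x = x}.
        delta h S T (smul (obj h ?I) (w ?I x) (p ?I x)) = 0"
      unfolding lin_scale[OF delta_lin[OF d] p_sp[OF fin(3)]]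
      using delta_p[OF d] T.scale_zero_right by auto
  qed (use P_finite fin in auto)
  also have "\<dots> = (\<Sum>x | x \<in> P S \<times> P T \<and> le S (fst x) (rest h P ?I S l) \<and> le T (snd x) (rest h P ?I T l).
        ?t (mult h S T (fst x) (snd x)))"
    by (rule sum_below_splits[OF d l])
  also have "\<dots> = (\<Sum>x | x \<in> P S \<times> P T \<and> le S (fst x) (rest h P ?I S l) \<and> le T (snd x) (rest h P ?I T l).
        tens h S T (smul (obj h S) (w S (fst x)) (p S (fst x))) (smul (obj h T) (w T (snd x)) (p T (snd x))))"
  proof (rule sum.cong[OF refl])
    fix x assume "x \<in> {x. x \<in> P S \<times> P T \<and> le S (fst x) (rest h P ?I S l) \<and> le T (snd x) (rest h P ?I T l)}"
    then have "fst x \<in> P S" "snd x \<in> P T" by auto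
    then show "?t (mult h S T (fst x) (snd x)) =
      tens h S T (smul (obj h S) (w S (fst x)) (p S (fst x))) (smul (obj h T) (w T (snd x)) (p T (snd x)))"
      using bilin_scale[OF vs[OF fin(1)] vs[OF fin(2)] is_vspace_tensor bilin_tens p_sp[OF fin(1)] p_sp[OF fin(2)]]
      by (simp only: w_mul[OF d] res_mul_left[OF d] res_mul_right[OF d])
  qed
  also have "\<dots> = tens h S T (wsum S (rest h P ?I S l)) (wsum T (rest h P ?I T l))"
    unfolding wsum_eq[OF fin(1)] wsum_eq[OF fin(2)] by (rule bilin_sum_pairs[OF d bilin_tens wp_sp[OF fin(1)] wp_sp[OF fin(2)]])
  finally show ?thesis .
qed

lemma act_wsum:
  assumes I: "finite I" "inj_on \<sigma> I" and l: "l \<in> P I"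
  shows "wsum (\<sigma> ` I) (act h I \<sigma> l) = act h I \<sigma> (wsum I l)"
proof -
  have "wsum (\<sigma> ` I) (act h I \<sigma> l) =
      (\<Sum>x | x \<in> P I \<and> le I x l. smul (obj h (\<sigma> ` I)) (w (\<sigma> ` I) (act h I \<sigma> x)) (p (\<sigma> ` I) (act h I \<sigma> x)))"
    unfolding wsum_eq[OF finite_imageI[OF I(1)]] by (rule act_downset[OF I l])
  also have "\<dots> = (\<Sum>x | x \<in> P I \<and> le I x l. act h I \<sigma> (smul (obj h I) (w I x) (p I x)))"
    by (rule sum.cong[OF refl]) (simp add: w_act[OF I] act_p[OF I] lin_scale[OF act_lin[OF I] p_sp[OF I(1)]])
  also have "\<dots> = act h I \<sigma> (wsum I l)"
    unfolding wsum_eq[OF I(1)] using I by (intro lin_sum[OF vs act_lin[OF I], symmetric] wp_sp)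
  finally show ?thesis .
qed

lemma wsum_one: "wsum {} (one_of h) = one_of h"
proof -
  interpret vector_space "smul (obj h {})" by (rule vsp) simp
  have "mult h {} {} (one_of h) (one_of h) = one_of h" using mul_unit[of "{}" "one_of h"] P_one by simp
  then have "w {} (one_of h) = w {} (one_of h) * w {} (one_of h)"
    using w_mul[of "{}" "{}" "one_of h" "one_of h"] P_one by (simp add: disj_def)
  then have "w {} (one_of h) = 1" using w_nonzero[of "{}" "one_of h"] P_one by simp
  moreover have "{x. x \<in> P {} \<and> le {} x (one_of h)} = {one_of h}" using P_one by auto
  ultimately show ?thesis by (simp add: wsum_eq p_one)
qed

text \<open>The transition from \<open>p\<close> to \<open>wsum\<close> is triangular, with the weights on the diagonal.\<close>

lemma p_span_wsum:
  assumes I: "finite I" and "l \<in> P I"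
  shows "p I l \<in> module.span (smul (obj h I)) (wsum I ` P I)"
  using assms(2)
proof (induction "card {x \<in> P I. le I x l}" arbitrary: l rule: less_induct)
  case less
  interpret vector_space "smul (obj h I)" using I by (rule vsp)
  let ?D = "{x. x \<in> P I \<and> le I x l}"
  let ?s = "\<lambda>x. smul (obj h I) (w I x) (p I x)"
  have "wsum I l = ?s l + (\<Sum>x\<in>?D - {l}. ?s x)"
    unfolding wsum_eq[OF I] using less.prems P_finite[OF I] by (intro sum.remove) auto
  then have "?s l = wsum I l - (\<Sum>x\<in>?D - {l}. ?s x)" by simp
  also have "\<dots> \<in> span (wsum I ` P I)"
  proof (intro span_diff span_sum span_scale)
    show "wsum I l \<in> span (wsum I ` P I)" using less.prems by (intro span_base) simp
    fix x assume x: "x \<in> ?D - {l}"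
    show "p I x \<in> span (wsum I ` P I)"
    proof (rule less.hyps)
      have "\<not> le I l x" using x le_antisym[OF I, of l x] by auto
      then have "{y \<in> P I. le I y x} \<subset> {y \<in> P I. le I y l}"
        using x less.prems le_trans le_refl by blast
      then show "card {y \<in> P I. le I y x} < card {y \<in> P I. le I y l}"
        using P_finite[OF I] by (intro psubset_card_mono) auto
    qed (use x in auto)
  qed
  finally have "smul (obj h I) (inverse (w I l)) (?s l) \<in> span (wsum I ` P I)" by (rule span_scale)
  then show ?case using w_nonzero[OF I less.prems] by simp
qed

lemma basis_family_wsum: "basis_family wsum"
  by (rule basis_familyI) (simp_all add: wsum_sp act_wsum wsum_one span_p[OF _ p_span_wsum])

text \<open>The products of elements of \<open>wsum\<close> are indexed by the products in \<open>P\<close>, so \<open>wsum l\<close> is decomposable iff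
  \<open>l\<close> is.\<close>

lemma indecomposables_wsum:
  assumes I: "finite I"
  shows "indecomposables h (family_set P wsum) I = wsum I ` indecomposables h P I"
proof -
  have bas: "is_basis h (family_set P wsum)" and inj: "\<And>I. finite I \<Longrightarrow> inj_on (wsum I) (P I)"
    using basis_family_wsum by (auto simp: basis_family_def)
  have image: "wsum (S \<union> T) l \<in> nabla_image h S T \<longleftrightarrow> l \<in> nabla_image h S T"
    if d: "disj S T" and l: "l \<in> P (S \<union> T)" for S T l
  proof -
    have fin: "finite (S \<union> T)" using d by (auto simp: disj_def)
    have "wsum (S \<union> T) l \<in> nabla_image h S T \<longleftrightarrow>
        (\<exists>a\<in>P S. \<exists>b\<in>P T. wsum (S \<union> T) l = mult h S T (wsum S a) (wsum T b))"
    proof (subst nabla_image_basis[OF species(2) product bas d])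
      show "mult h S T a b \<in> family_set P wsum (S \<union> T)"
        if "a \<in> family_set P wsum S" "b \<in> family_set P wsum T" for a b
        using that mult_wsum[OF d] mult_P[OF d] by (auto simp: family_set_def)
    qed (use l in \<open>simp_all add: family_set_def\<close>)
    also have "\<dots> \<longleftrightarrow> (\<exists>a\<in>P S. \<exists>b\<in>P T. l = mult h S T a b)"
      using mult_wsum[OF d] mult_P[OF d] inj_on_eq_iff[OF inj[OF fin] l] by simp
    also have "\<dots> \<longleftrightarrow> l \<in> nabla_image h S T"
      using nabla_image_basis[OF species(2) product basis d mult_P[OF d] l] by simp
    finally show ?thesis .
  qed
  let ?Q = "\<lambda>l. \<forall>S T. disj S T \<and> S \<union> T = I \<and> S \<noteq> {} \<and> T \<noteq> {} \<longrightarrow> l \<notin> nabla_image h S T"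
  have "?Q (wsum I l) \<longleftrightarrow> ?Q l" if "l \<in> P I" for l
    by (intro arg_cong[where f = All] ext) (use image that in auto)
  then have "{v \<in> wsum I ` P I. ?Q v} = wsum I ` {l \<in> P I. ?Q l}" by blast
  then show ?thesis by (simp add: indecomposables_def family_set_def)
qed

lemma strongly_linearized_wsum: "strongly_linearized h (family_set P wsum)"
  unfolding strongly_linearized_def linearized_def
proof (intro conjI allI impI ballI)
  fix S T :: "'l set" assume d: "disj S T"
  have fin: "finite (S \<union> T)" using d by (auto simp: disj_def)
  show "mult h S T a b \<in> family_set P wsum (S \<union> T)" if "a \<in> family_set P wsum S" "b \<in> family_set P wsum T" for a b
    using that mult_wsum[OF d] mult_P[OF d] by (auto simp: family_set_def)
  show "\<exists>a\<in>family_set P wsum S. \<exists>b\<in>family_set P wsum T. delta h S T l = tens h S T a b"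
    if lw: "l \<in> family_set P wsum (S \<union> T)" for l
  proof -
    obtain k where k: "k \<in> P (S \<union> T)" "l = wsum (S \<union> T) k" using lw by (auto simp: family_set_def)
    have "rest h P (S \<union> T) S k \<in> P S" "rest h P (S \<union> T) T k \<in> P T"
      using fin k by (auto intro: rest_P)
    then show ?thesis using delta_wsum[OF d k(1)] k(2) unfolding family_set_def by blast
  qed
next
  fix S T :: "'l set" and l
  assume *: "disj S T \<and> S \<noteq> {} \<and> T \<noteq> {}" "l \<in> indecomposables h (family_set P wsum) (S \<union> T)"
  then have fin: "finite S" "finite T" "finite (S \<union> T)" and d: "disj S T" by (auto simp: disj_def)
  have "l \<in> wsum (S \<union> T) ` {k. indec (S \<union> T) k}"
    using *(2) indecomposables_iff[OF fin(3)] by (auto simp: indecomposables_wsum[OF fin(3)])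
  then obtain k where k: "l = wsum (S \<union> T) k" "indec (S \<union> T) k" by blast
  have "indec S (rest h P (S \<union> T) S k)" "indec T (rest h P (S \<union> T) T k)"
    using k * fin by (auto intro!: indec_res)
  moreover have "delta h S T l = tens h S T (wsum S (rest h P (S \<union> T) S k)) (wsum T (rest h P (S \<union> T) T k))"
    using k delta_wsum[OF d] by (simp add: indec_def)
  ultimately show "\<exists>a\<in>indecomposables h (family_set P wsum) S.
      \<exists>b\<in>indecomposables h (family_set P wsum) T. delta h S T l = tens h S T a b"
    unfolding indecomposables_wsum[OF fin(1)] indecomposables_wsum[OF fin(2)]
      indecomposables_iff[OF fin(1), symmetric] indecomposables_iff[OF fin(2), symmetric] by blast
qed

end

section \<open>Changes of basis\<close>

lemma bilin_eq_on_span: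
  assumes X: "is_vspace X" "A \<subseteq> carr X" "module.span (smul X) A = carr X"
    and Y: "is_vspace Y" "B \<subseteq> carr Y" "module.span (smul Y) B = carr Y"
    and b: "bilin X Y Z b" "bilin X Y Z b'"
    and eq: "\<And>x y. x \<in> A \<Longrightarrow> y \<in> B \<Longrightarrow> b x y = b' x y"
    and xy: "x \<in> carr X" "y \<in> carr Y"
  shows "b x y = b' x y"
proof -
  have lin: "lin Y Z (b x)" "lin Y Z (b' x)" if "x \<in> carr X" for x
    using b that by (simp_all add: bilin_def)
  have on_A: "b x y = b' x y" if "x \<in> A" for x
    using lin_eq_on_span[OF Y(1) lin[OF subsetD[OF X(2) that]] Y(2,3) eq[OF that] xy(2)] .
  have "lin X Z (\<lambda>x. b x y)" "lin X Z (\<lambda>x. b' x y)" using b xy(2) by (simp_all add: bilin_def)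
  from lin_eq_on_span[OF X(1) this X(2,3) on_A xy(1)] show ?thesis .
qed

context strongly_linearized_hopf
begin

lemma family_sub: "basis_family x \<Longrightarrow> finite I \<Longrightarrow> x I ` P I \<subseteq> sp h I"
  and family_indep: "basis_family x \<Longrightarrow> finite I \<Longrightarrow> \<not> module.dependent (smul (obj h I)) (x I ` P I)"
  and family_span: "basis_family x \<Longrightarrow> finite I \<Longrightarrow> module.span (smul (obj h I)) (x I ` P I) = sp h I"
  and family_inj: "basis_family x \<Longrightarrow> finite I \<Longrightarrow> inj_on (x I) (P I)"
  and family_act: "basis_family x \<Longrightarrow> finite I \<Longrightarrow> inj_on \<sigma> I \<Longrightarrow> l \<in> P I \<Longrightarrow>
    x (\<sigma> ` I) (act h I \<sigma> l) = act h I \<sigma> (x I l)"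
  and family_one: "basis_family x \<Longrightarrow> x {} (one_of h) = one_of h"
  by (simp_all add: basis_family_def is_basis_def set_subspecies_def family_set_def)

lemma family_sp: "basis_family x \<Longrightarrow> finite I \<Longrightarrow> l \<in> P I \<Longrightarrow> x I l \<in> sp h I"
  using family_sub by blast

lemma change_ex:
  assumes x: "basis_family x" and y: "basis_family y"
  shows "\<exists>f. change_of_basis h P x y f"
proof -
  have "\<exists>f. lin (obj h I) (obj h I) f \<and> (\<forall>l\<in>P I. f (x I l) = y I l)" if I: "finite I" for I
  proof -
    interpret vector_space "smul (obj h I)" using I by (rule vsp)
    interpret VV: vector_space_pair "smul (obj h I)" "smul (obj h I)" ..
    obtain f where f: "Vector_Spaces.linear (smul (obj h I)) (smul (obj h I)) f"
      "\<forall>v\<in>x I ` P I. f v = y I (inv_into (P I) (x I) v)"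
      using VV.linear_independent_extend[OF family_indep[OF x I], of "\<lambda>v. y I (inv_into (P I) (x I) v)"] by blast
    interpret f: Vector_Spaces.linear "smul (obj h I)" "smul (obj h I)" f by (fact f)
    have fx: "f (x I l) = y I l" if "l \<in> P I" for l
      using f(2) that family_inj[OF x I] by simp
    have "v \<in> sp h I \<longrightarrow> f v \<in> sp h I" for v
    proof
      assume "v \<in> sp h I"
      then have "f v \<in> f ` span (x I ` P I)" using family_span[OF x I] by simp
      also have "\<dots> = span (f ` x I ` P I)" by (rule f.span_image[symmetric])
      also have "f ` x I ` P I = y I ` P I" using fx by force
      finally show "f v \<in> sp h I" using family_span[OF y I] by simp
    qed
    then have "lin (obj h I) (obj h I) f" by (simp add: lin_def f.add f.scale)
    then show ?thesis using fx by blast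
  qed
  then have "\<forall>I. \<exists>f. finite I \<longrightarrow> lin (obj h I) (obj h I) f \<and> (\<forall>l\<in>P I. f (x I l) = y I l)" by blast
  then show ?thesis unfolding change_of_basis_def by (rule choice[THEN exE]) blast
qed

lemma change_species_hom:
  assumes x: "basis_family x" and y: "basis_family y" and f: "change_of_basis h P x y f"
  shows "connected_species_hom h h f"
  unfolding connected_species_hom_def
proof (intro conjI allI impI ballI)
  show "f {} (one_of h) = one_of h"
    using f P_one family_one[OF x] family_one[OF y] by (metis change_of_basis_def finite.emptyI insertI1)
  show lin: "lin (obj h S) (obj h S) (f S)" if "finite S" for S
    using f that by (simp add: change_of_basis_def)
  fix S :: "'l set" and \<sigma> :: "'l \<Rightarrow> 'l" and v assume S: "finite S \<and> inj_on \<sigma> S" and v: "v \<in> sp h S"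
  then have fin: "finite S" "inj_on \<sigma> S" "finite (\<sigma> ` S)" by auto
  show "f (\<sigma> ` S) (act h S \<sigma> v) = act h S \<sigma> (f S v)"
  proof (rule lin_eq_on_span[OF vs[OF fin(1)] _ _ family_sub[OF x fin(1)] family_span[OF x fin(1)] _ v])
    show "lin (obj h S) (obj h (\<sigma> ` S)) (\<lambda>v. f (\<sigma> ` S) (act h S \<sigma> v))"
      using act_lin[OF fin(1,2)] lin[OF fin(3)] by (rule lin_comp)
    show "lin (obj h S) (obj h (\<sigma> ` S)) (\<lambda>v. act h S \<sigma> (f S v))"
      using lin[OF fin(1)] act_lin[OF fin(1,2)] by (rule lin_comp)
    fix b assume "b \<in> x S ` P S"
    then obtain l where l: "l \<in> P S" "b = x S l" by blast
    have "f (\<sigma> ` S) (x (\<sigma> ` S) (act h S \<sigma> l)) = y (\<sigma> ` S) (act h S \<sigma> l)" "f S (x S l) = y S l"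
      using f fin l act_P[OF fin(1,2) l(1)] by (simp_all add: change_of_basis_def)
    then show "f (\<sigma> ` S) (act h S \<sigma> b) = act h S \<sigma> (f S b)"
      using l family_act[OF x fin(1,2) l(1)] family_act[OF y fin(1,2) l(1)] by simp
  qed
qed

lemma change_monoid_hom:
  assumes x: "basis_family x" and y: "basis_family y" and f: "change_of_basis h P x y f"
    and mx: "\<And>S T a b. \<lbrakk>disj S T; a \<in> P S; b \<in> P T\<rbrakk> \<Longrightarrow>
      mult h S T (x S a) (x T b) = x (S \<union> T) (mult h S T a b)"
    and my: "\<And>S T a b. \<lbrakk>disj S T; a \<in> P S; b \<in> P T\<rbrakk> \<Longrightarrow>
      mult h S T (y S a) (y T b) = y (S \<union> T) (mult h S T a b)"
  shows "connected_monoid_hom h h f"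
  unfolding connected_monoid_hom_def
proof (intro conjI allI impI ballI)
  show "connected_species_hom h h f" using x y f by (rule change_species_hom)
  fix S T :: "'l set" and t assume d: "disj S T" and t: "t \<in> carr (obj2 h S T)"
  have fin: "finite S" "finite T" "finite (S \<union> T)" using d by (auto simp: disj_def)
  have f_lin: "lin (obj h I) (obj h I) (f I)" and fx: "\<And>l. l \<in> P I \<Longrightarrow> f I (x I l) = y I l" if "finite I" for I
    using f that by (auto simp: change_of_basis_def)
  have m_lin: "lin (obj2 h S T) (obj2 h S T) (tensor_map (obj h S) (obj h T) (f S) (f T))"
    using fin by (intro lin_tensor_map f_lin)
  have L1: "lin (obj2 h S T) (obj h (S \<union> T)) (\<lambda>t. f (S \<union> T) (nabla h S T t))"
    using nabla_lin[OF d] f_lin[OF fin(3)] by (rule lin_comp)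
  have L2: "lin (obj2 h S T) (obj h (S \<union> T)) (\<lambda>t. nabla h S T (tensor_map (obj h S) (obj h T) (f S) (f T) t))"
    using m_lin nabla_lin[OF d] by (rule lin_comp)
  show "f (S \<union> T) (nabla h S T t) = nabla h S T (tensor_map (obj h S) (obj h T) (f S) (f T) t)"
  proof (rule tensor_lin_unique[OF L1 L2 _ t])
    fix u v assume u: "u \<in> sp h S" and v: "v \<in> sp h T"
    show "f (S \<union> T) (nabla h S T (tens h S T u v)) =
        nabla h S T (tensor_map (obj h S) (obj h T) (f S) (f T) (tens h S T u v))"
    proof (rule bilin_eq_on_span[OF vs[OF fin(1)] family_sub[OF x fin(1)] family_span[OF x fin(1)]
          vs[OF fin(2)] family_sub[OF x fin(2)] family_span[OF x fin(2)] _ _ _ u v])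
      show "bilin (obj h S) (obj h T) (obj h (S \<union> T)) (\<lambda>u v. f (S \<union> T) (nabla h S T (tens h S T u v)))"
        by (rule bilin_comp[OF bilin_tens L1])
      show "bilin (obj h S) (obj h T) (obj h (S \<union> T))
          (\<lambda>u v. nabla h S T (tensor_map (obj h S) (obj h T) (f S) (f T) (tens h S T u v)))"
        by (rule bilin_comp[OF bilin_tens L2])
      fix u v assume "u \<in> x S ` P S" "v \<in> x T ` P T"
      then obtain a b where ab: "a \<in> P S" "b \<in> P T" "u = x S a" "v = x T b" by blast
      have "f (S \<union> T) (mult h S T (x S a) (x T b)) = mult h S T (y S a) (y T b)"
        using mx[OF d ab(1,2)] my[OF d ab(1,2)] fx[OF fin(3) mult_P[OF d ab(1,2)]] by simp
      then show "f (S \<union> T) (nabla h S T (tens h S T u v)) =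
          nabla h S T (tensor_map (obj h S) (obj h T) (f S) (f T) (tens h S T u v))"
        using tensor_map_pure[OF f_lin[OF fin(1)] f_lin[OF fin(2)]
            family_sp[OF x fin(1) ab(1)] family_sp[OF x fin(2) ab(2)]] ab fx fin
        by (simp add: mult_def)
    qed
  qed
qed

text \<open>\<open>Q\<close> says for which \<open>l\<close> the coproduct is nonzero; it has to be the same for both families.  It is constantly
  true for \<open>e\<close> and \<open>h\<close>, and the splitting condition for \<open>p\<close> and \<open>m\<close>.\<close>

lemma change_comonoid_hom:
  assumes x: "basis_family x" and y: "basis_family y" and f: "change_of_basis h P x y f"
    and dx: "\<And>S T l. \<lbrakk>disj S T; l \<in> P (S \<union> T)\<rbrakk> \<Longrightarrow> delta h S T (x (S \<union> T) l) =
      (if Q S T l then tens h S T (x S (rest h P (S \<union> T) S l)) (x T (rest h P (S \<union> T) T l)) else 0)"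
    and dy: "\<And>S T l. \<lbrakk>disj S T; l \<in> P (S \<union> T)\<rbrakk> \<Longrightarrow> delta h S T (y (S \<union> T) l) =
      (if Q S T l then tens h S T (y S (rest h P (S \<union> T) S l)) (y T (rest h P (S \<union> T) T l)) else 0)"
  shows "connected_comonoid_hom h h f"
  unfolding connected_comonoid_hom_def
proof (intro conjI allI impI ballI)
  show "connected_species_hom h h f" using x y f by (rule change_species_hom)
  fix S T :: "'l set" and v assume d: "disj S T" and v: "v \<in> sp h (S \<union> T)"
  have fin: "finite S" "finite T" "finite (S \<union> T)" using d by (auto simp: disj_def)
  have f_lin: "lin (obj h I) (obj h I) (f I)" and fx: "\<And>l. l \<in> P I \<Longrightarrow> f I (x I l) = y I l" if "finite I" for I
    using f that by (auto simp: change_of_basis_def)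
  have m_lin: "lin (obj2 h S T) (obj2 h S T) (tensor_map (obj h S) (obj h T) (f S) (f T))"
    using fin by (intro lin_tensor_map f_lin)
  show "delta h S T (f (S \<union> T) v) = tensor_map (obj h S) (obj h T) (f S) (f T) (delta h S T v)"
  proof (rule lin_eq_on_span[OF vs[OF fin(3)] _ _ family_sub[OF x fin(3)] family_span[OF x fin(3)] _ v])
    show "lin (obj h (S \<union> T)) (obj2 h S T) (\<lambda>v. delta h S T (f (S \<union> T) v))"
      using f_lin[OF fin(3)] delta_lin[OF d] by (rule lin_comp)
    show "lin (obj h (S \<union> T)) (obj2 h S T) (\<lambda>v. tensor_map (obj h S) (obj h T) (f S) (f T) (delta h S T v))"
      using delta_lin[OF d] m_lin by (rule lin_comp)
    fix b assume "b \<in> x (S \<union> T) ` P (S \<union> T)"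
    then obtain l where l: "l \<in> P (S \<union> T)" "b = x (S \<union> T) l" by blast
    have r: "rest h P (S \<union> T) S l \<in> P S" "rest h P (S \<union> T) T l \<in> P T" using fin l by (auto intro: rest_P)
    have "tensor_map (obj h S) (obj h T) (f S) (f T)
        (tens h S T (x S (rest h P (S \<union> T) S l)) (x T (rest h P (S \<union> T) T l))) =
        tens h S T (y S (rest h P (S \<union> T) S l)) (y T (rest h P (S \<union> T) T l))"
      using tensor_map_pure[OF f_lin[OF fin(1)] f_lin[OF fin(2)]
          family_sp[OF x fin(1) r(1)] family_sp[OF x fin(2) r(2)]] fx r fin by simp
    then show "delta h S T (f (S \<union> T) b) = tensor_map (obj h S) (obj h T) (f S) (f T) (delta h S T b)"
      unfolding l(2) fx[OF fin(3) l(1)] dx[OF d l(1)] dy[OF d l(1)]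
      using lin_zero[OF is_vspace_tensor m_lin] by (simp only: split: if_split) blast
  qed
qed

text \<open>The inverse of a change of basis is any change of basis in the other direction, since their
  compositions fix the elements of a basis.\<close>

lemma natural_isoI:
  assumes x: "basis_family x" and y: "basis_family y"
    and hom: "\<And>f. change_of_basis h P x y f \<Longrightarrow> hom h h f" "\<And>f. change_of_basis h P y x f \<Longrightarrow> hom h h f"
  shows "natural_iso hom h P x y"
proof -
  have inv: "g I (f I v) = v"
    if x: "basis_family x" and f: "change_of_basis h P x y f" and g: "change_of_basis h P y x g"
      and I: "finite I" and v: "v \<in> sp h I" for x y f g I v
  proof (rule lin_eq_on_span[OF vs[OF I] _ _ family_sub[OF x I] family_span[OF x I] _ v])
    show "lin (obj h I) (obj h I) (\<lambda>v. g I (f I v))"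
      using f g I lin_comp[of "obj h I" "obj h I" "f I" "obj h I" "g I"] by (simp add: change_of_basis_def)
  qed (use f g I in \<open>auto simp: change_of_basis_def lin_def\<close>)
  have "iso_in hom h h f" if f: "change_of_basis h P x y f" for f
  proof -
    obtain g where g: "change_of_basis h P y x g" using change_ex[OF y x] by blast
    show ?thesis
      unfolding iso_in_def using hom(1)[OF f] hom(2)[OF g] inv[OF x f g] inv[OF y g f] by blast
  qed
  then show ?thesis unfolding natural_iso_def using change_ex[OF x y] by blast
qed

end

section \<open>The four bases\<close>

theorem theorem4p7:
  fixes h :: "('l, 'k::field_char_0, 'v::ab_group_add) hopf"
    and P :: "'l set \<Rightarrow> 'v set"
  assumes "infinite (UNIV :: 'l set)"
    and "connected_hopf_monoid h"
    and "finite_dimensional h"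
    and "commutative h"
    and "cocommutative h"
    and "is_basis h P"
    and "strongly_linearized h P"
  shows
    "(\<forall>x \<in> {m_elt h P, p_elt h P, e_elt h P, h_elt h P}. is_basis h (family_set P x)) \<and>

     (\<forall>S T. disj S T \<longrightarrow>
       (\<forall>\<alpha>\<in>P S. \<forall>\<beta>\<in>P T.
          (\<forall>x \<in> {p_elt h P, e_elt h P, h_elt h P}.
             nabla h S T (tens h S T (x S \<alpha>) (x T \<beta>)) = x (S \<union> T) (mult h S T \<alpha> \<beta>)) \<and>
          (\<forall>y \<in> {m_elt h P}.
             nabla h S T (tens h S T (y S \<alpha>) (y T \<beta>)) =
             (\<Sum>\<gamma> \<in> {\<gamma> \<in> P (S \<union> T). res1 h P S T \<gamma> = \<alpha> \<and> res2 h P S T \<gamma> = \<beta>}. y (S \<union> T) \<gamma>))) \<and>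
       (\<forall>l\<in>P (S \<union> T).
          (\<forall>x \<in> {e_elt h P, h_elt h P}.
             delta h S T (x (S \<union> T) l) =
             tens h S T (x S (res1 h P S T l)) (x T (res2 h P S T l))) \<and>
          (\<forall>y \<in> {m_elt h P, p_elt h P}.
             delta h S T (y (S \<union> T) l) =
             (if l \<in> nabla_image h S T
              then tens h S T (y S (res1 h P S T l)) (y T (res2 h P S T l))
              else 0)))) \<and>

     natural_iso connected_monoid_hom h P (p_elt h P) (h_elt h P) \<and>
     natural_iso connected_monoid_hom h P (h_elt h P) (p_elt h P) \<and>
     natural_iso connected_comonoid_hom h P (p_elt h P) (m_elt h P) \<and>
     natural_iso connected_comonoid_hom h P (m_elt h P) (p_elt h P) \<and>
     natural_iso connected_hopf_hom h P (e_elt h P) (h_elt h P) \<and>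
     natural_iso connected_hopf_hom h P (h_elt h P) (e_elt h P) \<and>

     strongly_linearized h (family_set P (e_elt h P)) \<and>
     strongly_linearized h (family_set P (h_elt h P)) \<and>
     strongly_self_dual h (family_set P (p_elt h P))"
proof -
  interpret strongly_linearized_hopf h P
    using assms(2-7) by unfold_locales
  interpret e: weighted_family h P "\<lambda>I l. of_int (mu1 h P I l)"
    by unfold_locales (simp_all add: c_mul c_nonzero act_mu1)
  interpret a: weighted_family h P "\<lambda>I l. of_int \<bar>mu1 h P I l\<bar>"
    by unfold_locales (simp_all add: c_mul c_nonzero act_mu1 abs_mult)
  let ?e = "e_elt h P" and ?h = "h_elt h P"
  have e: "?e = e.wsum" by (simp add: fun_eq_iff e_elt_def e.wsum_def)
  have a: "?h = a.wsum" by (simp add: fun_eq_iff h_elt_def a.wsum_def)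
  have fam: "basis_family ?e" "basis_family ?h"
    unfolding e a by (rule e.basis_family_wsum a.basis_family_wsum)+
  have mult_e: "mult h S T (?e S \<alpha>) (?e T \<beta>) = ?e (S \<union> T) (mult h S T \<alpha> \<beta>)"
    and mult_h: "mult h S T (?h S \<alpha>) (?h T \<beta>) = ?h (S \<union> T) (mult h S T \<alpha> \<beta>)"
    if "disj S T" "\<alpha> \<in> P S" "\<beta> \<in> P T" for S T \<alpha> \<beta>
    unfolding e a using that by (rule e.mult_wsum a.mult_wsum)+
  have delta_e: "delta h S T (?e (S \<union> T) l) =
      tens h S T (?e S (rest h P (S \<union> T) S l)) (?e T (rest h P (S \<union> T) T l))"
    and delta_h: "delta h S T (?h (S \<union> T) l) =
      tens h S T (?h S (rest h P (S \<union> T) S l)) (?h T (rest h P (S \<union> T) T l))"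
    if "disj S T" "l \<in> P (S \<union> T)" for S T l
    unfolding e a using that by (rule e.delta_wsum a.delta_wsum)+
  have monoid: "natural_iso connected_monoid_hom h P p ?h" "natural_iso connected_monoid_hom h P ?h p"
    by (intro natural_isoI change_monoid_hom[where x = p and y = ?h] change_monoid_hom[where x = ?h and y = p]
        basis_family_p fam mult_p mult_h; assumption)+
  have comonoid: "natural_iso connected_comonoid_hom h P p m" "natural_iso connected_comonoid_hom h P m p"
    by (intro natural_isoI change_comonoid_hom[where x = p and y = m and Q = "\<lambda>S T l. cut (S \<union> T) S l = l"]
        change_comonoid_hom[where x = m and y = p and Q = "\<lambda>S T l. cut (S \<union> T) S l = l"]
        basis_family_p basis_family_m delta_p delta_m; assumption)+
  have hopf_hom: "connected_hopf_hom h h f"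
    if "change_of_basis h P ?e ?h f \<or> change_of_basis h P ?h ?e f" for f
    unfolding connected_hopf_hom_def
    using that change_monoid_hom[of ?e ?h f] change_monoid_hom[of ?h ?e f]
      change_comonoid_hom[of ?e ?h f "\<lambda>_ _ _. True"] change_comonoid_hom[of ?h ?e f "\<lambda>_ _ _. True"]
    by (auto simp: fam mult_e mult_h delta_e delta_h)
  have hopf_iso: "natural_iso connected_hopf_hom h P ?e ?h" "natural_iso connected_hopf_hom h P ?h ?e"
    by (intro natural_isoI fam; simp add: hopf_hom)+
  have bases: "\<forall>x\<in>{m, p, ?e, ?h}. is_basis h (family_set P x)"
    using basis_family_m basis_family_p fam by (auto simp: basis_family_def)
  have self_dual: "strongly_self_dual h (family_set P p)"
    unfolding strongly_self_dual_def
  proof (intro allI impI conjI ballI)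
    fix S T :: "'l set" assume d: "disj S T"
    then have fin: "finite S" "finite T" "finite (S \<union> T)" by (auto simp: disj_def)
    show "mult h S T a b \<in> family_set P p (S \<union> T)" if "a \<in> family_set P p S" "b \<in> family_set P p T" for a b
      using that mult_p[OF d] mult_P[OF d] by (auto simp: family_set_def)
    show "finite (family_set P p (S \<union> T))" using P_finite[OF fin(3)] by (simp add: family_set_def)
    show "family_set P p (S \<union> T) \<subseteq> nabla_image h S T \<union> {x \<in> sp h (S \<union> T). delta h S T x = 0}"
    proof
      fix x assume "x \<in> family_set P p (S \<union> T)"
      then obtain l where l: "l \<in> P (S \<union> T)" "x = p (S \<union> T) l" by (auto simp: family_set_def)
      show "x \<in> nabla_image h S T \<union> {x \<in> sp h (S \<union> T). delta h S T x = 0}"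
      proof (cases "cut (S \<union> T) S l = l")
        case True
        then obtain a b where ab: "a \<in> P S" "b \<in> P T" "l = mult h S T a b"
          using splits_mul_iff[OF d l(1)] by auto
        then have "x = nabla h S T (tens h S T (p S a) (p T b))"
          using mult_p[OF d ab(1,2)] l by (simp add: mult_def)
        moreover have "tens h S T (p S a) (p T b) \<in> carr (obj2 h S T)"
          using fin by (intro pure_in_tensor p_sp)
        ultimately show ?thesis by (auto simp: nabla_image_def)
      next
        case False
        then show ?thesis using delta_p[OF d l(1)] p_sp[OF fin(3)] l by simp
      qed
    qed
  qed
  have formulas: "(\<forall>\<alpha>\<in>P S. \<forall>\<beta>\<in>P T.
          (\<forall>x \<in> {p, ?e, ?h}.
             nabla h S T (tens h S T (x S \<alpha>) (x T \<beta>)) = x (S \<union> T) (mult h S T \<alpha> \<beta>)) \<and>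
          (\<forall>y \<in> {m}.
             nabla h S T (tens h S T (y S \<alpha>) (y T \<beta>)) =
             (\<Sum>\<gamma> \<in> {\<gamma> \<in> P (S \<union> T). res1 h P S T \<gamma> = \<alpha> \<and> res2 h P S T \<gamma> = \<beta>}. y (S \<union> T) \<gamma>))) \<and>
       (\<forall>l\<in>P (S \<union> T).
          (\<forall>x \<in> {?e, ?h}.
             delta h S T (x (S \<union> T) l) =
             tens h S T (x S (res1 h P S T l)) (x T (res2 h P S T l))) \<and>
          (\<forall>y \<in> {m, p}.
             delta h S T (y (S \<union> T) l) =
             (if l \<in> nabla_image h S T
              then tens h S T (y S (res1 h P S T l)) (y T (res2 h P S T l))
              else 0)))" if d: "disj S T" for S T
  proof (intro conjI ballI)
    fix \<alpha> \<beta> x assume ab: "\<alpha> \<in> P S" "\<beta> \<in> P T" and x: "x \<in> {p, ?e, ?h}"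
    show "nabla h S T (tens h S T (x S \<alpha>) (x T \<beta>)) = x (S \<union> T) (mult h S T \<alpha> \<beta>)"
      unfolding mult_def[of h S T "x S \<alpha>", symmetric]
      using x mult_p[OF d ab] mult_e[OF d ab] mult_h[OF d ab] by auto
  next
    fix \<alpha> \<beta> y assume ab: "\<alpha> \<in> P S" "\<beta> \<in> P T" and y: "y \<in> {m}"
    have "{\<gamma> \<in> P (S \<union> T). res1 h P S T \<gamma> = \<alpha> \<and> res2 h P S T \<gamma> = \<beta>} =
        {\<gamma>. \<gamma> \<in> P (S \<union> T) \<and> rest h P (S \<union> T) S \<gamma> = \<alpha> \<and> rest h P (S \<union> T) T \<gamma> = \<beta>}"
      using res1_eq_rest[OF d] res2_eq_rest[OF d] by auto
    then show "nabla h S T (tens h S T (y S \<alpha>) (y T \<beta>)) =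
        (\<Sum>\<gamma> \<in> {\<gamma> \<in> P (S \<union> T). res1 h P S T \<gamma> = \<alpha> \<and> res2 h P S T \<gamma> = \<beta>}. y (S \<union> T) \<gamma>)"
      using y mult_m[OF d ab] by (simp add: mult_def)
  next
    fix l x assume l: "l \<in> P (S \<union> T)" and x: "x \<in> {?e, ?h}"
    show "delta h S T (x (S \<union> T) l) = tens h S T (x S (res1 h P S T l)) (x T (res2 h P S T l))"
      unfolding res1_eq_rest[OF d] res2_eq_rest[OF d l]
      using x delta_e[OF d l] delta_h[OF d l] by auto
  next
    fix l y assume l: "l \<in> P (S \<union> T)" and y: "y \<in> {m, p}"
    show "delta h S T (y (S \<union> T) l) = (if l \<in> nabla_image h S T
        then tens h S T (y S (res1 h P S T l)) (y T (res2 h P S T l)) else 0)"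
      unfolding res1_eq_rest[OF d] res2_eq_rest[OF d l] nabla_image_iff[OF d l]
      using y delta_m[OF d l] delta_p[OF d l] by auto
  qed
  have lin: "strongly_linearized h (family_set P ?e)" "strongly_linearized h (family_set P ?h)"
    unfolding e a by (rule e.strongly_linearized_wsum a.strongly_linearized_wsum)+
  show ?thesis
    by (intro conjI allI impI bases formulas monoid comonoid hopf_iso lin self_dual; assumption)
qed

end
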